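(* Let $\ell=tp^n+k$ with integers $t\ge 0$, $1\le k\le p^n$, and suppose $\max(r+s-p^{n+1},0)+1\le\ell\le\min(r,s)$ and $m>0$. Assume that $t\le\min(r_n,s_n)$ and $\max(e,0)+1\le k\le m$. Then $\lambda_\ell=(r_n+s_n-2t)p^n+\mu_k$, so $(g-1)^{(r_n+s_n-2t)p^n}$ maps $D_{(r_n+s_n-t)p^n+R+S-k}$ to $D_{tp^n+R+S-k}$. Let $A=J(R,S)=(a_{i,j})$ and $D=J(p^n-R,p^n-S)=(d_{i,j})$. Then the following hold. (1) Define $z_\ell\in D_{tp^n+R+S-k}$ by \[z_\ell=\sum_{i=0}^t(-1)^i\sum_{j=1}^k a_{k+1-j,j}\,v_{ip^n+R-k+j,\,(t-i)p^n+S+1-j}+(-1)^{R}\sum_{i=0}^{t-1}(-1)^i\sum_{j=1}^{k-e}d_{k-e+1-j,j}\,v_{ip^n+R+S+j-k,\,(t-i)p^n+1-j}.\] Then $(g-1)^{\mu_k-1}(z_\ell)=x_{tp^n+k'}$. (2) Let $P$ be the $(t+1)\times(t+1)$ matrix and $Q$ the $t\times t$ matrix over $F$, both with $(i,j)$ entry $\binom{r_n+s_n-2t}{r_n-t+j-i}$ (both are invertible); let $X$ and $Y$ be the $(t+1)\times1$ and $t\times1$ matrices, respectively, with $(i,1)$ entry $(-1)^{i-1}$; and let $\zeta=P^{-1}X$ and $\eta=Q^{-1}Y$. Define $y_\ell\in D_{(r_n+s_n-t)p^n+R+S-k}$ by \[y_\ell=\sum_{i=0}^t\zeta_{i+1,1}\sum_{j=1}^k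 a_{k+1-j,j}\,v_{(r_n-t+i)p^n+R+j-k,\,(s_n-i)p^n+S+1-j}+(-1)^{R}\sum_{i=0}^{t-1}\eta_{i+1,1}\sum_{j=1}^{k-e}d_{k-e+1-j,j}\,v_{(r_n-t+i)p^n+R+S+j-k,\,(s_n-i)p^n+1-j}.\] Then $(g-1)^{(r_n+s_n-2t)p^n}(y_\ell)=z_\ell$.
   Context: $p$ is a prime, $F$ a field of characteristic $p$, $G=\langle g\rangle$ a cyclic group of order $q=p^a$ ($a$ a positive integer). $V_q$ is the indecomposable $FG$-module of dimension $q$, with ordered $F$-basis $(v_1,\dots,v_q)$ such that $gv_1=v_1$ and $gv_i=v_{i-1}+v_i$ for $i>1$; $V_i=\langle v_1,\dots,v_i\rangle$, and $V_1,\dots,V_q$ is a complete set of indecomposable $FG$-modules. Let $1\le r,s\le q$ and write $V_r\otimes V_s\cong V_{\lambda_1}\oplus\dots\oplus V_{\lambda_{\min(r,s)}}$ with $\lambda_1\ge\dots\ge\lambda_{\min(r,s)}>0$. Let $n$ be the unique nonnegative integer with $p^n\le\max(r,s)<p^{n+1}$, and write $r=r_np^n+R$, $s=s_np^n+S$ with integers $0\le r_n,s_n<p$ and $0\le R,S<p^n$ (the paper writes $R_{n-1},S_{n-1}$). Put $m=\min(R,S)$ and $e=R+S-p^n$. When $m>0$ write $V_R\otimes V_S\cong V_{\mu_1}\oplus\dots\oplus V_{\mu_m}$ with $\mu_1\ge\dots\ge\mu_m>0$, and for $1\le k\le m$ put $k_0=\min\{i\mid\mu_i=\mu_k\}$,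 $k_\infty=\max\{i\mid\mu_i=\mu_k\}$, $k'=k_0+k_\infty-k$. The elements $v_{i,j}=v_i\otimes g^{n-i}v_j$ ($1\le i\le r$, $1\le j\le s$) form a basis of $V_r\otimes V_s$ satisfying $(g-1)v_{i,j}=v_{i-1,j}+v_{i,j-1}$, with $v_{i,j}=0$ if $i\le0$ or $j\le0$. Put $D_d=\langle v_{i,j}\mid i+j=d+1\rangle$ for $1\le d\le r+s-1$ and $x_d=\sum_{i=1}^d(-1)^{i-1}v_{i,d+1-i}$ for $1\le d\le\min(r,s)$. Binomial coefficients $\binom cd$ are $0$ if $d<0$ or $d>c$, and are regarded as elements of $F$. Definition of the $r\times s$ matrix $J(r,s)$ over $F$, for any $1\le r,s\le q$ (with $\lambda_\ell$, $v_{i,j}$, $D_d$, $x_d$ taken for that pair $(r,s)$; any fixed integer $n$ in the exponent defining $v_{i,j}$ may be used). For $1\le\ell\le\min(r,s)$ let $\ell_0=\min\{i\mid\lambda_i=\lambda_\ell\}$. (i) If $\ell=\ell_0$, the entries $J(r,s)_{\ell+1-j,j}$, $1\le j\le\ell$, are the coefficients of the unique element $y=\sum_{j=1}^{\ell}J(r,s)_{\ell+1-j,j}\,v_{r-\ell+j,s+1-j}\in D_{r+s-\ell}$ with $(g-1)^{\lambda_\ell-1}(y)=x_{r+s+1-\ell-\lambda_\ell}$ (existence and uniqueness hold). (ii) If $\ell>\ell_0$, then $J(r,s)_{\ell+1-j,j}=(-1)^{\ell-\ell_0}J(r,s)_{\ell_0+1-j,j}$ for $1\le j\le\ell_0$ and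 $J(r,s)_{\ell+1-j,j}=0$ for $\ell_0<j\le\ell$. (iii) $J(r,s)_{i,j}=0$ if $i+j-1>\min(r,s)$. *)

theory Defs
  imports
    "HOL-Algebra.Generated_Groups"
    "HOL-Library.Function_Algebras"
    "HOL-Computational_Algebra.Computational_Algebra"
    "Jordan_Normal_Form.Gauss_Jordan_Elimination"
begin

section \<open>Coordinate spaces\<close>

text \<open>
  All vector spaces below are subspaces of function spaces \<open>'x \<Rightarrow> 'f\<close>; the pointwise
  addition comes from the function instances of the library.
\<close>

definition fscale :: "'f::field \<Rightarrow> ('x \<Rightarrow> 'f) \<Rightarrow> ('x \<Rightarrow> 'f)"  (infixr "*\<^sub>F" 75)
  where "c *\<^sub>F u = (\<lambda>x. c * u x)"

interpretation fs: vector_space "fscale :: 'f::field \<Rightarrow> ('x \<Rightarrow> 'f) \<Rightarrow> ('x \<Rightarrow> 'f)"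
  by standard (auto simp: fscale_def fun_eq_iff algebra_simps)

record ('g, 'v) gmodule =
  mod_space :: "'v set"
  mod_act :: "'g \<Rightarrow> 'v \<Rightarrow> 'v"

definition gmodule_iso ::
  "('g, 'b) monoid_scheme \<Rightarrow> ('g, 'x \<Rightarrow> 'f::field) gmodule \<Rightarrow> ('g, 'y \<Rightarrow> 'f) gmodule \<Rightarrow> bool"
  where "gmodule_iso G M N \<longleftrightarrow>
    (\<exists>\<phi>. bij_betw \<phi> (mod_space M) (mod_space N) \<and>
         (\<forall>u\<in>mod_space M. \<forall>w\<in>mod_space M. \<phi> (u + w) = \<phi> u + \<phi> w) \<and>
         (\<forall>c. \<forall>u\<in>mod_space M. \<phi> (c *\<^sub>F u) = c *\<^sub>F \<phi> u) \<and>
         (\<forall>h\<in>carrier G. \<forall>u\<in>mod_space M. \<phi> (mod_act M h u) = mod_act N h (\<phi> u)))"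

section \<open>The modules of a cyclic group with a chosen generator\<close>

text \<open>The basis vector with index \<open>0\<close> is \<open>0\<close>, in accordance with \<open>v\<^sub>i = 0\<close> for \<open>i \<le> 0\<close>.\<close>

definition vbasis :: "nat \<Rightarrow> nat \<Rightarrow> 'f::field"
  where "vbasis i = (\<lambda>j. if 1 \<le> i \<and> j = i then 1 else 0)"

definition gen_act :: "(nat \<Rightarrow> 'f::field) \<Rightarrow> (nat \<Rightarrow> 'f)"
  where "gen_act u = (\<lambda>i. if i = 0 then 0 else u i + u (Suc i))"

lemma gen_act_vbasis: "1 \<le> i \<Longrightarrow> gen_act (vbasis i) = vbasis (i - 1) + vbasis i"
  by (auto simp: gen_act_def vbasis_def fun_eq_iff)

text \<open>
  An element \<open>h = g\<^sup>k\<close> acts as the \<open>k\<close>-th power of the action of the generator \<open>g\<close>.  If \<open>G\<close> has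
  order \<open>q\<close>, a power of the characteristic, this does not depend on the choice of \<open>k\<close> on the span
  of the first \<open>q\<close> basis vectors.
\<close>

definition vact :: "('g, 'b) monoid_scheme \<Rightarrow> 'g \<Rightarrow> 'g \<Rightarrow> (nat \<Rightarrow> 'f::field) \<Rightarrow> (nat \<Rightarrow> 'f)"
  where "vact G g h = gen_act ^^ (LEAST k::nat. g [^]\<^bsub>G\<^esub> k = h)"

definition Vmod ::
  "('g, 'b) monoid_scheme \<Rightarrow> 'g \<Rightarrow> nat \<Rightarrow> ('g, nat \<Rightarrow> 'f::field) gmodule"
  where "Vmod G g d = \<lparr> mod_space = fs.span (vbasis ` {1..d}), mod_act = vact G g \<rparr>"

section \<open>Tensor products and direct sums\<close>

definition pure_tensor :: "('x \<Rightarrow> 'f::field) \<Rightarrow> ('y \<Rightarrow> 'f) \<Rightarrow> ('x \<times> 'y \<Rightarrow> 'f)"  (infixr "\<otimes>\<^sub>F" 76)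
  where "u \<otimes>\<^sub>F w = (\<lambda>(i, j). u i * w j)"

text \<open>
  For linear \<open>A\<close> and \<open>B\<close>, this is the linear map with \<open>u \<otimes> w \<mapsto> A u \<otimes> B w\<close>
  on the span of the pure tensors.
\<close>

definition tensor_map ::
  "(('x \<Rightarrow> 'f) \<Rightarrow> ('x \<Rightarrow> 'f)) \<Rightarrow> (('y \<Rightarrow> 'f) \<Rightarrow> ('y \<Rightarrow> 'f)) \<Rightarrow> ('x \<times> 'y \<Rightarrow> 'f::field) \<Rightarrow> ('x \<times> 'y \<Rightarrow> 'f)"
  where "tensor_map A B T = (\<lambda>(i, j). A (\<lambda>i'. B (\<lambda>j'. T (i', j')) j) i)"

lemma tensor_map_pure:
  assumes A: "\<And>c u. A (c *\<^sub>F u) = c *\<^sub>F A u" and B: "\<And>c w. B (c *\<^sub>F w) = c *\<^sub>F B w"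
  shows "tensor_map A B (u \<otimes>\<^sub>F w) = A u \<otimes>\<^sub>F B w"
proof -
  have "B (\<lambda>j'. u i' * w j') j = u i' * B w j" for i' j
    using B[of "u i'" w] by (simp add: fscale_def)
  moreover have "A (\<lambda>i'. u i' * B w j) i = A u i * B w j" for i j
    using A[of "B w j" u] by (simp add: fscale_def mult.commute)
  ultimately show ?thesis
    by (auto simp: tensor_map_def pure_tensor_def fun_eq_iff)
qed

definition tensor_module ::
  "('g, 'x \<Rightarrow> 'f::field) gmodule \<Rightarrow> ('g, 'y \<Rightarrow> 'f) gmodule \<Rightarrow> ('g, 'x \<times> 'y \<Rightarrow> 'f) gmodule"
  where "tensor_module M N =
    \<lparr> mod_space = fs.span {u \<otimes>\<^sub>F w | u w. u \<in> mod_space M \<and> w \<in> mod_space N},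
      mod_act = (\<lambda>h. tensor_map (mod_act M h) (mod_act N h)) \<rparr>"

definition direct_sum_module ::
  "('g, 'x \<Rightarrow> 'f::field) gmodule list \<Rightarrow> ('g, nat \<times> 'x \<Rightarrow> 'f) gmodule"
  where "direct_sum_module Ms =
    \<lparr> mod_space = {w. (\<forall>k<length Ms. (\<lambda>x. w (k, x)) \<in> mod_space (Ms ! k)) \<and>
                      (\<forall>k\<ge>length Ms. \<forall>x. w (k, x) = 0)},
      mod_act = (\<lambda>h w (k, x). if k < length Ms then mod_act (Ms ! k) h (\<lambda>x'. w (k, x')) x else 0) \<rparr>"

text \<open>
  \<open>[\<lambda>\<^sub>1, \<dots>, \<lambda>\<^sub>m]\<close> with \<open>m = min r s\<close>, \<open>\<lambda>\<^sub>1 \<ge> \<dots> \<ge> \<lambda>\<^sub>m > 0\<close> and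
  \<open>V\<^sub>r \<otimes> V\<^sub>s \<cong> V\<^bsub>\<lambda>\<^sub>1\<^esub> \<oplus> \<dots> \<oplus> V\<^bsub>\<lambda>\<^sub>m\<^esub>\<close>.  The field enters only through its type.
\<close>

definition tensor_parts ::
  "'f::field itself \<Rightarrow> ('g, 'b) monoid_scheme \<Rightarrow> 'g \<Rightarrow> nat \<Rightarrow> nat \<Rightarrow> nat list"
  where "tensor_parts F G g r s = (THE L.
     length L = min r s \<and> sorted_wrt (\<ge>) L \<and> (\<forall>d\<in>set L. 0 < d \<and> d \<le> Coset.order G) \<and>
     gmodule_iso G
       (tensor_module (Vmod G g r :: ('g, nat \<Rightarrow> 'f) gmodule) (Vmod G g s :: ('g, nat \<Rightarrow> 'f) gmodule))
       (direct_sum_module (map (Vmod G g) L)))"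

definition lam ::
  "'f::field itself \<Rightarrow> ('g, 'b) monoid_scheme \<Rightarrow> 'g \<Rightarrow> nat \<Rightarrow> nat \<Rightarrow> nat \<Rightarrow> nat"
  where "lam F G g r s l = tensor_parts F G g r s ! (l - 1)"

definition first_eq ::
  "'f::field itself \<Rightarrow> ('g, 'b) monoid_scheme \<Rightarrow> 'g \<Rightarrow> nat \<Rightarrow> nat \<Rightarrow> nat \<Rightarrow> nat"
  where "first_eq F G g r s l = Min {i \<in> {1..min r s}. lam F G g r s i = lam F G g r s l}"

definition last_eq ::
  "'f::field itself \<Rightarrow> ('g, 'b) monoid_scheme \<Rightarrow> 'g \<Rightarrow> nat \<Rightarrow> nat \<Rightarrow> nat \<Rightarrow> nat"
  where "last_eq F G g r s l = Max {i \<in> {1..min r s}. lam F G g r s i = lam F G g r s l}"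

section \<open>The elements \<open>v\<^sub>i\<^sub>,\<^sub>j\<close> and \<open>x\<^sub>d\<close> and the spaces \<open>D\<^sub>d\<close>\<close>

text \<open>The parameter \<open>c\<close> is the integer in the exponent: \<open>v\<^sub>i\<^sub>,\<^sub>j = v\<^sub>i \<otimes> g\<^bsup>c-i\<^esup> v\<^sub>j\<close>.\<close>

definition tbasis ::
  "('g, 'b) monoid_scheme \<Rightarrow> 'g \<Rightarrow> int \<Rightarrow> nat \<Rightarrow> nat \<Rightarrow> (nat \<times> nat \<Rightarrow> 'f::field)"
  where "tbasis G g c i j = vbasis i \<otimes>\<^sub>F vact G g (g [^]\<^bsub>G\<^esub> (c - int i)) (vbasis j)"

definition gminus1 ::
  "('g, 'b) monoid_scheme \<Rightarrow> 'g \<Rightarrow> (nat \<times> nat \<Rightarrow> 'f::field) \<Rightarrow> (nat \<times> nat \<Rightarrow> 'f)"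
  where "gminus1 G g T = tensor_map (vact G g g) (vact G g g) T - T"

definition Dspace ::
  "('g, 'b) monoid_scheme \<Rightarrow> 'g \<Rightarrow> int \<Rightarrow> nat \<Rightarrow> nat \<Rightarrow> nat \<Rightarrow> (nat \<times> nat \<Rightarrow> 'f::field) set"
  where "Dspace G g c r s d =
    fs.span {tbasis G g c i j | i j. i \<in> {1..r} \<and> j \<in> {1..s} \<and> i + j = d + 1}"

definition xvec ::
  "('g, 'b) monoid_scheme \<Rightarrow> 'g \<Rightarrow> int \<Rightarrow> nat \<Rightarrow> (nat \<times> nat \<Rightarrow> 'f::field)"
  where "xvec G g c d = (\<Sum>i=1..d. (-1) ^ (i - 1) *\<^sub>F tbasis G g c i (d + 1 - i))"

section \<open>The matrix \<open>J(r,s)\<close>\<close>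

text \<open>Matrices of the library have indices starting at \<open>0\<close>; the following two use \<open>1\<close>.\<close>

definition mat1 :: "nat \<Rightarrow> nat \<Rightarrow> (nat \<Rightarrow> nat \<Rightarrow> 'f) \<Rightarrow> 'f mat"
  where "mat1 nr nc f = mat nr nc (\<lambda>(i, j). f (i + 1) (j + 1))"

definition entry1 :: "'f mat \<Rightarrow> nat \<Rightarrow> nat \<Rightarrow> 'f"
  where "entry1 A i j = A $$ (i - 1, j - 1)"

text \<open>
  The coefficients of the unique \<open>y\<close> in \<open>D\<^bsub>r+s-l\<^esub>\<close> with
  \<open>(g - 1)\<^bsup>\<lambda>\<^sub>l - 1\<^esup> y = x\<^bsub>r+s+1-l-\<lambda>\<^sub>l\<^esub>\<close>, where \<open>l\<close> is the first index of its block of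
  equal parts; coefficients outside \<open>{1..l}\<close> are normalised to \<open>0\<close>.
\<close>

definition Jcoeff ::
  "('g, 'b) monoid_scheme \<Rightarrow> 'g \<Rightarrow> int \<Rightarrow> nat \<Rightarrow> nat \<Rightarrow> nat \<Rightarrow> nat \<Rightarrow> 'f::field"
  where "Jcoeff G g c r s l = (THE cf.
     (\<forall>j. j \<notin> {1..l} \<longrightarrow> cf j = 0) \<and>
     (let p\<^sub>l = lam TYPE('f) G g r s l;
          y = (\<Sum>j=1..l. cf j *\<^sub>F tbasis G g c (r - l + j) (s + 1 - j))
      in y \<in> Dspace G g c r s (r + s - l) \<and>
         (gminus1 G g ^^ (p\<^sub>l - 1)) y = xvec G g c (r + s + 1 - l - p\<^sub>l)))"

definition Jmat ::
  "('g, 'b) monoid_scheme \<Rightarrow> 'g \<Rightarrow> int \<Rightarrow> nat \<Rightarrow> nat \<Rightarrow> 'f::field mat"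
  where "Jmat G g c r s = mat1 r s (\<lambda>i j.
     let l = i + j - 1; l0 = first_eq TYPE('f) G g r s l in
     if l > min r s then 0
     else if l = l0 then Jcoeff G g c r s l j
     else if j \<le> l0 then (-1) ^ (l - l0) * Jcoeff G g c r s l0 j
     else 0)"

definition zbinom :: "nat \<Rightarrow> int \<Rightarrow> 'f::field"
  where "zbinom c d = (if d < 0 then 0 else of_nat (c choose nat d))"

end

theory Submission
  imports Defs "HOL-Algebra.Multiplicative_Group" "Jordan_Normal_Form.Determinant"
begin

text \<open>
  Identify \<open>V\<^sub>r \<otimes> V\<^sub>s\<close> with \<open>F[X, Y] / (X\<^sup>r, Y\<^sup>s)\<close>, where \<open>g - 1\<close> acts as multiplication by the linear
  form \<open>X + Y\<close>.  The vector \<open>x\<^sub>l\<close> spans a graded piece of the kernel of \<open>g - 1\<close>, so \<open>\<lambda>\<^sub>l - 1\<close> is the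
  largest \<open>j\<close> with \<open>x\<^sub>l\<close> in the image of \<open>(g - 1)\<^sup>j\<close>; since \<open>g - 1\<close> is self-adjoint for the pairing of
  complementary degrees, \<open>\<lambda>\<^sub>l\<close> is also the least \<open>j\<close> such that \<open>(g - 1)\<^sup>j\<close> kills a form of degree \<open>l - 1\<close>
  not divisible by \<open>X + Y\<close>.  Comparing the two descriptions, a maximal block \<open>i, \<dots>, j\<close> of indices
  with equal parts has parts \<open>r + s + 1 - i - j\<close>, and the entries of \<open>J(r, s)\<close> are the coefficients of
  such a form \<open>f\<close>, and \<open>(X + Y)\<^sup>\<lambda> f = 0\<close> lifts to a syzygy of \<open>X\<^sup>r, Y\<^sup>s, (X + Y)\<^sup>\<lambda>\<close> over \<open>F[X, Y]\<close>.

  Let \<open>w = p\<^sup>n\<close>.  As \<open>(X + Y)\<^sup>w = X\<^sup>w + Y\<^sup>w\<close>, a syzygy of \<open>X\<^sup>R, Y\<^sup>S, (X + Y)\<^sup>\<mu>\<close> yields one of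
  \<open>X\<^sup>w\<^sup>-\<^sup>R, Y\<^sup>w\<^sup>-\<^sup>S, (X + Y)\<^sup>\<mu>\<close>, which ties \<open>J(R, S)\<close> to \<open>J(w - R, w - S)\<close>.  Both matrices
  therefore enter \<open>z\<close> and \<open>y\<close> as combinations of the two forms with coefficients that are polynomials
  in \<open>X\<^sup>w, Y\<^sup>w\<close>; the images under powers of \<open>X\<^sup>w + Y\<^sup>w\<close> are computed one \<open>w\<close>-adic digit at a time.
  A Wronskian bound on the degrees of syzygies gives the invertibility of the binomial matrices and
  shows that \<open>y\<close> is not divisible by \<open>X + Y\<close>, hence determines \<open>\<lambda>\<^sub>l\<close>.
\<close>

hide_const (open) up_ring.coeff up_ring.monom module.smult Coset.order

text \<open>\<open>lam\<close> and \<open>Jcoeff\<close> are definite descriptions, so existence and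
  uniqueness have to be proved too. Hence the argument runs first for \<open>plam\<close>, which is
  defined by polynomial equations alone; \<open>lam = plam\<close> is obtained afterwards from
  explicit Jordan strings ending in the vectors \<open>x_l\<close>. Only the first index
  \<open>i\<close> of a block needs a construction. Rule (ii) for J is multiplication by
  \<open>(-X)^(k-i)\<close>, which also takes \<open>x_j\<close> to \<open>x_(i+j-k)\<close>; this
  is the origin of \<open>k'\<close>. The hypothesis \<open>k > e\<close> keeps the part below
  \<open>w\<close>, so that \<open>(X + Y)^w\<close> can be divided by \<open>(X + Y)^\<mu>\<close>;
  this division produces the dual form \<open>b\<close>. It enters as \<open>X^R Y^S b\<close>,
  whose degree exceeds that of \<open>a\<close> by \<open>w\<close>, that is by one digit: hence
  \<open>t + 1\<close> coefficients go with \<open>a\<close> and \<open>t\<close> with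
  \<open>b\<close>. The sign \<open>(-1)^R\<close> normalises \<open>b\<close> to an antidiagonal of
  the dual matrix. The lower bound on \<open>l\<close> serves to get
  \<open>r_n + s_n - t < p\<close>. That is the degree in which the Wronskian argument is applied,
  and its inequality \<open>2 d + 2 <= a + b + c\<close> holds there with equality.\<close>

definition deg_le :: "'a::zero poly \<Rightarrow> int \<Rightarrow> bool"
  where "deg_le f d \<longleftrightarrow> (\<forall>i. d < int i \<longrightarrow> coeff f i = 0)"

lemma deg_leD: "deg_le f d \<Longrightarrow> d < int i \<Longrightarrow> coeff f i = 0"
  by (simp add: deg_le_def)

lemma deg_le_iff: "deg_le f d \<longleftrightarrow> f = 0 \<or> int (degree f) \<le> d"
proof
  assume "deg_le f d"
  then show "f = 0 \<or> int (degree f) \<le> d"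
    by (metis deg_leD leading_coeff_0_iff not_le)
qed (auto simp: deg_le_def coeff_eq_0)

text \<open>Bounds are integers so that degrees can be subtracted without truncation; a negative
  bound then forces the zero form.\<close>

lemma deg_le_neg: "deg_le f d \<Longrightarrow> d < 0 \<Longrightarrow> f = 0"
  by (auto simp: deg_le_iff)

lemma deg_le_mono: "deg_le f d \<Longrightarrow> d \<le> d' \<Longrightarrow> deg_le f d'"
  by (auto simp: deg_le_def)

lemma deg_le_0 [simp]: "deg_le 0 d"
  by (simp add: deg_le_def)

lemma deg_le_1 [simp]: "deg_le 1 d \<longleftrightarrow> d \<ge> 0" for d :: int
  by (simp add: deg_le_iff)

lemma deg_le_add: "deg_le f d \<Longrightarrow> deg_le g d \<Longrightarrow> deg_le (f + g) d"
  for f g :: "'a::comm_monoid_add poly"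
  by (auto simp: deg_le_def)

lemma deg_le_diff: "deg_le f d \<Longrightarrow> deg_le g d \<Longrightarrow> deg_le (f - g) d"
  for f g :: "'a::ab_group_add poly"
  by (auto simp: deg_le_def)

lemma deg_le_uminus: "deg_le f d \<Longrightarrow> deg_le (- f) d"
  for f :: "'a::ab_group_add poly"
  by (auto simp: deg_le_def)

lemma deg_le_smult: "deg_le f d \<Longrightarrow> deg_le (smult c f) d"
  for f :: "'a::comm_semiring_0 poly"
  by (auto simp: deg_le_def)

lemma deg_le_sum: "(\<And>i. i \<in> A \<Longrightarrow> deg_le (f i) d) \<Longrightarrow> deg_le (\<Sum>i\<in>A. f i) d"
  for f :: "_ \<Rightarrow> 'a::comm_monoid_add poly"
  by (auto simp: deg_le_def coeff_sum)

lemma deg_le_mult: "deg_le f d \<Longrightarrow> deg_le g e \<Longrightarrow> deg_le (f * g) (d + e)"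
  for f g :: "'a::comm_semiring_0 poly"
  using degree_mult_le[of f g] by (auto simp: deg_le_iff)

lemma deg_le_monom: "int n \<le> d \<Longrightarrow> deg_le (monom c n) d"
  by (auto simp: deg_le_def)

section \<open>Divisibility by powers of \<open>X + 1\<close> and of \<open>X\<close>\<close>

lemma degree_linear_power [simp]: "degree ([:1, 1:] ^ n :: 'a::idom poly) = n"
  by (simp add: degree_power_eq)

lemma linear_power_neq_0 [simp]: "([:1, 1:] ^ n :: 'a::idom poly) \<noteq> 0"
  by simp

lemma deg_le_linear_power_mult_iff:
  fixes f :: "'a::idom poly"
  shows "deg_le ([:1, 1:] ^ n * f) d \<longleftrightarrow> deg_le f (d - int n)"
  by (cases "f = 0") (auto simp: deg_le_iff degree_mult_eq)

lemma deg_le_monom_mult_iff: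
  fixes f :: "'a::idom poly"
  shows "deg_le (monom 1 n * f) d \<longleftrightarrow> deg_le f (d - int n)"
  by (cases "f = 0") (auto simp: deg_le_iff degree_mult_eq degree_monom_eq)

lemma coeff_linear_mult:
  "coeff ([:1, 1:] * f) i = coeff f i + (if i = 0 then 0 else coeff f (i - 1))"
  for f :: "'a::comm_ring_1 poly"
  by (cases i) (auto simp: coeff_pCons)

lemma linear_dvd_iff: "[:1, 1:] dvd f \<longleftrightarrow> poly f (- 1) = 0"
  for f :: "'a::idom poly"
  by (metis dvd_iff_poly_eq_0)

text \<open>\<open>X\<close> is invertible modulo \<open>X + 1\<close>, having a nonzero value at
  -1, so the factors \<open>X + 1\<close> can be split off one at a time.\<close>

lemma linear_power_dvd_monom_mult:
  fixes f :: "'a::idom poly"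
  assumes "[:1, 1:] ^ n dvd monom 1 m * f"
  shows "[:1, 1:] ^ n dvd f"
  using assms
proof (induction n)
  case (Suc n)
  have "[:1, 1:] ^ n dvd monom 1 m * f"
    using Suc.prems by (metis dvd_mult_right power_Suc)
  then obtain h where h: "f = [:1, 1:] ^ n * h"
    using Suc.IH by (auto elim: dvdE)
  have "[:1, 1:] ^ n * [:1, 1:] dvd [:1, 1:] ^ n * (monom 1 m * h)"
    using Suc.prems by (simp only: h power_Suc2 ac_simps)
  then have "[:1, 1:] dvd monom 1 m * h"
    by (simp add: dvd_times_left_cancel_iff del: mult_pCons_left mult_pCons_right)
  then have "[:1, 1:] dvd h"
    by (simp add: linear_dvd_iff poly_monom)
  then show ?case
    by (simp add: h mult.commute mult_dvd_mono del: mult_pCons_left mult_pCons_right)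
qed simp

lemma monom_dvdI:
  fixes f :: "'a::comm_ring_1 poly"
  assumes "\<And>i. i < n \<Longrightarrow> coeff f i = 0"
  shows "monom 1 n dvd f"
  using assms by (metis monom_1_dvd_iff')

lemma monom_dvd_linear_power_mult:
  fixes f :: "'a::comm_ring_1 poly"
  assumes "monom 1 m dvd [:1, 1:] ^ n * f"
  shows "monom 1 m dvd f"
  using assms
proof (induction n)
  case (Suc n)
  let ?g = "[:1, 1:] ^ n * f"
  have z: "coeff ([:1, 1:] * ?g) i = 0" if "i < m" for i
    using Suc.prems that by (simp only: power_Suc mult.assoc monom_1_dvd_iff')
  have "coeff ?g i = 0" if "i < m" for i
    using that
  proof (induction i)
    case 0
    then show ?case using z[of 0] by (simp only: coeff_linear_mult) simp
  next
    case (Suc i)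
    then show ?case using z[of "Suc i"] by (simp only: coeff_linear_mult) simp
  qed
  then show ?case by (intro Suc.IH monom_dvdI)
qed simp

text \<open>For a form of degree \<open>d\<close> and \<open>b = d - s\<close>, the window between
  \<open>b\<close> and \<open>r\<close> consists of the monomials that survive modulo
  \<open>X^r\<close> and \<open>Y^s\<close>; \<open>A\<close> and \<open>B\<close> are the cofactors
  of \<open>X^r\<close> and \<open>Y^s\<close>.\<close>

lemma window_split:
  fixes f :: "'a::comm_ring_1 poly"
  assumes "\<And>i. i < r \<Longrightarrow> b < int i \<Longrightarrow> coeff f i = 0"
  obtains A B where "f = monom 1 r * A + B" "deg_le B b"
proof
  show "f = monom 1 r * poly_shift r f + poly_cutoff r f"
    by (auto simp: poly_eq_iff coeff_monom_mult coeff_poly_shift coeff_poly_cutoff)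
  show "deg_le (poly_cutoff r f) b"
    using assms by (auto simp: deg_le_def coeff_poly_cutoff)
qed

section \<open>A syzygy bound\<close>

text \<open>
  The Wronskian of the summands of a syzygy of \<open>X\<^sup>a\<close>, \<open>Y\<^sup>b\<close>, \<open>(X + Y)\<^sup>c\<close> is divisible by
  \<open>X\<^sup>a\<^sup>-\<^sup>1 Y\<^sup>b\<^sup>-\<^sup>1 (X + Y)\<^sup>c\<^sup>-\<^sup>1\<close>, hence vanishes if the degree is small; below degree \<open>p\<close>
  a vanishing Wronskian forces proportionality.
\<close>

lemma linear_power_dvd_pderiv:
  fixes f :: "'a::idom poly"
  shows "[:1, 1:] ^ (n - 1) dvd pderiv ([:1, 1:] ^ n * f)"
proof (cases n)
  case (Suc m)
  have "pderiv ([:1, 1:] ^ Suc m * f) = [:1, 1:] ^ m * (smult (of_nat (Suc m)) f + [:1, 1:] * pderiv f)"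
    by (subst pderiv_mult, subst pderiv_power_Suc)
       (simp add: pderiv_pCons algebra_simps smult_add_right)
  then show ?thesis using Suc by simp
qed simp

lemma monom_dvd_pderiv:
  fixes f :: "'a::idom poly"
  shows "monom 1 (n - 1) dvd pderiv (monom 1 n * f)"
  by (rule monom_dvdI) (auto simp: coeff_pderiv coeff_monom_mult)

text \<open>The lowest exponents satisfy \<open>i >= a > degree B >= j\<close>. The coefficient of
  the Wronskian at \<open>i + j - 1\<close> is \<open>j - i\<close> times the two lowest
  coefficients, and \<open>0 < i - j < CHAR('a)\<close> keeps it nonzero.\<close>

lemma proportional_wronskian:
  fixes A B :: "'a::idom poly"
  assumes "A \<noteq> 0" "B \<noteq> 0" "monom 1 a dvd A" "degree B < a" "degree A < CHAR('a)"
  shows "A * pderiv B - pderiv A * B \<noteq> 0"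
proof -
  define i where "i = (LEAST i. coeff A i \<noteq> 0)"
  define j where "j = (LEAST i. coeff B i \<noteq> 0)"
  have ex: "\<exists>i. coeff A i \<noteq> 0" "\<exists>i. coeff B i \<noteq> 0"
    by (rule exI, rule leading_coeff_neq_0, rule assms)+
  have i: "coeff A i \<noteq> 0" and j: "coeff B j \<noteq> 0"
    unfolding i_def j_def using LeastI_ex[OF ex(1)] LeastI_ex[OF ex(2)] by simp_all
  have i': "coeff A k = 0" if "k < i" for k
    using that not_less_Least i_def by blast
  have j': "coeff B k = 0" if "k < j" for k
    using that not_less_Least j_def by blast
  have "a \<le> i" using i assms(3) by (metis monom_1_dvd_iff' not_le)
  moreover have "i \<le> degree A" "j \<le> degree B" using i j by (simp_all add: le_degree)
  ultimately have ij: "j < i" "i < CHAR('a)" using assms by auto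
  obtain i0 where i0: "i = Suc i0" using ij by (cases i) auto
  have 1: "coeff (A * pderiv B) (i + j - 1) = of_nat j * coeff A i * coeff B j"
  proof (cases j)
    case (Suc j0)
    have "coeff (A * pderiv B) (i + j - 1) = (\<Sum>k\<le>i + j - 1. if k = i then coeff A i * coeff (pderiv B) (i + j - 1 - i) else 0)"
      unfolding coeff_mult
    proof (rule sum.cong)
      fix k assume "k \<in> {..i + j - 1}"
      then show "coeff A k * coeff (pderiv B) (i + j - 1 - k) =
        (if k = i then coeff A i * coeff (pderiv B) (i + j - 1 - i) else 0)"
        using i'[of k] j'[of "Suc (i + j - 1 - k)"] Suc
        by (cases k i rule: linorder_cases) (auto simp: coeff_pderiv)
    qed simp
    then show ?thesis using Suc by (simp add: coeff_pderiv algebra_simps)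
  next
    case 0
    have "coeff A k * coeff (pderiv B) (i - 1 - k) = 0" if "k \<le> i - 1" for k
      using i'[of k] that i0 by auto
    then show ?thesis using 0 by (auto simp: coeff_mult intro!: sum.neutral)
  qed
  have 2: "coeff (pderiv A * B) (i + j - 1) = of_nat i * coeff A i * coeff B j"
  proof -
    have "coeff (pderiv A * B) (i + j - 1) = (\<Sum>k\<le>i + j - 1. if k = i0 then coeff (pderiv A) i0 * coeff B j else 0)"
      unfolding coeff_mult
    proof (rule sum.cong)
      fix k assume "k \<in> {..i + j - 1}"
      then show "coeff (pderiv A) k * coeff B (i + j - 1 - k) =
        (if k = i0 then coeff (pderiv A) i0 * coeff B j else 0)"
        using i'[of "Suc k"] j'[of "i + j - 1 - k"] i0
        by (cases k i0 rule: linorder_cases) (auto simp: coeff_pderiv)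
    qed simp
    then show ?thesis using i0 by (simp add: coeff_pderiv)
  qed
  have "of_nat (i - j) \<noteq> (0::'a)"
    using ij unfolding of_nat_eq_0_iff_char_dvd by (auto dest: dvd_imp_le)
  then have "(of_nat i :: 'a) - of_nat j \<noteq> 0"
    using ij by (simp add: of_nat_diff)
  then have "coeff (A * pderiv B - pderiv A * B) (i + j - 1) \<noteq> 0"
    using i j unfolding coeff_diff 1 2 by (simp add: mult.assoc flip: left_diff_distrib)
  then show ?thesis by auto
qed

text \<open>With \<open>Y\<close> restored the equation is
  \<open>X^a f + Y^b h = (X + Y)^c w\<close> in degree \<open>d\<close>. The Wronskian has degree at
  most \<open>2 d - b - 1\<close>, while its divisors account for \<open>a + c - 2\<close>. The
  bounds \<open>d < b + c\<close> and \<open>d < a + c\<close> exclude a zero summand on the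
  right.\<close>

lemma no_syzygy:
  fixes f h w :: "'a::idom poly" and a b c d :: nat
  assumes eq: "[:1, 1:] ^ c * w = monom 1 a * f + h"
    and h: "deg_le h (int d - int b)" and w: "deg_le w (int d - int c)"
    and d: "d < CHAR('a)" "2 * d + 2 \<le> a + b + c" "d < b + c" "d < a + c"
  shows "w = 0"
proof (rule ccontr)
  assume w0: "w \<noteq> 0"
  define A where "A = monom 1 a * f"
  define C where "C = [:1, 1:] ^ c * w"
  have C: "C = A + h" using eq by (simp add: A_def C_def)
  have cd: "c + degree w \<le> d" using w w0 by (auto simp: deg_le_iff)
  have degC: "degree C = c + degree w"
    using w0 by (simp_all add: C_def degree_mult_eq)
  have "h \<noteq> 0"
  proof
    assume "h = 0"
    then have "monom 1 a dvd [:1, 1:] ^ c * w" using eq by simp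
    then have "monom 1 a dvd w" by (rule monom_dvd_linear_power_mult)
    then have "a \<le> degree w"
      using w0 by (metis degree_monom_eq dvd_imp_degree_le zero_neq_one)
    then show False using cd d by linarith
  qed
  then have bd: "b + degree h \<le> d" using h by (auto simp: deg_le_iff)
  have "A \<noteq> 0"
  proof
    assume "A = 0"
    then have "degree h = c + degree w" using C degC by simp
    then show False using bd d by linarith
  qed
  have degA: "degree A \<le> d"
  proof -
    have "A = C - h" using C by simp
    then show ?thesis using degree_diff_le[of C d h] degC cd bd by simp
  qed
  moreover have "a \<le> degree A"
    using \<open>A \<noteq> 0\<close> by (auto simp: A_def degree_mult_eq degree_monom_eq)
  ultimately have ad: "a \<le> d" by simp
  have pos: "a \<ge> 1" "c \<ge> 1" using ad bd cd d by linarith+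
  define W where "W = A * pderiv h - pderiv A * h"
  \<comment> \<open>Replacing \<open>h\<close> by \<open>C = A + h\<close> does not change the
    Wronskian, and it exposes the factor \<open>(X + 1)^(c-1)\<close>.\<close>
  have "W = A * pderiv C - pderiv A * C"
    by (simp add: W_def C pderiv_add algebra_simps)
  then have 1: "[:1, 1:] ^ (c - 1) dvd W"
    by (metis C_def dvd_diff dvd_mult dvd_mult2 le_imp_power_dvd linear_power_dvd_pderiv diff_le_self)
  have 2: "monom 1 (a - 1) dvd W"
    unfolding W_def A_def
    by (intro dvd_diff dvd_mult2[OF monom_dvd_pderiv] dvd_mult2[OF dvd_mult2]) (simp add: monom_1_dvd_iff')
  obtain W1 where W1: "W = monom 1 (a - 1) * W1" using 2 by (auto elim: dvdE)
  obtain W2 where W2: "W1 = [:1, 1:] ^ (c - 1) * W2"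
    using 1 linear_power_dvd_monom_mult unfolding W1 by (metis dvdE)
  have "W \<noteq> 0"
    unfolding W_def
    using \<open>A \<noteq> 0\<close> \<open>h \<noteq> 0\<close> by (rule proportional_wronskian[where a = a]) (use degA ad bd cd d in \<open>auto simp: A_def\<close>)
  then have "degree W \<ge> (a - 1) + (c - 1)"
    by (auto simp: W1 W2 degree_mult_eq degree_monom_eq)
  moreover have "deg_le W (int d + (int d - int b) - 1)"
  proof -
    have pd: "deg_le (pderiv u) (k - 1)" if "deg_le u k" for u :: "'a poly" and k
      using that by (auto simp: deg_le_def coeff_pderiv)
    have "deg_le A (int d)" using degA by (simp add: deg_le_iff)
    from deg_le_mult[OF this pd[OF h]] deg_le_mult[OF pd[OF this] h]
    show ?thesis unfolding W_def by (intro deg_le_diff) (simp_all add: algebra_simps)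
  qed
  ultimately show False
    using \<open>W \<noteq> 0\<close> pos bd d by (auto simp: deg_le_iff)
qed

section \<open>The parts in terms of polynomials\<close>

text \<open>
  Sending \<open>v\<^sub>i\<^sub>,\<^sub>j\<close> to \<open>X\<^sup>r\<^sup>-\<^sup>i Y\<^sup>s\<^sup>-\<^sup>j\<close> identifies \<open>V\<^sub>r \<otimes> V\<^sub>s\<close> with \<open>F[X, Y] / (X\<^sup>r, Y\<^sup>s)\<close> and \<open>g - 1\<close>
  with multiplication by \<open>X + Y\<close>.  Homogeneous polynomials of degree \<open>d\<close> are written with \<open>Y = 1\<close>,
  as univariate polynomials of degree at most \<open>d\<close>; then divisibility by \<open>Y\<^sup>s\<close> means degree at most
  \<open>d - s\<close>.  The coefficients of \<open>x\<^sub>l\<close> become \<open>(-1)\<^sup>i\<^sup>-\<^sup>1\<close> at \<open>X\<^sup>r\<^sup>-\<^sup>i\<close>, in total degree \<open>r + s - l - 1\<close>.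
\<close>

definition hits :: "'a::field itself \<Rightarrow> nat \<Rightarrow> nat \<Rightarrow> nat \<Rightarrow> nat \<Rightarrow> bool"
  where "hits F r s l j \<longleftrightarrow> (\<exists>u::'a poly. deg_le u (int r + int s - int l - 1 - int j) \<and>
    (\<forall>i\<in>{1..l}. coeff ([:1, 1:] ^ j * u) (r - i) = (- 1) ^ (i - 1)))"

definition plam :: "'a::field itself \<Rightarrow> nat \<Rightarrow> nat \<Rightarrow> nat \<Rightarrow> nat"
  where "plam F r s l = (LEAST j. \<not> hits F r s l j)"

text \<open>For a form of degree \<open>d\<close> this is membership in the ideal of
  \<open>X^r\<close> and \<open>Y^s\<close>: the coefficients inspected are those of
  \<open>X^i Y^(d-i)\<close> with \<open>i < r\<close> and \<open>d - i < s\<close>.\<close>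

definition vanishes :: "nat \<Rightarrow> nat \<Rightarrow> int \<Rightarrow> 'a::zero poly \<Rightarrow> bool"
  where "vanishes r s d f \<longleftrightarrow> (\<forall>i<r. d - int s < int i \<longrightarrow> coeff f i = 0)"

lemma hits_bound: "hits F r s l j \<Longrightarrow> 1 \<le> l \<Longrightarrow> int l + int j + 1 \<le> int r + int s"
proof (rule ccontr)
  assume h: "hits F r s l j" "1 \<le> l" "\<not> int l + int j + 1 \<le> int r + int s"
  then obtain u :: "'a poly" where u: "deg_le u (int r + int s - int l - 1 - int j)"
    "\<forall>i\<in>{1..l}. coeff ([:1, 1:] ^ j * u) (r - i) = (- 1) ^ (i - 1)"
    by (auto simp: hits_def)
  have "u = 0" using u(1) h(3) by (auto intro: deg_le_neg)
  then show False using u(2) h(2) by (auto dest: bspec[of _ _ 1])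
qed

lemma hits_Suc: "hits F r s l (Suc j) \<Longrightarrow> hits F r s l j"
proof -
  assume "hits F r s l (Suc j)"
  then obtain u :: "'a poly" where u: "deg_le u (int r + int s - int l - 1 - int (Suc j))"
    "\<forall>i\<in>{1..l}. coeff ([:1, 1:] ^ Suc j * u) (r - i) = (- 1) ^ (i - 1)"
    unfolding hits_def by blast
  have "deg_le ([:1, 1:] ^ 1 * u) (int r + int s - int l - 1 - int j)"
    using u(1) unfolding deg_le_linear_power_mult_iff by (simp add: algebra_simps)
  moreover have "[:1, 1:] ^ Suc j * u = [:1, 1:] ^ j * ([:1, 1:] ^ 1 * u)"
    by (simp only: power_Suc power_one_right ac_simps)
  ultimately show "hits F r s l j" using u(2) unfolding hits_def by metis
qed

lemma hits_antimono: "hits F r s l j \<Longrightarrow> i \<le> j \<Longrightarrow> hits F r s l i"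
  by (induction j rule: nat_induct) (auto simp: le_Suc_eq dest: hits_Suc)

text \<open>The exponents that hit are closed downwards and bounded, so the least failure separates
  them from the rest.\<close>

lemma less_plam_iff: "1 \<le> l \<Longrightarrow> j < plam F r s l \<longleftrightarrow> hits F r s l j"
proof -
  assume l: "1 \<le> l"
  have "\<not> hits F r s l (r + s)" using hits_bound[of F r s l "r + s"] l by auto
  then have "\<not> hits F r s l (plam F r s l)" unfolding plam_def by (rule LeastI)
  moreover have "hits F r s l j" if "j < plam F r s l"
    using that not_less_Least unfolding plam_def by blast
  ultimately show ?thesis using hits_antimono not_le by blast
qed

lemma hits_0: "1 \<le> l \<Longrightarrow> l \<le> r \<Longrightarrow> l \<le> s \<Longrightarrow> hits F r s l 0"
proof -
  assume l: "1 \<le> l" "l \<le> r" "l \<le> s"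
  define u :: "'a poly" where "u = (\<Sum>i=1..l. monom ((- 1) ^ (i - 1)) (r - i))"
  have "deg_le u (int r + int s - int l - 1 - int 0)"
    unfolding u_def using l by (intro deg_le_sum deg_le_monom) auto
  moreover have "coeff u (r - k) = (- 1) ^ (k - 1)" if "k \<in> {1..l}" for k
  proof -
    have "coeff u (r - k) = (\<Sum>i=1..l. if i = k then (- 1) ^ (k - 1) else 0)"
      unfolding u_def coeff_sum coeff_monom
      using that l by (intro sum.cong) auto
    then show ?thesis using that by simp
  qed
  ultimately show ?thesis unfolding hits_def by (intro exI[of _ u]) auto
qed

lemma plam_pos: "1 \<le> l \<Longrightarrow> l \<le> min r s \<Longrightarrow> 0 < plam F r s l"
  by (simp add: less_plam_iff hits_0)

text \<open>Multiplication by \<open>-X\<close> commutes with \<open>X + Y\<close> and takes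
  \<open>x_(l+1)\<close> to \<open>x_l\<close>. This makes the parts decreasing.\<close>

lemma hits_pred: "hits F r s (Suc l) j \<Longrightarrow> Suc l \<le> r \<Longrightarrow> hits F r s l j"
proof -
  assume "hits F r s (Suc l) j" and lr: "Suc l \<le> r"
  then obtain u :: "'a poly" where u: "deg_le u (int r + int s - int (Suc l) - 1 - int j)"
    "\<forall>i\<in>{1..Suc l}. coeff ([:1, 1:] ^ j * u) (r - i) = (- 1) ^ (i - 1)"
    unfolding hits_def by blast
  define u' where "u' = - (monom 1 1 * u)"
  have "deg_le u' (int r + int s - int l - 1 - int j)"
    using u(1) unfolding u'_def
    by (intro deg_le_uminus, unfold deg_le_monom_mult_iff) (auto elim: deg_le_mono)
  moreover have "coeff ([:1, 1:] ^ j * u') (r - i) = (- 1) ^ (i - 1)" if "i \<in> {1..l}" for i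
  proof -
    have "[:1, 1:] ^ j * u' = - (monom 1 1 * ([:1, 1:] ^ j * u))"
      by (simp add: u'_def mult.left_commute)
    then have "coeff ([:1, 1:] ^ j * u') (r - i) = - coeff ([:1, 1:] ^ j * u) (r - i - 1)"
      using that lr by (simp add: coeff_monom_mult)
    also have "r - i - 1 = r - Suc i" by simp
    also have "coeff ([:1, 1:] ^ j * u) (r - Suc i) = (- 1) ^ i"
      using u(2) that by (auto dest: bspec[of _ _ "Suc i"])
    also have "- ((- 1 :: 'a) ^ i) = (- 1) ^ (i - 1)"
      using that by (cases i) auto
    finally show ?thesis .
  qed
  ultimately show ?thesis unfolding hits_def by blast
qed

lemma plam_antimono:
  assumes "1 \<le> l" "l \<le> l'" "l' \<le> r"
  shows "plam F r s l' \<le> plam F r s l"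
  using assms(2,3)
proof (induction l' rule: dec_induct)
  case (step k)
  have "plam F r s (Suc k) \<le> plam F r s k"
    using less_plam_iff[of k "plam F r s k"] less_plam_iff[of "Suc k" "plam F r s k"] hits_pred step assms(1)
    by (metis Suc_leD le_Suc_eq le_trans less_irrefl linorder_not_less)
  then show ?case using step by simp
qed simp

lemma coeff_mult_window:
  fixes f w :: "'a::comm_ring_1 poly"
  assumes "deg_le w (int l - 1)" "1 \<le> l" "l \<le> r"
  shows "coeff (f * w) (r - 1) = (\<Sum>i=1..l. coeff f (r - i) * coeff w (i - 1))"
proof -
  have "coeff (f * w) (r - 1) = (\<Sum>i\<le>r - 1. coeff w i * coeff f (r - 1 - i))"
    by (simp add: mult.commute[of f] coeff_mult)
  also have "\<dots> = (\<Sum>i\<in>{..<l}. coeff w i * coeff f (r - 1 - i))"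
    using assms by (intro sum.mono_neutral_right) (auto simp: deg_le_def)
  also have "\<dots> = (\<Sum>i=1..l. coeff f (r - i) * coeff w (i - 1))"
    by (rule sum.reindex_bij_witness[of _ "\<lambda>i. i - 1" Suc]) (auto simp: mult.commute)
  finally show ?thesis .
qed

lemma poly_minus_1:
  fixes w :: "'a::comm_ring_1 poly"
  assumes "deg_le w (int l - 1)" "1 \<le> l"
  shows "poly w (- 1) = (\<Sum>i=1..l. (- 1) ^ (i - 1) * coeff w (i - 1))"
proof -
  have "poly w (- 1) = (\<Sum>i\<le>degree w. coeff w i * (- 1) ^ i)"
    by (simp add: poly_altdef)
  also have "\<dots> = (\<Sum>i\<in>{..<l}. coeff w i * (- 1) ^ i)"
    using assms by (intro sum.mono_neutral_left) (auto simp: deg_le_iff coeff_eq_0)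
  also have "\<dots> = (\<Sum>i=1..l. (- 1) ^ (i - 1) * coeff w (i - 1))"
    by (rule sum.reindex_bij_witness[of _ "\<lambda>i. i - 1" Suc]) (auto simp: mult.commute)
  finally show ?thesis .
qed

text \<open>
  Pairing complementary degrees by the coefficient of \<open>X\<^sup>r\<^sup>-\<^sup>1 Y\<^sup>s\<^sup>-\<^sup>1\<close>, for which \<open>X + Y\<close> is
  self-adjoint, \<open>x\<^sub>l\<close> becomes evaluation at \<open>-1\<close>.
\<close>

lemma not_hitsI:
  fixes w :: "'a::field poly"
  assumes w: "deg_le w (int l - 1)" "poly w (- 1) \<noteq> 0"
    and v: "vanishes r s (int l - 1 + int j) ([:1, 1:] ^ j * w)" and l: "1 \<le> l" "l \<le> r"
  shows "\<not> hits TYPE('a) r s l j"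
proof
  assume "hits TYPE('a) r s l j"
  then obtain u :: "'a poly" where u: "deg_le u (int r + int s - int l - 1 - int j)"
    "\<forall>i\<in>{1..l}. coeff ([:1, 1:] ^ j * u) (r - i) = (- 1) ^ (i - 1)"
    unfolding hits_def by blast
  have "coeff ([:1, 1:] ^ j * u * w) (r - 1) = poly w (- 1)"
    unfolding coeff_mult_window[OF w(1) l] poly_minus_1[OF w(1) l(1)]
    using u(2) by (intro sum.cong) auto
  \<comment> \<open>The power of \<open>X + 1\<close> is moved from \<open>u\<close> to
    \<open>w\<close>. Each exponent \<open>i\<close> now either lies in the window where
    \<open>(X + 1)^j w\<close> vanishes, or is paired with an exponent beyond the degree bound of
    \<open>u\<close>.\<close>
  moreover have "coeff (([:1, 1:] ^ j * w) * u) (r - 1) = 0"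
    unfolding coeff_mult[of _ u]
  proof (intro sum.neutral ballI)
    fix i assume i: "i \<in> {..r - 1}"
    show "coeff ([:1, 1:] ^ j * w) i * coeff u (r - 1 - i) = 0"
    proof (cases "int l - 1 + int j - int s < int i")
      case True
      then show ?thesis using v i l by (auto simp: vanishes_def)
    next
      case False
      then have "coeff u (r - 1 - i) = 0" using u(1) i l by (intro deg_leD[OF u(1)]) auto
      then show ?thesis by simp
    qed
  qed
  ultimately show False using w(2) by (simp add: ac_simps)
qed

text \<open>Induction restricts \<open>W\<close> to the kernel of one functional; a vector outside
  this kernel fixes the remaining coefficient. This is the duality that turns the unsolvability of
  an equation for \<open>x_l\<close> into a witness.\<close>

lemma functional_in_span:
  fixes L :: "'b \<Rightarrow> 'a::field poly \<Rightarrow> 'a" and \<Lambda> :: "'a poly \<Rightarrow> 'a"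
  assumes "finite I"
    and "\<And>i c u w. i \<in> I \<Longrightarrow> L i (u - smult c w) = L i u - c * L i w"
    and "\<And>c u w. \<Lambda> (u - smult c w) = \<Lambda> u - c * \<Lambda> w"
    and "\<And>c u w. u \<in> W \<Longrightarrow> w \<in> W \<Longrightarrow> u - smult c w \<in> W"
    and "\<And>w. w \<in> W \<Longrightarrow> (\<And>i. i \<in> I \<Longrightarrow> L i w = 0) \<Longrightarrow> \<Lambda> w = 0"
  shows "\<exists>c. \<forall>w\<in>W. \<Lambda> w = (\<Sum>i\<in>I. c i * L i w)"
  using assms
proof (induction I arbitrary: W rule: finite_induct)
  case (insert k I)
  define W' where "W' = {w \<in> W. L k w = 0}"
  have "\<exists>c. \<forall>w\<in>W'. \<Lambda> w = (\<Sum>i\<in>I. c i * L i w)"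
  proof (rule insert.IH)
    fix w assume "w \<in> W'" "\<And>i. i \<in> I \<Longrightarrow> L i w = 0"
    then show "\<Lambda> w = 0" using insert.prems(4)[of w] by (auto simp: W'_def)
  qed (use insert.prems(1-3) in \<open>auto simp: W'_def\<close>)
  then obtain c where c: "\<And>w. w \<in> W' \<Longrightarrow> \<Lambda> w = (\<Sum>i\<in>I. c i * L i w)" by blast
  show ?case
  proof (cases "W' = W")
    case True
    then show ?thesis using c insert.hyps
      by (intro exI[of _ c]) (auto simp: W'_def)
  next
    case False
    then obtain w0 where w0: "w0 \<in> W" "L k w0 \<noteq> 0" by (auto simp: W'_def)
    define b where "b = (\<Lambda> w0 - (\<Sum>i\<in>I. c i * L i w0)) / L k w0"
    have "\<Lambda> w = (\<Sum>i\<in>insert k I. (c(k := b)) i * L i w)" if w: "w \<in> W" for w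
    proof -
      define a where "a = L k w / L k w0"
      have "w - smult a w0 \<in> W'"
        using w w0 insert.prems by (simp add: W'_def a_def)
      from c[OF this] have "\<Lambda> w - a * \<Lambda> w0 = (\<Sum>i\<in>I. c i * (L i w - a * L i w0))"
        using insert.prems by simp
      also have "\<dots> = (\<Sum>i\<in>I. c i * L i w) - a * (\<Sum>i\<in>I. c i * L i w0)"
        by (simp add: sum_subtractf sum_distrib_left algebra_simps)
      finally have "\<Lambda> w = (\<Sum>i\<in>I. c i * L i w) + a * (\<Lambda> w0 - (\<Sum>i\<in>I. c i * L i w0))"
        by (simp add: algebra_simps)
      also have "a * (\<Lambda> w0 - (\<Sum>i\<in>I. c i * L i w0)) = b * L k w"
        using w0 by (simp add: a_def b_def)
      also have "(\<Sum>i\<in>I. c i * L i w) = (\<Sum>i\<in>I. (c(k := b)) i * L i w)"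
        using insert.hyps by (intro sum.cong) auto
      finally show ?thesis using insert.hyps by simp
    qed
    then show ?thesis by blast
  qed
qed auto

text \<open>Converse of \<open>not_hitsI\<close>. Without such a \<open>w\<close>, evaluation at -1
  would be a combination of the coefficients in the window, and its multipliers, read backwards, are
  the coefficients of a preimage of \<open>x_l\<close>.\<close>

lemma not_hitsE:
  assumes nh: "\<not> hits TYPE('a::field) r s l j" and l: "1 \<le> l" "l \<le> r"
  obtains w :: "'a::field poly" where "deg_le w (int l - 1)" "poly w (- 1) \<noteq> 0"
    "vanishes r s (int l - 1 + int j) ([:1, 1:] ^ j * w)"
proof (rule ccontr)
  assume "\<not> thesis"
  note no = this
  define I where "I = {i. i < r \<and> int l - 1 + int j - int s < int i}"
  have "finite I" by (rule finite_subset[of _ "{..<r}"]) (auto simp: I_def)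
  then have "\<exists>c. \<forall>w\<in>{w :: 'a poly. deg_le w (int l - 1)}. poly w (- 1) = (\<Sum>i\<in>I. c i * coeff ([:1, 1:] ^ j * w) i)"
  proof (rule functional_in_span[where L = "\<lambda>i w. coeff ([:1, 1:] ^ j * w) i" and \<Lambda> = "\<lambda>w. poly w (- 1)"])
    fix w :: "'a poly" assume "w \<in> {w. deg_le w (int l - 1)}" "\<And>i. i \<in> I \<Longrightarrow> coeff ([:1, 1:] ^ j * w) i = 0"
    then show "poly w (- 1) = 0" using no that[of w] by (auto simp: vanishes_def I_def)
  qed (auto intro: deg_le_diff deg_le_smult simp: right_diff_distrib mult_smult_right)
  then obtain c where c: "\<And>w :: 'a poly. deg_le w (int l - 1) \<Longrightarrow>
      poly w (- 1) = (\<Sum>i\<in>I. c i * coeff ([:1, 1:] ^ j * w) i)" by auto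
  define u where "u = (\<Sum>i\<in>I. monom (c i) (r - 1 - i))"
  have "deg_le u (int r + int s - int l - 1 - int j)"
    unfolding u_def by (intro deg_le_sum deg_le_monom) (auto simp: I_def)
  moreover have "coeff ([:1, 1:] ^ j * u) (r - k) = (- 1) ^ (k - 1)" if k: "k \<in> {1..l}" for k
  proof -
    \<comment> \<open>Testing the identity of functionals on \<open>X^(k-1)\<close> yields the
      coefficient at exponent \<open>r - k\<close>.\<close>
    let ?w = "monom 1 (k - 1) :: 'a poly"
    have dw: "deg_le ?w (int l - 1)" using k by (intro deg_le_monom) auto
    have "coeff ([:1, 1:] ^ j * u) (r - k) = coeff ([:1, 1:] ^ j * u * ?w) (r - 1)"
      using k l unfolding mult.commute[of "[:1, 1:] ^ j * u" ?w] by (auto simp: coeff_monom_mult)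
    also have "[:1, 1:] ^ j * u * ?w = u * ([:1, 1:] ^ j * ?w)" by (simp only: ac_simps)
    also have "coeff (u * ([:1, 1:] ^ j * ?w)) (r - 1) = (\<Sum>i\<in>I. c i * coeff ([:1, 1:] ^ j * ?w) i)"
      unfolding u_def sum_distrib_right coeff_sum
    proof (rule sum.cong)
      fix i assume "i \<in> I"
      then have i: "r - 1 - (r - 1 - i) = i" "\<not> r - 1 < r - 1 - i" by (auto simp: I_def)
      have "monom (c i) (r - 1 - i) * ([:1, 1:] ^ j * ?w) =
          smult (c i) (monom 1 (r - 1 - i) * ([:1, 1:] ^ j * ?w))"
        by (simp add: smult_monom flip: mult_smult_left)
      then show "coeff (monom (c i) (r - 1 - i) * ([:1, 1:] ^ j * ?w)) (r - 1) = c i * coeff ([:1, 1:] ^ j * ?w) i"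
        using i unfolding coeff_monom_mult coeff_smult by simp
    qed simp
    also have "\<dots> = poly ?w (- 1)" using c[OF dw] by simp
    finally show ?thesis by (simp add: poly_monom)
  qed
  ultimately have "hits TYPE('a) r s l j" unfolding hits_def by blast
  then show False using nh by simp
qed

section \<open>Blocks of equal parts\<close>

definition block :: "'a::field itself \<Rightarrow> nat \<Rightarrow> nat \<Rightarrow> nat \<Rightarrow> nat \<Rightarrow> nat \<Rightarrow> bool"
  where "block F r s i j L \<longleftrightarrow> 1 \<le> i \<and> i \<le> j \<and> j \<le> min r s \<and>
    (\<forall>l\<in>{1..min r s}. plam F r s l = L \<longleftrightarrow> l \<in> {i..j})"

lemma plam_in_block: "block F r s i j L \<Longrightarrow> i \<le> l \<Longrightarrow> l \<le> j \<Longrightarrow> plam F r s l = L"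
  by (auto simp: block_def)

lemma plam_before_block: "block F r s i j L \<Longrightarrow> 1 \<le> l \<Longrightarrow> l < i \<Longrightarrow> L < plam F r s l"
proof -
  assume b: "block F r s i j L" and l: "1 \<le> l" "l < i"
  then have "plam F r s i \<le> plam F r s l" by (intro plam_antimono) (auto simp: block_def)
  moreover have "plam F r s i = L" "plam F r s l \<noteq> L" using b l by (auto simp: block_def)
  ultimately show ?thesis by simp
qed

lemma plam_after_block: "block F r s i j L \<Longrightarrow> j < l \<Longrightarrow> l \<le> min r s \<Longrightarrow> plam F r s l < L"
proof -
  assume b: "block F r s i j L" and l: "j < l" "l \<le> min r s"
  then have "plam F r s l \<le> plam F r s j" by (intro plam_antimono) (auto simp: block_def)
  moreover have "plam F r s j = L" "plam F r s l \<noteq> L" using b l by (auto simp: block_def)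
  ultimately show ?thesis by simp
qed

lemma block_pos: "block F r s i j L \<Longrightarrow> 1 \<le> L"
  using plam_pos[of i r s F] by (auto simp: block_def Suc_le_eq)

lemma blockI:
  fixes F :: "'a::field itself" and r s l :: nat
  assumes "1 \<le> l" "l \<le> min r s"
  defines "A \<equiv> {i \<in> {1..min r s}. plam F r s i = plam F r s l}"
  shows "block F r s (Min A) (Max A) (plam F r s l)" "Min A \<le> l" "l \<le> Max A"
proof -
  have A: "k \<in> A \<longleftrightarrow> 1 \<le> k \<and> k \<le> min r s \<and> plam F r s k = plam F r s l" for k
    by (auto simp: A_def)
  have "A \<subseteq> {1..min r s}" by (auto simp: A_def)
  then have fin: "finite A" by (rule finite_subset) simp
  have l: "l \<in> A" using assms(1,2) by (simp add: A)
  then have mem: "Min A \<in> A" "Max A \<in> A" using fin by (auto intro: Min_in Max_in)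
  show le: "Min A \<le> l" "l \<le> Max A" using fin l by (rule Min_le, rule Max_ge)
  have "k \<in> A" if "Min A \<le> k" "k \<le> Max A" for k
    using that mem plam_antimono[of "Min A" k r F s] plam_antimono[of k "Max A" r F s]
    unfolding A by linarith
  moreover have "Min A \<le> k" "k \<le> Max A" if "k \<in> A" for k
    using fin that by (rule Min_le, rule Max_ge)
  ultimately have mm: "k \<in> A \<longleftrightarrow> k \<in> {Min A..Max A}" for k by (meson atLeastAtMost_iff)
  show "block F r s (Min A) (Max A) (plam F r s l)"
    unfolding block_def
  proof (intro conjI ballI)
    fix k assume "k \<in> {1..min r s}"
    then show "(plam F r s k = plam F r s l) = (k \<in> {Min A..Max A})"
      using A mm by (meson atLeastAtMost_iff)
  qed (use mem le in \<open>unfold A, linarith+\<close>)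
qed

text \<open>Since the parts decrease, comparing the interval with its two neighbours is enough for
  maximality.\<close>

lemma blockI':
  assumes "1 \<le> i" "i \<le> j" "j \<le> min r s" "plam F r s i = L" "plam F r s j = L"
    and "i = 1 \<or> plam F r s (i - 1) \<noteq> L" "j = min r s \<or> plam F r s (j + 1) \<noteq> L"
  shows "block F r s i j L"
proof -
  have "l \<in> {i..j}" if l: "l \<in> {1..min r s}" "plam F r s l = L" for l
  proof (rule ccontr)
    assume "l \<notin> {i..j}"
    then consider "l < i" | "j < l" by force
    then show False
    proof cases
      case 1
      then have "plam F r s (i - 1) \<le> plam F r s l" "plam F r s i \<le> plam F r s (i - 1)"
        using 1 l assms(1-3) plam_antimono[of l "i - 1" r F s] plam_antimono[of "i - 1" i r F s] by auto
      then show False using 1 l assms by auto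
    next
      case 2
      then have "plam F r s l \<le> plam F r s (j + 1)" "plam F r s (j + 1) \<le> plam F r s j"
        using 2 l assms(1-3) plam_antimono[of "j + 1" l r F s] plam_antimono[of j "j + 1" r F s] by auto
      then show False using 2 l assms by auto
    qed
  qed
  moreover have "plam F r s l = L" if "l \<in> {i..j}" for l
    using plam_antimono[of i l r F s] plam_antimono[of l j r F s] that assms by auto
  ultimately have "\<forall>l\<in>{1..min r s}. plam F r s l = L \<longleftrightarrow> l \<in> {i..j}" by blast
  then show ?thesis unfolding block_def using assms(1-3) by blast
qed

text \<open>As \<open>L + i + j = r + s + 1\<close> for a block, the condition reads
  \<open>(X + Y)^(L-1) u = x_j\<close>. The coefficients of \<open>u\<close> are thus the
  antidiagonal of J(r,s) that belongs to the first index of the block.\<close>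

definition block_gen :: "nat \<Rightarrow> nat \<Rightarrow> nat \<Rightarrow> nat \<Rightarrow> nat \<Rightarrow> 'a::field poly \<Rightarrow> bool"
  where "block_gen r s i j L u \<longleftrightarrow> deg_le u (int i - 1) \<and>
    (\<forall>k\<in>{1..j}. coeff ([:1, 1:] ^ (L - 1) * u) (r - k) = (- 1) ^ (k - 1))"

lemma linear_power_mult_comm:
  "[:1, 1:] ^ n * ([:1, 1:] * u) = [:1, 1:] ^ Suc n * (u :: 'a::comm_ring_1 poly)"
  by (simp only: power_Suc ac_simps)

lemma linear_power_mult_pred:
  "1 \<le> n \<Longrightarrow> [:1, 1:] ^ n * u = [:1, 1:] * ([:1, 1:] ^ (n - 1) * (u :: 'a::comm_ring_1 poly))"
  using linear_power_mult_comm[of "n - 1" u] by (cases n) (simp_all only: ac_simps diff_Suc_1 power_Suc not_one_le_zero)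

text \<open>A preimage of \<open>x_j\<close> under the highest possible power. If it vanished at -1,
  its factor \<open>X + 1\<close> could be moved into the power, which would be one too
  many.\<close>

lemma block_end:
  assumes b: "block TYPE('a::field) r s i j L"
  obtains u :: "'a::field poly" where "deg_le u (int r + int s - int j - int L)" "poly u (- 1) \<noteq> 0"
    "\<forall>k\<in>{1..j}. coeff ([:1, 1:] ^ (L - 1) * u) (r - k) = (- 1) ^ (k - 1)"
proof -
  have j: "1 \<le> j" "plam TYPE('a) r s j = L" and L: "1 \<le> L"
    using b block_pos[OF b] by (auto simp: block_def)
  then have "hits TYPE('a) r s j (L - 1)" using less_plam_iff[of j "L - 1" "TYPE('a)" r s] by simp
  then obtain u :: "'a poly" where u: "deg_le u (int r + int s - int j - 1 - int (L - 1))"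
    "\<forall>k\<in>{1..j}. coeff ([:1, 1:] ^ (L - 1) * u) (r - k) = (- 1) ^ (k - 1)"
    unfolding hits_def by blast
  have "poly u (- 1) \<noteq> 0"
  proof
    assume "poly u (- 1) = 0"
    then obtain u' where u': "u = [:1, 1:] * u'" by (auto simp flip: linear_dvd_iff elim: dvdE)
    have "deg_le u' (int r + int s - int j - 1 - int L)"
      using u(1) L deg_le_linear_power_mult_iff[of 1 u'] unfolding u' by (simp add: of_nat_diff algebra_simps)
    moreover have "[:1, 1:] ^ (L - 1) * u = [:1, 1:] ^ L * u'"
      unfolding u' linear_power_mult_comm using L by simp
    ultimately have "hits TYPE('a) r s j L" using u(2) unfolding hits_def by metis
    then show False using j less_plam_iff[of j L "TYPE('a)" r s] by simp
  qed
  moreover have "int r + int s - int j - 1 - int (L - 1) = int r + int s - int j - int L"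
    using L by (simp add: of_nat_diff)
  ultimately show ?thesis using that u by metis
qed

lemma alternating_window:
  fixes g :: "'a::comm_ring_1 poly"
  assumes "\<forall>k\<in>{1..j}. coeff g (r - k) = (- 1) ^ (k - 1)" "1 \<le> k" "k < j" "j \<le> r"
  shows "coeff ([:1, 1:] * g) (r - k) = 0"
proof -
  have "r - k - 1 = r - Suc k" by simp
  then show ?thesis
    using assms(1)[rule_format, of k] assms(1)[rule_format, of "Suc k"] assms(2-)
    by (cases k) (auto simp: coeff_linear_mult simp del: mult_pCons_left)
qed

text \<open>The preimage \<open>u\<close> of \<open>x_j\<close> is killed by one more factor
  \<open>X + Y\<close> and is nonzero at -1. By \<open>not_hitsI\<close> the part at
  \<open>l = r + s + 1 - j - L\<close> is at most \<open>L\<close>; parts before the block are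
  larger, so \<open>i <= l\<close>.\<close>

lemma block_length_le:
  assumes b: "block TYPE('a::field) r s i j L"
  shows "L + i + j \<le> r + s + 1"
proof -
  from block_end[OF b] obtain u :: "'a poly" where u: "deg_le u (int r + int s - int j - int L)"
    "poly u (- 1) \<noteq> 0" "\<forall>k\<in>{1..j}. coeff ([:1, 1:] ^ (L - 1) * u) (r - k) = (- 1) ^ (k - 1)" by blast
  have L: "1 \<le> L" and ij: "1 \<le> i" "i \<le> j" "j \<le> min r s" using b block_pos[OF b] by (auto simp: block_def)
  have "u \<noteq> 0" using u(2) by auto
  then have c0: "j + L \<le> r + s" using deg_le_neg[OF u(1)] by force
  define l where "l = r + s - j - L + 1"
  have l1: "1 \<le> l" by (simp add: l_def)
  have "i \<le> l"
  proof (cases "l \<le> min r s")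
    case True
    have "vanishes r s (int l - 1 + int L) ([:1, 1:] ^ L * u)"
      unfolding vanishes_def
    proof (intro allI impI)
      fix m assume m: "m < r" "int l - 1 + int L - int s < int m"
      have "coeff ([:1, 1:] * ([:1, 1:] ^ (L - 1) * u)) (r - (r - m)) = 0"
        by (rule alternating_window[OF u(3)]) (use m ij c0 in \<open>auto simp: l_def\<close>)
      then show "coeff ([:1, 1:] ^ L * u) m = 0"
        unfolding linear_power_mult_pred[OF L] using m by (simp del: mult_pCons_left)
    qed
    moreover have "int l - 1 = int r + int s - int j - int L" using c0 by (simp add: l_def)
    ultimately have "\<not> hits TYPE('a) r s l L"
      using not_hitsI[of u l r s L] u(1,2) l1 True by (metis min.bounded_iff)
    then have "plam TYPE('a) r s l \<le> L" using less_plam_iff[OF l1, of L] l1 not_le by blast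
    then show ?thesis using plam_before_block[OF b l1] by (meson leD leI)
  next
    case False
    then show ?thesis using ij by auto
  qed
  then show ?thesis using c0 by (simp add: l_def)
qed

text \<open>Here the witness \<open>w\<close> at the first index is used. Just before it is killed,
  \<open>g = (X + 1)^(L-1) w\<close> is a nonzero kernel element, hence a multiple of some
  \<open>x_\<delta>\<close>. So the part at \<open>\<delta>\<close> is at least \<open>L\<close>,
  which puts \<open>\<delta>\<close> at or before \<open>j\<close>.\<close>

lemma block_length_ge:
  assumes b: "block TYPE('a::field) r s i j L"
  shows "r + s + 1 \<le> L + i + j"
proof -
  have L: "1 \<le> L" and ij: "1 \<le> i" "i \<le> j" "j \<le> min r s" and Li: "plam TYPE('a) r s i = L"
    using b block_pos[OF b] by (auto simp: block_def)
  have "\<not> hits TYPE('a) r s i L" using less_plam_iff[of i L "TYPE('a)" r s] Li ij by simp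
  then obtain w :: "'a poly" where w: "deg_le w (int i - 1)" "poly w (- 1) \<noteq> 0"
    "vanishes r s (int i - 1 + int L) ([:1, 1:] ^ L * w)"
    by (rule not_hitsE) (use ij in auto)
  define g where "g = [:1, 1:] ^ (L - 1) * w"
  have g1: "[:1, 1:] ^ L * w = [:1, 1:] * g"
    unfolding g_def by (rule linear_power_mult_pred[OF L])
  have "hits TYPE('a) r s i (L - 1)" using less_plam_iff[of i "L - 1" "TYPE('a)" r s] Li ij L by simp
  then have "\<not> vanishes r s (int i - 1 + int (L - 1)) g"
    using not_hitsI[OF w(1,2), of r s "L - 1"] ij unfolding g_def by auto
  then obtain m where m: "m < r" "int i + int L - 2 - int s < int m" "coeff g m \<noteq> 0"
    using L by (auto simp: vanishes_def of_nat_diff algebra_simps)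
  have step: "coeff g n + (if n = 0 then 0 else coeff g (n - 1)) = 0"
    if "n < r" "int i + int L - 1 - int s < int n" for n
    using w(3) that unfolding g1 vanishes_def coeff_linear_mult by (auto simp: algebra_simps)
  \<comment> \<open>Otherwise the window reaches down to exponent 0, and the recursion kills every
    coefficient below \<open>X^r\<close>.\<close>
  have sL: "s + 1 \<le> i + L"
  proof (rule ccontr)
    assume "\<not> s + 1 \<le> i + L"
    then have s0: "int i + int L - 1 - int s < 0" by simp
    have "coeff g n = 0" if "n < r" for n
      using that
    proof (induction n)
      case 0 then show ?case using step[of 0] s0 by simp
    next
      case (Suc n) then show ?case using step[of "Suc n"] s0 by simp
    qed
    then show False using m by simp
  qed
  \<comment> \<open>The smallest exponent of the window; from here up to \<open>r - 1\<close> the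
    coefficients alternate.\<close>
  define n0 where "n0 = i + L - 1 - s"
  have alt: "coeff g (n0 + n) = (- 1) ^ n * coeff g n0" if "n0 + n < r" for n
    using that
  proof (induction n)
    case (Suc n)
    then show ?case using step[of "Suc (n0 + n)"] sL by (simp add: n0_def of_nat_diff eq_neg_iff_add_eq_0)
  qed simp
  have m0: "n0 \<le> m" using m sL by (simp add: n0_def of_nat_diff)
  have "coeff g n0 \<noteq> 0" using alt[of "m - n0"] m m0 by auto
  define \<delta> where "\<delta> = r - n0"
  have c0: "coeff g (r - 1) \<noteq> 0" using alt[of "r - 1 - n0"] m m0 \<open>coeff g n0 \<noteq> 0\<close> by auto
  define c where "c = coeff g (r - 1)"
  have tail: "coeff g (r - k) = (- 1) ^ (k - 1) * c" if "k \<in> {1..\<delta>}" for k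
  proof -
    have *: "r - k = n0 + (r - k - n0)" "r - 1 = n0 + (r - k - n0 + (k - 1))" "r - k < r" "r - 1 < r"
      using that m m0 by (auto simp: \<delta>_def)
    have "coeff g (r - k) = (- 1) ^ (r - k - n0) * coeff g n0"
      using alt[of "r - k - n0"] *(3) unfolding *(1)[symmetric] by blast
    moreover have "c = (- 1) ^ (r - k - n0 + (k - 1)) * coeff g n0"
      unfolding c_def using alt[of "r - k - n0 + (k - 1)"] *(4) unfolding *(2)[symmetric] by blast
    ultimately show ?thesis by (simp add: power_add)
  qed
  have dg: "deg_le g (int i + int L - 2)"
    unfolding g_def deg_le_linear_power_mult_iff using w(1) L by (simp add: of_nat_diff)
  \<comment> \<open>The nonzero coefficient at \<open>X^(r-1)\<close> must respect the degree bound
    of \<open>g\<close>; this yields \<open>\<delta> <= s\<close>.\<close>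
  have rL: "r + 1 \<le> i + L"
    using dg c0 m L by (auto simp: deg_le_def dest!: spec[of _ "r - 1"])
  have \<delta>: "1 \<le> \<delta>" "\<delta> \<le> min r s" "r + s + 1 = L + i + \<delta>"
    using m m0 sL rL by (auto simp: \<delta>_def n0_def)
  have "hits TYPE('a) r s \<delta> (L - 1)"
    unfolding hits_def
  proof (intro exI conjI ballI)
    show "deg_le (smult (1 / c) w) (int r + int s - int \<delta> - 1 - int (L - 1))"
      by (rule deg_le_smult[OF deg_le_mono[OF w(1)]]) (use \<delta> L in auto)
    fix k assume "k \<in> {1..\<delta>}"
    from tail[OF this] show "coeff ([:1, 1:] ^ (L - 1) * smult (1 / c) w) (r - k) = (- 1) ^ (k - 1)"
      using c0 unfolding mult_smult_right g_def[symmetric] by (simp add: c_def)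
  qed
  then have "L \<le> plam TYPE('a) r s \<delta>" using less_plam_iff[of \<delta> "L - 1" "TYPE('a)" r s] \<delta> L by simp
  then have "\<delta> \<le> j" using plam_after_block[OF b, of \<delta>] \<delta> by force
  then show ?thesis using \<delta> by simp
qed

lemma block_length:
  assumes "block TYPE('a::field) r s i j L"
  shows "L + i + j = r + s + 1"
  using block_length_le[OF assms] block_length_ge[OF assms] by simp

lemma block_gen_exists:
  assumes b: "block TYPE('a::field) r s i j L"
  obtains u :: "'a::field poly" where "block_gen r s i j L u" "poly u (- 1) \<noteq> 0"
proof -
  have "int r + int s - int j - int L = int i - 1" using block_length[OF b] by simp
  then show ?thesis using block_end[OF b] that unfolding block_gen_def by metis
qed

text \<open>This is the uniqueness of \<open>y\<close> in the definition of J. Strip all factors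
  \<open>X + 1\<close> from \<open>w\<close>, say \<open>n\<close> of them: the rest
  \<open>v\<close> certifies that the part at \<open>i - n\<close> is at most
  \<open>L - 1 + n\<close>. For \<open>n = 0\<close> this contradicts the part at \<open>i\<close>;
  for \<open>n > 0\<close> the index \<open>i - n\<close> lies in an earlier block, and
  \<open>block_length\<close> makes its part too large.\<close>

lemma block_ker_eq_0:
  fixes w :: "'a::field poly"
  assumes b: "block TYPE('a) r s i j L"
    and w: "deg_le w (int i - 1)" "vanishes r s (int i - 2 + int L) ([:1, 1:] ^ (L - 1) * w)"
  shows "w = 0"
proof (rule ccontr)
  assume w0: "w \<noteq> 0"
  have L: "1 \<le> L" and ij: "1 \<le> i" "i \<le> j" "j \<le> min r s" and len: "L + i + j = r + s + 1"
    using b block_pos[OF b] block_length[OF b] by (auto simp: block_def)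
  obtain v where v: "w = [:1, 1:] ^ Polynomial.order (- 1) w * v" "\<not> [:1, 1:] dvd v"
    using order_decomp[OF w0, of "- 1"] by auto
  define n where "n = Polynomial.order (- 1) w"
  have v': "deg_le v (int i - 1 - int n)" "poly v (- 1) \<noteq> 0"
    using w(1) v unfolding n_def[symmetric] by (auto simp: deg_le_linear_power_mult_iff linear_dvd_iff)
  have ni: "n < i" using deg_le_neg[OF v'(1)] v'(2) by force
  have eq: "[:1, 1:] ^ (L - 1 + n) * v = [:1, 1:] ^ (L - 1) * w"
    using v(1) by (simp add: power_add mult.assoc n_def)
  have "\<not> hits TYPE('a) r s (i - n) (L - 1 + n)"
  proof (rule not_hitsI[of v])
    have "int (i - n) - 1 + int (L - 1 + n) = int i - 2 + int L" using ni L by (simp add: of_nat_diff)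
    then show "vanishes r s (int (i - n) - 1 + int (L - 1 + n)) ([:1, 1:] ^ (L - 1 + n) * v)"
      using w(2) unfolding eq by metis
  qed (use v' ni ij in \<open>auto simp: of_nat_diff algebra_simps\<close>)
  then have le: "plam TYPE('a) r s (i - n) \<le> L - 1 + n"
    using less_plam_iff[of "i - n" "L - 1 + n" "TYPE('a)" r s] ni by linarith
  show False
  proof (cases "n = 0")
    case True
    then show ?thesis using le plam_in_block[OF b, of i] ij L by simp
  next
    case False
    have in1: "1 \<le> i - n" "i - n \<le> min r s" using ni ij by auto
    from blockI(1,2)[OF this]
    obtain i' j' where b': "block TYPE('a) r s i' j' (plam TYPE('a) r s (i - n))" "i' \<le> i - n"
      by blast
    have "j' < i"
    proof (rule ccontr)
      assume "\<not> j' < i"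
      then have "plam TYPE('a) r s i = plam TYPE('a) r s (i - n)"
        using plam_in_block[OF b'(1), of i] b'(2) by simp
      then show False using plam_before_block[OF b in1(1)] plam_in_block[OF b, of i] ni ij False by simp
    qed
    then show False using block_length[OF b'(1)] b'(2) le len L ni ij by linarith
  qed
qed

text \<open>A certificate for parts. Reaching \<open>x_j\<close> bounds the part at \<open>j\<close>
  from below; one more factor kills \<open>u\<close>, which is nonzero at -1, so the part at
  \<open>i\<close> is at most \<open>L\<close>. Monotonicity does the rest. It is applied to the
  dual form and to \<open>Y\<close>.\<close>

lemma plam_eqI:
  fixes u :: "'a::field poly"
  assumes ij: "1 \<le> i" "i \<le> j" "j \<le> min r s" "1 \<le> L" "L + i + j = r + s + 1"
    and u: "block_gen r s i j L u" "poly u (- 1) \<noteq> 0" and l: "i \<le> l" "l \<le> j"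
  shows "plam TYPE('a) r s l = L"
proof -
  have du: "deg_le u (int i - 1)" and alt: "\<forall>k\<in>{1..j}. coeff ([:1, 1:] ^ (L - 1) * u) (r - k) = (- 1) ^ (k - 1)"
    using u by (auto simp: block_gen_def)
  have "int i - 1 = int r + int s - int j - 1 - int (L - 1)" using ij by linarith
  then have "hits TYPE('a) r s j (L - 1)" using du alt unfolding hits_def by metis
  then have "L \<le> plam TYPE('a) r s j" using less_plam_iff[of j "L - 1" "TYPE('a)" r s] ij by linarith
  moreover have "vanishes r s (int i - 1 + int L) ([:1, 1:] ^ L * u)"
    unfolding vanishes_def
  proof (intro allI impI)
    fix m assume m: "m < r" "int i - 1 + int L - int s < int m"
    have "coeff ([:1, 1:] * ([:1, 1:] ^ (L - 1) * u)) (r - (r - m)) = 0"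
      by (rule alternating_window[OF alt]) (use m ij in linarith)+
    then show "coeff ([:1, 1:] ^ L * u) m = 0"
      unfolding linear_power_mult_pred[OF ij(4)] using m by (simp del: mult_pCons_left)
  qed
  then have "\<not> hits TYPE('a) r s i L" using ij by (intro not_hitsI[OF du u(2)]) auto
  then have "plam TYPE('a) r s i \<le> L" using less_plam_iff[of i L "TYPE('a)" r s] ij by linarith
  ultimately show ?thesis
    using plam_antimono[of i l r "TYPE('a)" s] plam_antimono[of l j r "TYPE('a)" s] l ij by simp
qed

section \<open>The dual pair\<close>

definition xpoly :: "nat \<Rightarrow> nat \<Rightarrow> 'a::comm_ring_1 poly"
  where "xpoly r l = (\<Sum>k=1..l. monom ((- 1) ^ (k - 1)) (r - k))"

lemma coeff_xpoly:
  assumes "l \<le> r"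
  shows "coeff (xpoly r l) m = (if m < r \<and> r - l \<le> m then (- 1) ^ (r - m - 1) else 0)"
proof (cases "m < r \<and> r - l \<le> m")
  case True
  have "coeff (xpoly r l) m = (\<Sum>k=1..l. if k = r - m then (- 1) ^ (r - m - 1) else 0)"
    unfolding xpoly_def coeff_sum coeff_monom
    using True assms by (intro sum.cong) auto
  moreover have "1 \<le> r - m" "r - m \<le> l" using True assms by auto
  ultimately show ?thesis using True by simp
next
  case False
  then show ?thesis
    unfolding xpoly_def coeff_sum coeff_monom using assms by (auto intro!: sum.neutral)
qed

lemma linear_mult_monom: "[:1, 1:] * monom c n = monom c (Suc n) + monom c n"
  for c :: "'a::comm_ring_1"
  by (simp add: monom_Suc)

text \<open>The alternating sum telescopes. With \<open>Y\<close> restored the two terms are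
  \<open>X^r Y^(s-l)\<close> and \<open>X^(r-l) Y^s\<close> up to sign, the explicit reason why
  \<open>x_l\<close> is in the kernel.\<close>

lemma linear_mult_xpoly:
  assumes "1 \<le> l" "l \<le> r"
  shows "[:1, 1:] * xpoly r l = monom 1 r + monom ((- 1) ^ (l - 1)) (r - l)"
  using assms
proof (induction l rule: dec_induct)
  case base
  then show ?case by (simp add: xpoly_def linear_mult_monom del: mult_pCons_left)
next
  case (step l)
  have x: "xpoly r (Suc l) = xpoly r l + monom ((- 1) ^ l) (r - Suc l)"
    by (simp add: xpoly_def)
  have "Suc (r - Suc l) = r - l" using step by simp
  moreover have "monom ((- 1) ^ (l - 1)) (r - l) + monom ((- 1) ^ l) (r - l) = (0 :: 'a poly)"
    using step(1) by (cases l) (auto simp: add_monom)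
  ultimately show ?case
    unfolding x distrib_left linear_mult_monom using step by (simp del: mult_pCons_left)
qed

text \<open>Evaluation at -1 settles the sign for odd \<open>q\<close> and for characteristic 2 at
  once.\<close>

lemma frobenius_minus_one:
  assumes "[:1, 1:] ^ q = (1 + monom 1 q :: 'a::field poly)" "1 \<le> q"
  shows "(- 1 :: 'a) ^ q = - 1"
proof -
  have "poly ([:1, 1:] ^ q) (- 1 :: 'a) = 0" using assms(2) by simp
  then show ?thesis unfolding assms(1) by (simp add: poly_monom add_eq_0_iff)
qed

lemma sign_eqI:
  fixes a :: "'a::comm_ring_1"
  assumes "a * (- 1) ^ j = - 1" "1 \<le> j"
  shows "a = (- 1) ^ (j - 1)"
proof (cases j)
  case (Suc m)
  then have "a * (- 1) ^ m = 1" using assms(1) by simp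
  moreover have "(- 1 :: 'a) ^ m * (- 1) ^ m = 1" by (simp flip: power_mult_distrib)
  ultimately show ?thesis using Suc by (metis diff_Suc_1 mult.assoc mult.left_neutral mult.right_neutral)
qed (use assms in simp)

lemma linear_mult_geometric:
  "[:1, 1:] * (\<Sum>i<n. monom ((- 1) ^ i) i) = (1 - monom ((- 1) ^ n) n :: 'a::comm_ring_1 poly)" (is "_ * ?g n = _")
  for n :: nat
proof (induction n)
  case (Suc n)
  have "[:1, 1:] * ?g (Suc n) = [:1, 1:] * ?g n + [:1, 1:] * monom ((- 1) ^ n) n"
    by (simp add: distrib_left del: mult_pCons_left)
  also have "\<dots> = 1 - monom ((- 1) ^ Suc n) (Suc n)"
  proof -
    have "monom ((- 1) ^ Suc n) (Suc n) = (- monom ((- 1) ^ n) (Suc n) :: 'a poly)" by (simp add: minus_monom)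
    then show ?thesis unfolding Suc.IH linear_mult_monom by (simp del: power_Suc)
  qed
  finally show ?case .
qed (simp add: monom_0 one_pCons)

lemma linear_mult_cancel: "[:1, 1:] * f = [:1, 1:] * g \<longleftrightarrow> f = g" for f g :: "'a::idom poly"
  by (metis mult_cancel_left pCons_eq_0_iff zero_neq_one)

lemma frobenius_power_pred:
  assumes "[:1, 1:] ^ q = (1 + monom 1 q :: 'a::field poly)" "1 \<le> q"
  shows "[:1, 1:] ^ (q - 1) = (\<Sum>i<q. monom ((- 1) ^ i) i :: 'a poly)"
proof -
  have "[:1, 1:] * [:1, 1:] ^ (q - 1) = ([:1, 1:] ^ q :: 'a poly)"
    using assms(2) by (cases q) (simp_all del: mult_pCons_left)
  also have "\<dots> = [:1, 1:] * (\<Sum>i<q. monom ((- 1) ^ i) i)"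
    unfolding linear_mult_geometric assms(1) frobenius_minus_one[OF assms] by (simp flip: minus_monom)
  finally show ?thesis by (simp only: linear_mult_cancel)
qed

text \<open>One direction is a degree count. Conversely \<open>(X + 1)^(q-1)\<close> is itself an
  alternating sum, so a constant multiple of it hits \<open>x_k\<close> whenever the degree leaves
  room.\<close>

lemma le_plam_frobenius_iff:
  assumes fr: "[:1, 1:] ^ q = (1 + monom 1 q :: 'a::field poly)" and q: "R < q" "S < q"
    and k: "1 \<le> k" "k \<le> min R S"
  shows "q \<le> plam TYPE('a) R S k \<longleftrightarrow> k + q \<le> R + S"
proof -
  have q1: "1 \<le> q" using q by simp
  have "q \<le> plam TYPE('a) R S k \<longleftrightarrow> hits TYPE('a) R S k (q - 1)"
    using less_plam_iff[of k "q - 1" "TYPE('a)" R S] k q1 by auto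
  also have "\<dots> \<longleftrightarrow> k + q \<le> R + S"
  proof
    assume "hits TYPE('a) R S k (q - 1)"
    from hits_bound[OF this k(1)] show "k + q \<le> R + S" using q1 by linarith
  next
    assume kq: "k + q \<le> R + S"
    show "hits TYPE('a) R S k (q - 1)"
      unfolding hits_def
    proof (intro exI conjI ballI)
      show "deg_le (monom ((- 1) ^ (R - 1)) 0 :: 'a poly) (int R + int S - int k - 1 - int (q - 1))"
        using kq q1 by (intro deg_le_monom) linarith
      fix i assume i: "i \<in> {1..k}"
      have "coeff ([:1, 1:] ^ (q - 1) * monom ((- 1) ^ (R - 1)) 0 :: 'a poly) (R - i) = (- 1) ^ (R - 1) * (- 1) ^ (R - i)"
        using i k q unfolding frobenius_power_pred[OF fr q1]
        by (simp add: monom_0 mult.commute coeff_sum coeff_monom)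
      also have "\<dots> = (- 1) ^ (2 * (R - i) + (i - 1))"
        unfolding power_add[symmetric] using i k by (intro arg_cong[where f = "(^) (- 1)"]) auto
      also have "\<dots> = (- 1) ^ (i - 1)" by (simp add: power_add)
      finally show "coeff ([:1, 1:] ^ (q - 1) * monom ((- 1) ^ (R - 1)) 0 :: 'a poly) (R - i) = (- 1) ^ (i - 1)" .
    qed
  qed
  finally show ?thesis .
qed

text \<open>
  A syzygy of \<open>X\<^sup>R\<close>, \<open>Y\<^sup>S\<close>, \<open>(X + Y)\<^sup>L\<close> turns into one of \<open>X\<^sup>q\<^sup>-\<^sup>R\<close>, \<open>Y\<^sup>q\<^sup>-\<^sup>S\<close>, \<open>(X + Y)\<^sup>L\<close> with the
  first two cofactors exchanged, because \<open>(X + Y)\<^sup>q = X\<^sup>q + Y\<^sup>q\<close>.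
\<close>

lemma block_syzygy:
  fixes a :: "'a::field poly"
  assumes fr: "[:1, 1:] ^ q = (1 + monom 1 q :: 'a poly)" and q: "R < q" "S < q"
    and b: "block TYPE('a) R S i j L" and ie: "R + S < i + q" and a: "block_gen R S i j L a"
  obtains f h b where
    "deg_le f (int S - int j - 1)" "deg_le h (int R - int j - 1)" "deg_le b (int i + int q - int R - int S - 1)"
    "[:1, 1:] ^ L * a = monom 1 R * (1 + [:1, 1:] * f) + (monom ((- 1) ^ (j - 1)) (R - j) + [:1, 1:] * h)"
    "[:1, 1:] ^ L * b = (1 + [:1, 1:] * f) - monom 1 (q - R) * (monom ((- 1) ^ (j - 1)) (R - j) + [:1, 1:] * h)"
    "monom 1 R * b = a - [:1, 1:] ^ (q - L) * (monom ((- 1) ^ (j - 1)) (R - j) + [:1, 1:] * h)"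
    "L < q"
proof -
  have ij: "1 \<le> i" "i \<le> j" "j \<le> min R S" and L1: "1 \<le> L" and len: "L + i + j = R + S + 1"
    using b block_pos[OF b] block_length[OF b] by (auto simp: block_def)
  have Lq: "L < q"
    using le_plam_frobenius_iff[OF fr q, of i] plam_in_block[OF b, of i] ij ie by auto
  define g where "g = [:1, 1:] ^ (L - 1) * a"
  have g: "coeff g (R - k) = (- 1) ^ (k - 1)" if "k \<in> {1..j}" for k
    using a that by (simp add: block_gen_def g_def)
  have "coeff (g - xpoly R j) m = 0" if "m < R" "int R - int j - 1 < int m" for m
  proof -
    have "R - m \<in> {1..j}" "R - (R - m) = m" using that ij by auto
    then show ?thesis using g[of "R - m"] that ij by (auto simp: coeff_xpoly)
  qed
  then obtain f h where fh: "g - xpoly R j = monom 1 R * f + h" "deg_le h (int R - int j - 1)"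
    by (rule window_split)
  have "deg_le g (int R + int S - int j - 1)"
    unfolding g_def deg_le_linear_power_mult_iff
    by (rule deg_le_mono[of _ "int i - 1"]) (use a len L1 in \<open>auto simp: block_gen_def\<close>)
  moreover have "deg_le (xpoly R j :: 'a poly) (int R + int S - int j - 1)"
    unfolding xpoly_def using ij by (intro deg_le_sum deg_le_monom) auto
  moreover have "deg_le h (int R + int S - int j - 1)" using fh(2) by (rule deg_le_mono) simp
  moreover have "monom 1 R * f = g - xpoly R j - h" using fh(1) by simp
  ultimately have "deg_le (monom 1 R * f) (int R + int S - int j - 1)"
    by (simp only: deg_le_diff)
  then have f: "deg_le f (int S - int j - 1)"
    unfolding deg_le_monom_mult_iff by (rule deg_le_mono) simp
  \<comment> \<open>Multiplying \<open>x_j + X^R f + h\<close> by \<open>X + 1\<close> telescopes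
    \<open>x_j\<close>, which contributes the 1 in \<open>F\<close> and the monomial in
    \<open>H\<close>.\<close>
  define F where "F = 1 + [:1, 1:] * f"
  define H where "H = monom ((- 1) ^ (j - 1)) (R - j) + [:1, 1:] * h"
  have "g = xpoly R j + monom 1 R * f + h" using fh(1) by (simp add: algebra_simps)
  then have "[:1, 1:] * g = [:1, 1:] * xpoly R j + monom 1 R * ([:1, 1:] * f) + [:1, 1:] * h"
    by (simp only: distrib_left ac_simps)
  also have "\<dots> = monom 1 R * F + H"
    using ij unfolding F_def H_def by (subst linear_mult_xpoly) (auto simp: distrib_left simp del: mult_pCons_left)
  finally have aFH: "[:1, 1:] ^ L * a = monom 1 R * F + H"
    unfolding linear_power_mult_pred[OF L1] g_def .
  have "monom 1 q = monom 1 R * (monom 1 (q - R) :: 'a poly)"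
    using q by (simp add: mult_monom)
  then have fq: "[:1, 1:] ^ L * [:1, 1:] ^ (q - L) = 1 + monom 1 R * (monom 1 (q - R) :: 'a poly)"
    using fr Lq by (simp flip: power_add del: mult_pCons_left)
  \<comment> \<open>Since \<open>X^q\<close> is \<open>(X + 1)^q - 1\<close> and
    \<open>L < q\<close>, the right-hand side is divisible by \<open>(X + 1)^L\<close>; the factor
    \<open>X^R\<close> on the left does not affect this divisibility.\<close>
  have "monom 1 R * (F - monom 1 (q - R) * H) = [:1, 1:] ^ L * a - (1 + monom 1 R * monom 1 (q - R)) * H"
    unfolding aFH by (simp add: algebra_simps)
  also have "\<dots> = [:1, 1:] ^ L * (a - [:1, 1:] ^ (q - L) * H)"
    unfolding fq[symmetric] by (simp only: right_diff_distrib mult.assoc)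
  finally have eq: "monom 1 R * (F - monom 1 (q - R) * H) = [:1, 1:] ^ L * (a - [:1, 1:] ^ (q - L) * H)" .
  have "[:1, 1:] ^ L dvd F - monom 1 (q - R) * H"
    by (rule linear_power_dvd_monom_mult[OF dvdI[OF eq]])
  then obtain b where bb: "F - monom 1 (q - R) * H = [:1, 1:] ^ L * b" by (auto elim: dvdE)
  have "[:1, 1:] ^ L * (monom 1 R * b) = [:1, 1:] ^ L * (a - [:1, 1:] ^ (q - L) * H)"
    using eq unfolding bb by (simp only: ac_simps)
  then have b3: "monom 1 R * b = a - [:1, 1:] ^ (q - L) * H"
    using linear_power_neq_0 mult_cancel_left by blast
  have "deg_le ([:1, 1:] * f) (int S - int j)" "deg_le ([:1, 1:] * h) (int R - int j)"
    using f fh(2) deg_le_linear_power_mult_iff[of 1 f] deg_le_linear_power_mult_iff[of 1 h]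
    by (simp_all add: algebra_simps del: mult_pCons_left)
  then have "deg_le F (int S - int j)" "deg_le H (int R - int j)"
    unfolding F_def H_def using ij by (auto intro!: deg_le_add deg_le_monom simp del: mult_pCons_left)
  then have "deg_le F (int q - int j)" "deg_le (monom 1 (q - R) * H) (int q - int j)"
    unfolding deg_le_monom_mult_iff using q by (auto elim!: deg_le_mono)
  then have "deg_le ([:1, 1:] ^ L * b) (int q - int j)"
    unfolding bb[symmetric] by (rule deg_le_diff)
  then have "deg_le b (int i + int q - int R - int S - 1)"
    unfolding deg_le_linear_power_mult_iff by (rule deg_le_mono) (use len in linarith)
  then show ?thesis
    using that[of f h b] f fh(2) aFH bb b3 Lq unfolding F_def H_def by simp
qed

text \<open>In the equation for \<open>b\<close> the monomials \<open>1\<close> and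
  \<open>X^(q-j)\<close> combine to \<open>X + 1\<close> times an alternating geometric sum, so one
  factor cancels. In the window of the dual pair \<open>f\<close> has too small a degree and
  \<open>X^(q-R) h\<close> too large an order. What is left are the signs of the geometric sum,
  which \<open>(-1)^R\<close> adjusts.\<close>

lemma dual_block_gen:
  fixes f h b :: "'a::field poly"
  assumes fr: "[:1, 1:] ^ q = (1 + monom 1 q :: 'a poly)" and q: "R < q" "S < q"
    and bl: "block TYPE('a) R S i j L" and ie: "R + S < i + q"
    and f: "deg_le f (int S - int j - 1)" and b: "deg_le b (int i + int q - int R - int S - 1)"
    and eq: "[:1, 1:] ^ L * b = (1 + [:1, 1:] * f) - monom 1 (q - R) * (monom ((- 1) ^ (j - 1)) (R - j) + [:1, 1:] * h)"
  shows "block_gen (q - R) (q - S) (i + q - R - S) (j + q - R - S) L (smult ((- 1) ^ R) b)"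
proof -
  have ij: "1 \<le> i" "i \<le> j" "j \<le> min R S" and L1: "1 \<le> L"
    using bl block_pos[OF bl] by (auto simp: block_def)
  have q1: "1 \<le> q" using q by simp
  define g where "g = (\<Sum>m<q - j. monom ((- 1) ^ m) m :: 'a poly)"
  have "(- 1 :: 'a) ^ (q - j) * (- 1) ^ j = - 1"
    using frobenius_minus_one[OF fr q1] ij q by (simp flip: power_add)
  then have "(- 1 :: 'a) ^ (q - j) = (- 1) ^ (j - 1)" using ij by (intro sign_eqI) auto
  then have "[:1, 1:] * g = 1 - monom ((- 1) ^ (j - 1)) (q - j)"
    unfolding g_def linear_mult_geometric by simp
  moreover have "monom 1 (q - R) * monom ((- 1) ^ (j - 1)) (R - j) = (monom ((- 1) ^ (j - 1)) (q - j) :: 'a poly)"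
    using q ij by (simp add: mult_monom)
  ultimately have "[:1, 1:] * ([:1, 1:] ^ (L - 1) * b) = [:1, 1:] * (g + f - monom 1 (q - R) * h)"
    unfolding linear_power_mult_pred[OF L1, symmetric] eq
    by (simp only: distrib_left right_diff_distrib mult.left_commute) (simp del: mult_pCons_left)
  then have gf: "[:1, 1:] ^ (L - 1) * b = g + f - monom 1 (q - R) * h"
    by (simp only: linear_mult_cancel)
  show ?thesis
    unfolding block_gen_def
  proof (intro conjI ballI)
    show "deg_le (smult ((- 1) ^ R) b) (int (i + q - R - S) - 1)"
      by (rule deg_le_mono[OF deg_le_smult[OF b]]) (use ie in auto)
    fix k assume k: "k \<in> {1..j + q - R - S}"
    have 1: "coeff g (q - R - k) = (- 1) ^ (q - R - k)"
    proof -
      have "q - R - k < q - j" using k ij q by auto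
      then show ?thesis by (simp add: g_def coeff_sum coeff_monom)
    qed
    have 2: "coeff f (q - R - k) = 0"
      by (rule deg_leD[OF f]) (use k ij q in auto)
    have 3: "coeff (monom 1 (q - R) * h) (q - R - k) = 0"
      using k q by (auto simp: coeff_monom_mult)
    have "(- 1 :: 'a) ^ R * (- 1) ^ (q - R - k) * (- 1) ^ k = (- 1) ^ q"
      using k ij q by (auto simp flip: power_add)
    also have "\<dots> = - 1" using frobenius_minus_one[OF fr q1] .
    finally have "(- 1 :: 'a) ^ R * (- 1) ^ (q - R - k) = (- 1) ^ (k - 1)"
      using k by (intro sign_eqI) auto
    then show "coeff ([:1, 1:] ^ (L - 1) * smult ((- 1) ^ R) b) (q - R - k) = (- 1) ^ (k - 1)"
      unfolding mult_smult_right gf coeff_smult coeff_diff coeff_add 1 2 3 by simp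
  qed
qed

text \<open>Because of \<open>L < q\<close> the correction term keeps a factor \<open>X + 1\<close>,
  so \<open>b\<close> inherits from \<open>a\<close> that it is nonzero at -1.\<close>

lemma dual_at_minus_one:
  fixes a :: "'a::field poly"
  assumes "monom 1 R * b = a - [:1, 1:] ^ (q - L) * H" "L < q"
  shows "(- 1) ^ R * poly b (- 1) = poly a (- 1)"
  using arg_cong[OF assms(1), of "\<lambda>f. poly f (- 1)"] assms(2) by (simp add: poly_monom)

lemma plam_dual:
  assumes fr: "[:1, 1:] ^ q = (1 + monom 1 q :: 'a::field poly)" and q: "R < q" "S < q"
    and bl: "block TYPE('a) R S i j L" and ie: "R + S < i + q" and l: "i \<le> l" "l \<le> j"
  shows "plam TYPE('a) (q - R) (q - S) (l + q - R - S) = L"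
proof -
  have ij: "1 \<le> i" "i \<le> j" "j \<le> min R S" and L1: "1 \<le> L" and len: "L + i + j = R + S + 1"
    using bl block_pos[OF bl] block_length[OF bl] by (auto simp: block_def)
  obtain a :: "'a poly" where a: "block_gen R S i j L a" "poly a (- 1) \<noteq> 0"
    using block_gen_exists[OF bl] .
  obtain f h b where fhb: "deg_le f (int S - int j - 1)"
    "deg_le b (int i + int q - int R - int S - 1)"
    "[:1, 1:] ^ L * b = (1 + [:1, 1:] * f) - monom 1 (q - R) * (monom ((- 1) ^ (j - 1)) (R - j) + [:1, 1:] * h)"
    "monom 1 R * b = a - [:1, 1:] ^ (q - L) * (monom ((- 1) ^ (j - 1)) (R - j) + [:1, 1:] * h)" "L < q"
    using block_syzygy[OF fr q bl ie a(1)] by metis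
  show ?thesis
  proof (rule plam_eqI[OF _ _ _ L1 _ dual_block_gen[OF fr q bl ie fhb(1-3)]])
    show "poly (smult ((- 1) ^ R) b) (- 1) \<noteq> 0"
      using dual_at_minus_one[OF fhb(4,5)] a(2) by simp
  qed (use ij q ie l len in auto)
qed

text \<open>\<open>plam_dual\<close> transports the parts, and maximality is checked at the
  neighbours. The delicate case is \<open>i = 1\<close>, in which the lower neighbour has no
  counterpart for \<open>R\<close>, \<open>S\<close>.\<close>

lemma block_dual:
  assumes fr: "[:1, 1:] ^ q = (1 + monom 1 q :: 'a::field poly)" and q: "R < q" "S < q"
    and bl: "block TYPE('a) R S i j L" and ie: "R + S < i + q"
  shows "block TYPE('a) (q - R) (q - S) (i + q - R - S) (j + q - R - S) L"
proof (rule blockI')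
  have ij: "1 \<le> i" "i \<le> j" "j \<le> min R S" using bl by (auto simp: block_def)
  then show "1 \<le> i + q - R - S" "i + q - R - S \<le> j + q - R - S" "j + q - R - S \<le> min (q - R) (q - S)"
    using ie q by auto
  show "plam TYPE('a) (q - R) (q - S) (i + q - R - S) = L" "plam TYPE('a) (q - R) (q - S) (j + q - R - S) = L"
    using plam_dual[OF fr q bl ie] ij by auto
  show "i + q - R - S = 1 \<or> plam TYPE('a) (q - R) (q - S) (i + q - R - S - 1) \<noteq> L"
  proof (cases "i + q - R - S = 1")
    case False
    then have ie': "R + S < i - 1 + q" using ie ij by simp
    show ?thesis
    proof (cases "i = 1")
      case True
      \<comment> \<open>The dual index before the block is \<open>q - R - S\<close>, whose part is
        at least \<open>q\<close> by the threshold lemma for the dual pair.\<close>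
      have "L < q"
        using le_plam_frobenius_iff[OF fr q, of i] plam_in_block[OF bl, of i] ij ie by auto
      moreover have "q \<le> plam TYPE('a) (q - R) (q - S) (q - R - S)"
        using True ie' ij q by (subst le_plam_frobenius_iff[OF fr]) auto
      ultimately show ?thesis using True by auto
    next
      case False
      then have i1: "1 \<le> i - 1" "i - 1 \<le> min R S" using ij by auto
      from blockI[OF this] obtain i' j' where
        b': "block TYPE('a) R S i' j' (plam TYPE('a) R S (i - 1))" "i' \<le> i - 1" "i - 1 \<le> j'" by blast
      have ne: "plam TYPE('a) R S (i - 1) \<noteq> L" using plam_before_block[OF bl i1(1)] ij by auto
      show ?thesis
      proof (cases "R + S < i' + q")
        case True
        have "plam TYPE('a) (q - R) (q - S) (i - 1 + q - R - S) = plam TYPE('a) R S (i - 1)"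
          by (rule plam_dual[OF fr q b'(1) True b'(2,3)])
        moreover have "i - 1 + q - R - S = i + q - R - S - 1" using ij by simp
        ultimately show ?thesis using ne by simp
      next
        case F: False
        \<comment> \<open>A block cannot straddle the threshold between parts of size at least
          \<open>q\<close> and smaller ones.\<close>
        have "q \<le> plam TYPE('a) R S i'" "\<not> q \<le> plam TYPE('a) R S (i - 1)"
          using F ie' ij False b' by (auto simp: le_plam_frobenius_iff[OF fr q] block_def)
        then show ?thesis using plam_in_block[OF b'(1), of i'] b'(2,3) by simp
      qed
    qed
  qed simp
  show "j + q - R - S = min (q - R) (q - S) \<or> plam TYPE('a) (q - R) (q - S) (j + q - R - S + 1) \<noteq> L"
  proof (cases "j = min R S")
    case True
    then show ?thesis using q by (auto simp: min_def)
  next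
    case False
    then have j1: "1 \<le> j + 1" "j + 1 \<le> min R S" using ij by auto
    from blockI[OF j1] obtain i' j' where
      b': "block TYPE('a) R S i' j' (plam TYPE('a) R S (j + 1))" "i' \<le> j + 1" "j + 1 \<le> j'" by blast
    have ne: "plam TYPE('a) R S (j + 1) < L" using plam_after_block[OF bl _ j1(2)] by simp
    have "i \<le> i'"
      using plam_in_block[OF bl, of i'] plam_in_block[OF b'(1), of i] ij b' ne plam_in_block[OF bl, of i]
      by (metis add_leD1 le_add1 le_trans linear nat_less_le)
    then have "R + S < i' + q" using ie by simp
    from plam_dual[OF fr q b'(1) this b'(2,3)]
    have "plam TYPE('a) (q - R) (q - S) (j + 1 + q - R - S) = plam TYPE('a) R S (j + 1)" .
    moreover have "j + 1 + q - R - S = j + q - R - S + 1" using ie ij by simp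
    ultimately show ?thesis using ne by simp
  qed
qed

section \<open>The elements \<open>z\<close> and \<open>y\<close>\<close>

lemma vanishes_iff:
  fixes g :: "'a::comm_ring_1 poly"
  shows "vanishes r s d g \<longleftrightarrow> (\<exists>A B. g = monom 1 r * A + B \<and> deg_le B (d - int s))"
proof
  assume "vanishes r s d g"
  then have "coeff g m = 0" if "m < r" "d - int s < int m" for m
    using that by (simp add: vanishes_def)
  then show "\<exists>A B. g = monom 1 r * A + B \<and> deg_le B (d - int s)"
    using window_split[of r "d - int s" g] by metis
next
  assume "\<exists>A B. g = monom 1 r * A + B \<and> deg_le B (d - int s)"
  then show "vanishes r s d g"
    by (auto simp: vanishes_def coeff_monom_mult deg_le_def)
qed

lemma vanishes_mult:
  fixes g :: "'a::idom poly"
  assumes "vanishes r s d g"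
  shows "vanishes r s (d + int k) ([:1, 1:] ^ k * g)"
proof -
  obtain A B where AB: "g = monom 1 r * A + B" "deg_le B (d - int s)"
    using assms by (auto simp: vanishes_iff)
  have "[:1, 1:] ^ k * g = monom 1 r * ([:1, 1:] ^ k * A) + [:1, 1:] ^ k * B"
    unfolding AB(1) by (simp only: distrib_left distrib_right ac_simps)
  moreover have "deg_le ([:1, 1:] ^ k * B) (d + int k - int s)"
    unfolding deg_le_linear_power_mult_iff using AB(2) by (rule deg_le_mono) simp
  ultimately show ?thesis unfolding vanishes_iff by blast
qed

section \<open>Substitution of \<open>X^q\<close> for \<open>X\<close>\<close>

lemma pcompose_power: "pcompose (f ^ n) g = pcompose f g ^ n" for f g :: "'a::comm_ring_1 poly"
  by (induction n) (simp_all add: pcompose_mult one_pCons)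

lemma pcompose_monom: "pcompose (monom c n) (monom 1 q) = monom c (q * n)" for c :: "'a::comm_ring_1"
proof (induction n)
  case (Suc n)
  then show ?case by (simp add: monom_Suc[of c n] pcompose_pCons mult_monom)
qed (simp add: monom_0)

lemma deg_le_pcompose:
  fixes f :: "'a::idom poly"
  assumes "deg_le f d"
  shows "deg_le (pcompose f (monom 1 q)) (int q * d)"
proof (cases "f = 0")
  case False
  then have "int (degree f) \<le> d" using assms by (simp add: deg_le_iff)
  then have "int q * int (degree f) \<le> int q * d" by (simp add: mult_left_mono)
  then show ?thesis
    by (simp add: deg_le_iff degree_pcompose degree_monom_eq mult.commute[of "degree f"])
qed simp

text \<open>The analogue of \<open>x\<close> for the leading digits: for \<open>t <= n + 1\<close>
  this is \<open>xpoly (n + 1) t\<close>. Evaluated at \<open>X^q\<close> it produces the signs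
  \<open>(-1)^i\<close> in \<open>z\<close>.\<close>

definition Theta :: "nat \<Rightarrow> nat \<Rightarrow> 'a::comm_ring_1 poly"
  where "Theta n t = (\<Sum>i<t. monom ((- 1) ^ i) (n - i))"

text \<open>The two alternating sums telescope. In \<open>Z_image\<close> this identity controls the
  coefficient of the cofactor \<open>F\<close>, and \<open>Theta_diff\<close> that of
  \<open>H\<close>.\<close>

lemma Theta_add:
  "Theta n (Suc t) + Theta (n - 1) t = (monom 1 n :: 'a::comm_ring_1 poly)"
proof -
  have "Theta n (Suc t) = monom 1 n - (Theta (n - 1) t :: 'a poly)"
    unfolding Theta_def sum.lessThan_Suc_shift
    by (simp add: sum_negf minus_monom flip: minus_monom)
  then show ?thesis by simp
qed

lemma Theta_diff:
  assumes "t \<le> n"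
  shows "Theta n (Suc t) - monom 1 1 * Theta (n - 1) t = (monom ((- 1) ^ t) (n - t) :: 'a::comm_ring_1 poly)"
proof -
  have "monom 1 1 * Theta (n - 1) t = (Theta n t :: 'a poly)"
    unfolding Theta_def sum_distrib_left using assms by (intro sum.cong) (auto simp: mult_monom Suc_diff_Suc)
  then show ?thesis by (simp add: Theta_def)
qed

lemma coeff_Theta:
  assumes "t \<le> Suc n" "m \<le> n"
  shows "coeff (Theta n t) m = (if n - m < t then (- 1) ^ (n - m) else 0)"
proof -
  have "coeff (Theta n t) m = (\<Sum>i<t. if i = n - m then (- 1) ^ (n - m) else 0)"
    unfolding Theta_def coeff_sum coeff_monom using assms by (intro sum.cong) auto
  then show ?thesis by simp
qed

text \<open>The data attached to a block of the low digits \<open>R\<close>, \<open>S\<close>: its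
  generator \<open>a\<close>, the cofactors \<open>f\<close> and \<open>h\<close> of the syzygy, the
  dual form \<open>b\<close>, and polynomials \<open>\<zeta>\<close>, \<open>\<eta>\<close> whose
  coefficients solve the two binomial systems. The leading digits are \<open>rn\<close>,
  \<open>sn\<close>, \<open>t\<close>, and \<open>q\<close> stands for \<open>p^n\<close>.\<close>

locale carry =
  fixes q R S rn sn t :: nat and i j L :: nat and a f h b \<zeta> \<eta> :: "'a::field poly"
  assumes frobenius: "[:1, 1:] ^ q = (1 + monom 1 q :: 'a poly)"
    and q: "R < q" "S < q" and t: "t \<le> min rn sn" and char: "rn + sn - t < CHAR('a)"
    and block: "block TYPE('a) R S i j L" and ie: "R + S < i + q" and Lq: "L < q"
    and a: "block_gen R S i j L a" "poly a (- 1) \<noteq> 0"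
    and f: "deg_le f (int S - int j - 1)" and h: "deg_le h (int R - int j - 1)"
    and b: "deg_le b (int i + int q - int R - int S - 1)"
    and a_eq: "[:1, 1:] ^ L * a = monom 1 R * (1 + [:1, 1:] * f) + (monom ((- 1) ^ (j - 1)) (R - j) + [:1, 1:] * h)"
    and b_eq: "[:1, 1:] ^ L * b = (1 + [:1, 1:] * f) - monom 1 (q - R) * (monom ((- 1) ^ (j - 1)) (R - j) + [:1, 1:] * h)"
    and b_eq': "monom 1 R * b = a - [:1, 1:] ^ (q - L) * (monom ((- 1) ^ (j - 1)) (R - j) + [:1, 1:] * h)"
    and \<zeta>: "deg_le \<zeta> (int t)" "\<forall>m\<le>t. coeff ([:1, 1:] ^ (rn + sn - 2 * t) * \<zeta>) (rn - m) = (- 1) ^ m"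
    and \<eta>: "deg_le \<eta> (int t - 1)" "\<forall>m<t. coeff ([:1, 1:] ^ (rn + sn - 2 * t) * \<eta>) (rn - 1 - m) = (- 1) ^ m"
begin

definition "M = rn + sn - 2 * t"

abbreviation "xq \<equiv> monom 1 q :: 'a poly"

text \<open>The element \<open>z\<close> for the first index of the block. The dual matrix
  contributes \<open>(-1)^R b\<close>, so its sign cancels the one in front of the second
  sum.\<close>

definition Z :: "'a poly"
  where "Z = pcompose (Theta rn (Suc t)) xq * a + pcompose (Theta (rn - 1) t) xq * (monom 1 R * b)"

definition Y :: "'a poly"
  where "Y = pcompose \<zeta> xq * a + pcompose \<eta> xq * (monom 1 R * b)"

lemma ij: "1 \<le> i" "i \<le> j" "j \<le> R" "j \<le> S"
  and L: "1 \<le> L" "L + i + j = R + S + 1" and q1: "1 \<le> q"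
  using block block_pos[OF block] block_length[OF block] q by (auto simp: block_def)

lemma t': "t \<le> rn" "t \<le> sn" "M + 2 * t = rn + sn"
  using t by (auto simp: M_def)

lemma power_M: "pcompose ([:1, 1:] ^ M) xq = [:1, 1:] ^ (M * q)"
proof -
  have "pcompose [:1, 1:] xq = [:1, 1:] ^ q" unfolding frobenius by (simp add: pcompose_pCons one_pCons)
  then show ?thesis by (simp only: pcompose_power power_mult[symmetric] mult.commute)
qed

text \<open>Inserting the two syzygies, \<open>(X + 1)^L Z\<close> becomes
  \<open>(u + w) X^R F + (u - X^q w) H\<close>. The coefficients of \<open>a\<close> and
  \<open>b\<close> in \<open>Z\<close> are chosen so that both brackets collapse to monomials; the
  monomials then recombine to \<open>X + 1\<close> times \<open>x_(tq+j)\<close>.\<close>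

lemma Z_image:
  "[:1, 1:] ^ (L - 1) * Z = xpoly (rn * q + R) (t * q + j) + monom 1 (rn * q + R) * f
     + monom ((- 1) ^ t) (q * (rn - t)) * h"
proof -
  define F where "F = 1 + [:1, 1:] * f"
  define H where "H = monom ((- 1) ^ (j - 1)) (R - j) + [:1, 1:] * h"
  define u where "u = pcompose (Theta rn (Suc t)) xq"
  define w where "w = pcompose (Theta (rn - 1) t) xq"
  have 1: "u + w = monom 1 (q * rn)"
    unfolding u_def w_def pcompose_add[symmetric] Theta_add pcompose_monom ..
  have 2: "u - xq * w = monom ((- 1) ^ t) (q * (rn - t))"
  proof -
    have "xq = pcompose (monom 1 1) xq" by (simp add: pcompose_monom)
    then have "u - xq * w = pcompose (Theta rn (Suc t) - monom 1 1 * Theta (rn - 1) t) xq"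
      by (simp add: u_def w_def pcompose_diff pcompose_mult)
    then show ?thesis unfolding Theta_diff[OF t'(1)] pcompose_monom .
  qed
  have xR: "monom 1 R * monom 1 (q - R) = xq" using q by (simp add: mult_monom)
  have "[:1, 1:] ^ L * Z = u * ([:1, 1:] ^ L * a) + w * (monom 1 R * ([:1, 1:] ^ L * b))"
    unfolding Z_def u_def w_def by (simp only: distrib_left distrib_right ac_simps)
  also have "\<dots> = (u + w) * (monom 1 R * F) + (u - monom 1 R * monom 1 (q - R) * w) * H"
    unfolding a_eq b_eq F_def[symmetric] H_def[symmetric] by (simp add: algebra_simps)
  also have "\<dots> = monom 1 (q * rn) * (monom 1 R * F) + monom ((- 1) ^ t) (q * (rn - t)) * H"
    unfolding xR 1 2 ..
  also have "monom 1 (q * rn) * (monom 1 R * F) = monom 1 (rn * q + R) + [:1, 1:] * (monom 1 (rn * q + R) * f)"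
  proof -
    have "monom 1 (q * rn) * monom 1 R = (monom 1 (rn * q + R) :: 'a poly)"
      by (simp add: mult_monom ac_simps)
    then show ?thesis
      unfolding F_def mult.assoc[symmetric] distrib_left by (simp only: mult_1_right mult_1_left ac_simps)
  qed
  also have "monom ((- 1) ^ t) (q * (rn - t)) * H =
      monom ((- 1) ^ (t * q + j - 1)) (rn * q + R - (t * q + j)) + [:1, 1:] * (monom ((- 1) ^ t) (q * (rn - t)) * h)"
  proof -
    have "(- 1 :: 'a) ^ (t * q + j - 1) = (- 1) ^ (q * t) * (- 1) ^ (j - 1)"
      using ij by (simp flip: power_add add: mult.commute)
    also have "\<dots> = (- 1) ^ t * (- 1) ^ (j - 1)"
      unfolding power_mult frobenius_minus_one[OF frobenius q1] ..
    finally have s: "(- 1 :: 'a) ^ (t * q + j - 1) = (- 1) ^ t * (- 1) ^ (j - 1)" .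
    have "q * (rn - t) + (R - j) = rn * q + R - (t * q + j)"
      using ij t'(1) mult_le_mono1[OF t'(1), of q] by (simp add: diff_mult_distrib2 mult.commute)
    then have "monom ((- 1) ^ t) (q * (rn - t)) * monom ((- 1) ^ (j - 1)) (R - j) =
        (monom ((- 1) ^ (t * q + j - 1)) (rn * q + R - (t * q + j)) :: 'a poly)"
      unfolding s mult_monom by simp
    then show ?thesis unfolding H_def distrib_left by (simp only: ac_simps)
  qed
  also have "monom 1 (rn * q + R) + [:1, 1:] * (monom 1 (rn * q + R) * f) +
      (monom ((- 1) ^ (t * q + j - 1)) (rn * q + R - (t * q + j)) + [:1, 1:] * (monom ((- 1) ^ t) (q * (rn - t)) * h))
    = [:1, 1:] * (xpoly (rn * q + R) (t * q + j) + monom 1 (rn * q + R) * f + monom ((- 1) ^ t) (q * (rn - t)) * h)"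
  proof -
    have "t * q + j \<le> rn * q + R" using mult_le_mono1[OF t'(1), of q] ij by linarith
    then have "[:1, 1:] * xpoly (rn * q + R) (t * q + j) = monom 1 (rn * q + R) +
        (monom ((- 1) ^ (t * q + j - 1)) (rn * q + R - (t * q + j)) :: 'a poly)"
      using ij by (intro linear_mult_xpoly) auto
    then show ?thesis unfolding distrib_left by (simp only: ac_simps)
  qed
  finally show ?thesis
    unfolding linear_power_mult_pred[OF L(1)] linear_mult_cancel .
qed

text \<open>Of the two error terms one is a multiple of \<open>X^r\<close>; the other has so small a
  degree in \<open>X\<close> that it misses the window.\<close>

lemma coeff_Z_image:
  assumes "k \<in> {1..t * q + j}"
  shows "coeff ([:1, 1:] ^ (L - 1) * Z) (rn * q + R - k) = (- 1) ^ (k - 1)"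
proof -
  have le: "t * q + j \<le> rn * q + R" using mult_le_mono1[OF t'(1), of q] ij by linarith
  have "coeff (monom ((- 1) ^ t) (q * (rn - t)) * h) (rn * q + R - k) = 0"
  proof (rule deg_leD)
    show "deg_le (monom ((- 1) ^ t) (q * (rn - t)) * h) (int (q * (rn - t)) + (int R - int j - 1))"
      by (intro deg_le_mult deg_le_monom h) simp
    have "q * (rn - t) + t * q = rn * q"
      using t'(1) by (simp add: mult.commute flip: distrib_left)
    then have "int (q * (rn - t)) + int (t * q) = int (rn * q)" by (metis of_nat_add)
    moreover have "int k \<le> int (t * q) + int j"
      using assms by (metis atLeastAtMost_iff of_nat_add of_nat_le_iff)
    moreover have "k \<le> rn * q + R" using assms le by simp
    then have "int (rn * q + R - k) = int (rn * q) + int R - int k"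
      by (simp only: of_nat_diff of_nat_add)
    ultimately show "int (q * (rn - t)) + (int R - int j - 1) < int (rn * q + R - k)" by linarith
  qed
  moreover have k: "rn * q + R - k < rn * q + R" "rn * q + R - (t * q + j) \<le> rn * q + R - k"
    "rn * q + R - (rn * q + R - k) - 1 = k - 1"
    using assms le by auto
  moreover have "coeff (monom 1 (rn * q + R) * f) (rn * q + R - k) = 0"
    unfolding coeff_monom_mult using k(1) by simp
  ultimately show ?thesis
    unfolding Z_image coeff_add coeff_xpoly[OF le] by simp
qed

text \<open>The left side has degree at most \<open>rn + sn - t\<close>, and the bound on
  \<open>B\<close> is this number minus \<open>sn + 1\<close>: a congruence modulo
  \<open>X^(rn+1)\<close> and \<open>Y^(sn+1)\<close>. For \<open>\<eta>\<close> it is modulo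
  \<open>X^rn\<close> and \<open>Y^sn\<close>, one degree lower.\<close>

lemma \<zeta>_eq:
  obtains A B where "[:1, 1:] ^ M * \<zeta> = Theta rn (Suc t) + monom 1 (Suc rn) * A + B"
    "deg_le B (int rn - int t - 1)"
proof -
  have "coeff ([:1, 1:] ^ M * \<zeta> - Theta rn (Suc t)) m = 0"
    if "m < Suc rn" "int rn - int t - 1 < int m" for m
  proof -
    have "rn - m \<le> t" "rn - (rn - m) = m" using that by auto
    then have "coeff ([:1, 1:] ^ M * \<zeta>) m = (- 1) ^ (rn - m)"
      using \<zeta>(2) unfolding M_def by metis
    then show ?thesis using that t'(1) by (simp add: coeff_Theta \<open>rn - m \<le> t\<close> less_Suc_eq_le)
  qed
  then obtain A B where "[:1, 1:] ^ M * \<zeta> - Theta rn (Suc t) = monom 1 (Suc rn) * A + B"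
    "deg_le B (int rn - int t - 1)"
    using window_split[of "Suc rn" "int rn - int t - 1" "[:1, 1:] ^ M * \<zeta> - Theta rn (Suc t)"] by metis
  then show ?thesis by (intro that[of A B]) (simp_all add: algebra_simps)
qed

lemma \<eta>_eq:
  obtains A B where "[:1, 1:] ^ M * \<eta> = Theta (rn - 1) t + monom 1 rn * A + B"
    "deg_le B (int rn - int t - 1)"
proof -
  have "coeff ([:1, 1:] ^ M * \<eta> - Theta (rn - 1) t) m = 0"
    if "m < rn" "int rn - int t - 1 < int m" for m
  proof -
    have *: "rn - 1 - m < t" "rn - 1 - (rn - 1 - m) = m" "t \<le> Suc (rn - 1)" "m \<le> rn - 1"
      using that t'(1) by auto
    then have "coeff ([:1, 1:] ^ M * \<eta>) m = (- 1) ^ (rn - 1 - m)"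
      using \<eta>(2) unfolding M_def by metis
    then show ?thesis unfolding coeff_diff coeff_Theta[OF *(3,4)] using *(1) by simp
  qed
  then obtain A B where "[:1, 1:] ^ M * \<eta> - Theta (rn - 1) t = monom 1 rn * A + B"
    "deg_le B (int rn - int t - 1)"
    using window_split[of rn "int rn - int t - 1" "[:1, 1:] ^ M * \<eta> - Theta (rn - 1) t"] by metis
  then show ?thesis by (intro that[of A B]) (simp_all add: algebra_simps)
qed

text \<open>After substituting \<open>X^q\<close>, the errors of \<open>\<zeta>\<close> involve
  \<open>X^((rn+1)q)\<close> and \<open>Y^((sn+1)q)\<close>, multiples of \<open>X^r\<close> and
  \<open>Y^s\<close> because \<open>R, S < q\<close>. The errors of \<open>\<eta>\<close> only
  involve \<open>X^(rn q)\<close> and \<open>Y^(sn q)\<close>; the missing \<open>X^R\<close> and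
  \<open>Y^S\<close> come from the form \<open>X^R Y^S b\<close>.\<close>

lemma Y_image:
  "vanishes (rn * q + R) (sn * q + S) (int (t * q + i) - 1 + int (M * q)) ([:1, 1:] ^ (M * q) * Y - Z)"
proof -
  obtain A B where AB: "[:1, 1:] ^ M * \<zeta> = Theta rn (Suc t) + monom 1 (Suc rn) * A + B"
    "deg_le B (int rn - int t - 1)" by (rule \<zeta>_eq)
  obtain A' B' where AB': "[:1, 1:] ^ M * \<eta> = Theta (rn - 1) t + monom 1 rn * A' + B'"
    "deg_le B' (int rn - int t - 1)" by (rule \<eta>_eq)
  let ?E = "\<lambda>f. pcompose f xq"
  have 1: "[:1, 1:] ^ (M * q) * ?E \<zeta> = ?E (Theta rn (Suc t)) + monom 1 (rn * q + R) * (monom 1 (q - R) * ?E A) + ?E B"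
  proof -
    have "?E (monom 1 (Suc rn)) = monom 1 (rn * q + R) * monom 1 (q - R)"
      using q by (simp add: pcompose_monom mult_monom ac_simps)
    then show ?thesis
      using arg_cong[OF AB(1), of ?E] unfolding pcompose_mult pcompose_add power_M by (simp add: mult.assoc)
  qed
  have 2: "[:1, 1:] ^ (M * q) * ?E \<eta> = ?E (Theta (rn - 1) t) + monom 1 (rn * q) * ?E A' + ?E B'"
  proof -
    have "?E (monom 1 rn) = monom 1 (rn * q)"
      using q by (simp add: pcompose_monom ac_simps)
    then show ?thesis
      using arg_cong[OF AB'(1), of ?E] unfolding pcompose_mult pcompose_add power_M by simp
  qed
  have 3: "monom 1 (rn * q) * monom 1 R = (monom 1 (rn * q + R) :: 'a poly)"
    by (simp add: mult_monom)
  have "[:1, 1:] ^ (M * q) * Y - Z =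
      ([:1, 1:] ^ (M * q) * ?E \<zeta> - ?E (Theta rn (Suc t))) * a +
      ([:1, 1:] ^ (M * q) * ?E \<eta> - ?E (Theta (rn - 1) t)) * (monom 1 R * b)"
    unfolding Y_def Z_def by (simp only: algebra_simps)
  also have "\<dots> = (monom 1 (rn * q + R) * (monom 1 (q - R) * ?E A) + ?E B) * a +
      (monom 1 (rn * q) * ?E A' + ?E B') * (monom 1 R * b)"
    unfolding 1 2 by (simp only: add_diff_cancel_left' add.assoc)
  also have "\<dots> = monom 1 (rn * q + R) * (monom 1 (q - R) * ?E A * a + ?E A' * b) +
      (?E B * a + ?E B' * (monom 1 R * b))"
    unfolding 3[symmetric] by (simp only: algebra_simps)
  finally have "[:1, 1:] ^ (M * q) * Y - Z = monom 1 (rn * q + R) * (monom 1 (q - R) * ?E A * a + ?E A' * b) +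
      (?E B * a + ?E B' * (monom 1 R * b))" .
  moreover have "deg_le (?E B * a + ?E B' * (monom 1 R * b)) (int (t * q + i) - 1 + int (M * q) - int (sn * q + S))"
  proof -
    let ?d = "int q * (int rn - int t - 1) + int i + int q - int S - 1"
    have M: "int M = int rn + int sn - 2 * int t" using t'(3) by linarith
    have d: "int (t * q + i) - 1 + int (M * q) - int (sn * q + S) = ?d"
      unfolding of_nat_mult of_nat_add M by (simp add: algebra_simps)
    have "deg_le (?E B * a) (int q * (int rn - int t - 1) + (int i - 1))"
      using a(1) AB(2) by (intro deg_le_mult deg_le_pcompose) (auto simp: block_gen_def)
    then have "deg_le (?E B * a) ?d" by (rule deg_le_mono) (use q in simp)
    moreover have "deg_le (?E B' * (monom 1 R * b)) (int q * (int rn - int t - 1) + (int R + (int i + int q - int R - int S - 1)))"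
      by (intro deg_le_mult deg_le_pcompose deg_le_monom AB'(2) b) simp
    then have "deg_le (?E B' * (monom 1 R * b)) ?d" by (rule deg_le_mono) simp
    ultimately show ?thesis unfolding d by (rule deg_le_add)
  qed
  ultimately show ?thesis unfolding vanishes_iff by blast
qed

text \<open>If \<open>X + 1\<close> divides \<open>\<zeta> + \<eta>\<close>, then
  \<open>Theta_add\<close> gives a syzygy of \<open>X^rn\<close>, \<open>Y^(sn+1)\<close>,
  \<open>(X + 1)^(M+1)\<close>, whence \<open>\<zeta> = - \<eta>\<close>. Now
  \<open>(X + 1) (- \<eta>) = \<zeta> - X \<eta>\<close>, and \<open>Theta_diff\<close> gives one of
  \<open>X^(rn+1)\<close>, \<open>Y^sn\<close>, \<open>(X + 1)^(M+1)\<close>. So both are 0, against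
  a coefficient 1 of \<open>(X + 1)^M \<zeta>\<close>.\<close>

lemma \<zeta>\<eta>_minus_one: "poly (\<zeta> + \<eta>) (- 1) \<noteq> 0"
proof
  assume "poly (\<zeta> + \<eta>) (- 1) = 0"
  then have "[:1, 1:] dvd \<zeta> + \<eta>" by (simp only: linear_dvd_iff)
  then obtain u where u: "\<zeta> + \<eta> = [:1, 1:] * u" by (rule dvdE)
  obtain A B where AB: "[:1, 1:] ^ M * \<zeta> = Theta rn (Suc t) + monom 1 (Suc rn) * A + B"
    "deg_le B (int rn - int t - 1)" by (rule \<zeta>_eq)
  obtain A' B' where AB': "[:1, 1:] ^ M * \<eta> = Theta (rn - 1) t + monom 1 rn * A' + B'"
    "deg_le B' (int rn - int t - 1)" by (rule \<eta>_eq)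
  have x: "monom 1 (Suc rn) = monom 1 1 * (monom 1 rn :: 'a poly)" by (simp add: mult_monom)
  have "u = 0"
  proof (rule no_syzygy[where a = rn and b = "sn + 1" and c = "M + 1" and d = "rn + sn - t"])
    have "[:1, 1:] ^ (M + 1) * u = [:1, 1:] ^ M * \<zeta> + [:1, 1:] ^ M * \<eta>"
      unfolding distrib_left[symmetric] u linear_power_mult_comm by simp
    also have "\<dots> = (Theta rn (Suc t) + Theta (rn - 1) t) + monom 1 (Suc rn) * A + monom 1 rn * A' + (B + B')"
      unfolding AB AB' by (simp only: ac_simps)
    also have "\<dots> = monom 1 rn * (1 + monom 1 1 * A + A') + (B + B')"
      unfolding Theta_add x by (simp only: algebra_simps mult_1_right mult_1_left)
    finally show "[:1, 1:] ^ (M + 1) * u = monom 1 rn * (1 + monom 1 1 * A + A') + (B + B')" .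
    show "deg_le (B + B') (int (rn + sn - t) - int (sn + 1))"
      using AB(2) AB'(2) t' by (auto intro!: deg_le_add elim!: deg_le_mono)
    have "deg_le ([:1, 1:] ^ 1 * u) (int t)"
      using \<zeta>(1) \<eta>(1) unfolding power_one_right u[symmetric]
      by (auto intro!: deg_le_add elim!: deg_le_mono)
    then show "deg_le u (int (rn + sn - t) - int (M + 1))"
      unfolding deg_le_linear_power_mult_iff by (rule deg_le_mono) (use t' in linarith)
  qed (use t' char in auto)
  then have z: "\<zeta> = - \<eta>" using u by (simp add: eq_neg_iff_add_eq_0)
  have "- \<eta> = 0"
  proof (rule no_syzygy[where a = "Suc rn" and b = sn and c = "M + 1" and d = "rn + sn - t"])
    have "[:1, 1:] ^ (M + 1) * (- \<eta>) = [:1, 1:] ^ M * \<zeta> - monom 1 1 * ([:1, 1:] ^ M * \<eta>)"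
    proof -
      have "[:1, 1:] = 1 + (monom 1 1 :: 'a poly)" by (simp add: monom_Suc monom_0 one_pCons)
      then have "[:1, 1:] * (- \<eta>) = \<zeta> - monom 1 1 * \<eta>" unfolding z by (simp only:) (simp add: algebra_simps)
      then have "[:1, 1:] ^ M * ([:1, 1:] * (- \<eta>)) = [:1, 1:] ^ M * (\<zeta> - monom 1 1 * \<eta>)" by (rule arg_cong)
      then show ?thesis unfolding linear_power_mult_comm
        by (simp only: right_diff_distrib mult.left_commute Suc_eq_plus1)
    qed
    also have "\<dots> = (Theta rn (Suc t) - monom 1 1 * Theta (rn - 1) t) + monom 1 (Suc rn) * (A - A') + (B - monom 1 1 * B')"
      unfolding AB AB' x by (simp only: algebra_simps)
    finally show "[:1, 1:] ^ (M + 1) * (- \<eta>) =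
        monom 1 (Suc rn) * (A - A') + (monom ((- 1) ^ t) (rn - t) + (B - monom 1 1 * B'))"
      unfolding Theta_diff[OF t'(1)] by (simp only: ac_simps)
    have "deg_le (monom 1 1 * B') (int rn - int t)"
      unfolding deg_le_monom_mult_iff using AB'(2) by (rule deg_le_mono) simp
    moreover have "deg_le B (int rn - int t)" using AB(2) by (rule deg_le_mono) simp
    moreover have "int (rn + sn - t) - int sn = int rn - int t" using t' by linarith
    ultimately show "deg_le (monom ((- 1) ^ t) (rn - t) + (B - monom 1 1 * B')) (int (rn + sn - t) - int sn)"
      using t' by (auto intro!: deg_le_add deg_le_diff deg_le_monom)
    show "deg_le (- \<eta>) (int (rn + sn - t) - int (M + 1))"
      by (rule deg_le_uminus[OF deg_le_mono[OF \<eta>(1)]]) (use t' in linarith)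
  qed (use t' char in auto)
  then have "\<zeta> = 0" using z by simp
  then show False using \<zeta>(2) by auto
qed

text \<open>As \<open>(-1)^q = -1\<close>, the substitution is invisible at -1, where moreover
  \<open>X^R b\<close> agrees with \<open>a\<close>; the value factors.\<close>

lemma Y_minus_one: "poly Y (- 1) \<noteq> 0"
proof -
  have E: "poly (pcompose g xq) (- 1) = poly g (- 1)" for g
    by (simp add: poly_pcompose poly_monom frobenius_minus_one[OF frobenius q1])
  have "poly (monom 1 R * b) (- 1) = poly a (- 1)"
    unfolding b_eq' using Lq by simp
  then have "poly Y (- 1) = poly (\<zeta> + \<eta>) (- 1) * poly a (- 1)"
    unfolding Y_def poly_add poly_mult E by (simp add: algebra_simps)
  then show ?thesis using \<zeta>\<eta>_minus_one a(2) by simp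
qed

lemma deg_le_Y: "deg_le Y (int (t * q + i) - 1)"
  unfolding Y_def
proof (rule deg_le_add)
  have "deg_le (pcompose \<zeta> xq * a) (int q * int t + (int i - 1))"
    using a(1) by (intro deg_le_mult deg_le_pcompose \<zeta>(1)) (simp add: block_gen_def)
  then show "deg_le (pcompose \<zeta> xq * a) (int (t * q + i) - 1)"
    by (rule deg_le_mono) (simp add: mult.commute)
  have "deg_le (pcompose \<eta> xq * (monom 1 R * b))
      (int q * (int t - 1) + (int R + (int i + int q - int R - int S - 1)))"
    by (intro deg_le_mult deg_le_pcompose \<eta>(1) deg_le_monom b) simp
  then show "deg_le (pcompose \<eta> xq * (monom 1 R * b)) (int (t * q + i) - 1)"
    by (rule deg_le_mono) (simp add: algebra_simps)
qed

lemma carry_length: "M * q + L + (t * q + i) + (t * q + j) = rn * q + R + (sn * q + S) + 1"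
proof -
  have "M * q + 2 * t * q = rn * q + sn * q" using t'(3) by (simp flip: distrib_right)
  then show ?thesis using L(2) by simp
qed

lemma block_gen_Y:
  "block_gen (rn * q + R) (sn * q + S) (t * q + i) (t * q + j) (M * q + L) Y"
  unfolding block_gen_def
proof (intro conjI ballI deg_le_Y)
  fix k assume k: "k \<in> {1..t * q + j}"
  let ?d = "int (t * q + i) - 1 + int (M * q) + int (L - 1)"
  have "vanishes (rn * q + R) (sn * q + S) ?d ([:1, 1:] ^ (L - 1) * ([:1, 1:] ^ (M * q) * Y - Z))"
    by (rule vanishes_mult[OF Y_image])
  moreover have "rn * q + R - k < rn * q + R" using k ij mult_le_mono1[OF t'(1), of q] by simp
  moreover have "?d - int (sn * q + S) < int (rn * q + R - k)"
  proof -
    have "int (M * q) + int L + (int (t * q) + int i) + (int (t * q) + int j) = int (rn * q + R) + int (sn * q + S) + 1"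
      using carry_length by (metis of_nat_1 of_nat_add)
    moreover have "int k \<le> int (t * q) + int j" using k by (metis atLeastAtMost_iff of_nat_add of_nat_le_iff)
    ultimately show ?thesis using L(1) by linarith
  qed
  ultimately have "coeff ([:1, 1:] ^ (L - 1) * ([:1, 1:] ^ (M * q) * Y - Z)) (rn * q + R - k) = 0"
    by (auto simp: vanishes_def)
  moreover have "[:1, 1:] ^ (M * q + L - 1) * Y =
      [:1, 1:] ^ (L - 1) * ([:1, 1:] ^ (M * q) * Y - Z) + [:1, 1:] ^ (L - 1) * Z"
  proof -
    have "M * q + L - 1 = (L - 1) + M * q" using L(1) by simp
    then show ?thesis by (simp only: power_add right_diff_distrib diff_add_cancel mult.assoc)
  qed
  ultimately show "coeff ([:1, 1:] ^ (M * q + L - 1) * Y) (rn * q + R - k) = (- 1) ^ (k - 1)"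
    using coeff_Z_image[OF k] by simp
qed

lemma plam_carry:
  assumes "i \<le> l" "l \<le> j"
  shows "plam TYPE('a) (rn * q + R) (sn * q + S) (t * q + l) = M * q + L"
proof (rule plam_eqI[OF _ _ _ _ carry_length block_gen_Y Y_minus_one])
  show "t * q + j \<le> min (rn * q + R) (sn * q + S)"
    using ij mult_le_mono1[OF t'(1), of q] mult_le_mono1[OF t'(2), of q]
    unfolding min.bounded_iff by linarith
qed (use ij L assms in auto)

end

text \<open>A kernel vector is a syzygy of \<open>X^(rn+1)\<close>, \<open>Y^(sn+1)\<close> and a
  power of \<open>X + Y\<close> in degree \<open>rn + sn - t\<close>, exactly at the limit of
  \<open>no_syzygy\<close>.\<close>

lemma binomial_window_injective:
  fixes w :: "'a::field poly"
  assumes "t \<le> min rn sn" "rn + sn - t < CHAR('a)"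
    and "deg_le w (int t)" "\<forall>m\<le>t. coeff ([:1, 1:] ^ (rn + sn - 2 * t) * w) (rn - m) = 0"
  shows "w = 0"
proof -
  have "coeff ([:1, 1:] ^ (rn + sn - 2 * t) * w) m = 0" if "m < Suc rn" "int rn - int t - 1 < int m" for m
    using assms(1) assms(4)[rule_format, of "rn - m"] that by (cases "rn - m \<le> t") auto
  then obtain A B where AB: "[:1, 1:] ^ (rn + sn - 2 * t) * w = monom 1 (Suc rn) * A + B"
    "deg_le B (int rn - int t - 1)"
    using window_split[of "Suc rn" "int rn - int t - 1" "[:1, 1:] ^ (rn + sn - 2 * t) * w"] by metis
  show ?thesis
    by (rule no_syzygy[OF AB(1), where b = "Suc sn" and d = "rn + sn - t"])
       (use assms AB(2) in \<open>auto elim!: deg_le_mono\<close>)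
qed

section \<open>Coordinates\<close>

lemma sum_fun_apply: "(\<Sum>i\<in>A. f i) x = (\<Sum>i\<in>A. f i x)" for f :: "'i \<Rightarrow> 'x \<Rightarrow> 'b::comm_monoid_add"
  by (induction A rule: infinite_finite_induct) auto

lemma fscale_apply [simp]: "(c *\<^sub>F u) x = c * u x"
  by (simp add: fscale_def)

definition delta :: "'x \<Rightarrow> 'x \<Rightarrow> 'f::field"
  where "delta x = (\<lambda>y. if y = x then 1 else 0)"

definition supported :: "'x set \<Rightarrow> ('x \<Rightarrow> 'f::field) set"
  where "supported B = {u. \<forall>x. x \<notin> B \<longrightarrow> u x = 0}"

lemma supported_subspace: "fs.subspace (supported B)"
  by (auto simp: fs.subspace_def supported_def)

lemma supported_expand:
  assumes "finite B" "u \<in> supported B"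
  shows "u = (\<Sum>x\<in>B. u x *\<^sub>F delta x)"
proof
  fix y
  have "(\<Sum>x\<in>B. u x *\<^sub>F delta x) y = (\<Sum>x\<in>B. if x = y then u y else 0)"
    unfolding sum_fun_apply by (intro sum.cong) (auto simp: delta_def)
  then show "u y = (\<Sum>x\<in>B. u x *\<^sub>F delta x) y"
    using assms by (auto simp: supported_def)
qed

lemma span_delta:
  assumes "finite B"
  shows "fs.span (delta ` B) = supported B"
proof
  show "fs.span (delta ` B) \<subseteq> supported B"
    by (intro fs.span_minimal supported_subspace) (auto simp: delta_def supported_def)
  show "supported B \<subseteq> fs.span (delta ` B)"
  proof
    fix u assume "u \<in> supported B"
    have "(\<Sum>x\<in>B. u x *\<^sub>F delta x) \<in> fs.span (delta ` B)"
      by (intro fs.span_sum fs.span_scale fs.span_base) auto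
    then show "u \<in> fs.span (delta ` B)"
      using supported_expand[OF assms \<open>u \<in> supported B\<close>] by simp
  qed
qed

lemma vbasis_eq_delta: "1 \<le> i \<Longrightarrow> vbasis i = delta i"
  by (auto simp: vbasis_def delta_def)

lemma span_vbasis: "fs.span (vbasis ` {1..d}) = supported {1..d}"
proof -
  have "vbasis ` {1..d} = (delta ` {1..d} :: (nat \<Rightarrow> 'a::field) set)"
    by (rule image_cong) (auto simp: vbasis_eq_delta)
  then show ?thesis by (simp only: span_delta finite_atLeastAtMost)
qed

lemma mod_space_Vmod: "mod_space (Vmod G g d) = supported {1..d}"
  by (simp only: Vmod_def span_vbasis gmodule.simps)

lemma mod_space_tensor:
  "mod_space (tensor_module (Vmod G g r) (Vmod G g s)) = supported ({1..r} \<times> {1..s})"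
proof -
  let ?S = "{u \<otimes>\<^sub>F w | u w. u \<in> supported {1..r} \<and> w \<in> supported {1..s}} :: (nat \<times> nat \<Rightarrow> 'a::field) set"
  have "fs.span ?S = supported ({1..r} \<times> {1..s})"
  proof
    show "fs.span ?S \<subseteq> supported ({1..r} \<times> {1..s})"
      by (intro fs.span_minimal supported_subspace) (auto simp: supported_def pure_tensor_def)
    have "delta x \<in> ?S" if "x \<in> {1..r} \<times> {1..s}" for x
    proof -
      have "delta x = delta (fst x) \<otimes>\<^sub>F (delta (snd x) :: nat \<Rightarrow> 'a)"
        by (cases x) (auto simp: delta_def pure_tensor_def fun_eq_iff)
      moreover have "delta (fst x) \<in> supported {1..r}" "delta (snd x) \<in> supported {1..s}"
        using that by (auto simp: delta_def supported_def)
      ultimately show ?thesis by blast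
    qed
    then have "delta ` ({1..r} \<times> {1..s}) \<subseteq> ?S" by blast
    then show "supported ({1..r} \<times> {1..s}) \<subseteq> fs.span ?S"
      using fs.span_mono[of "delta ` ({1..r} \<times> {1..s})" ?S]
      by (simp only: span_delta finite_SigmaI finite_atLeastAtMost)
  qed
  then show ?thesis by (simp only: tensor_module_def mod_space_Vmod gmodule.simps)
qed

section \<open>The action of the generator\<close>

lemma gen_act_add: "gen_act (u + w) = gen_act u + gen_act w"
  by (auto simp: gen_act_def fun_eq_iff)

lemma gen_act_scale: "gen_act (c *\<^sub>F u) = c *\<^sub>F gen_act u"
  by (auto simp: gen_act_def fun_eq_iff algebra_simps)

lemma gen_act_pow_add: "(gen_act ^^ k) (u + w) = (gen_act ^^ k) u + (gen_act ^^ k) w"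
  by (induction k) (simp_all only: funpow.simps o_apply id_apply gen_act_add)

lemma gen_act_pow_scale: "(gen_act ^^ k) (c *\<^sub>F u) = c *\<^sub>F (gen_act ^^ k) u"
  by (induction k) (simp_all only: funpow.simps o_apply id_apply gen_act_scale)

lemma gen_act_pow_0 [simp]: "(gen_act ^^ k) (\<lambda>_. 0) = (\<lambda>_. 0)"
  by (induction k) (simp_all, simp add: gen_act_def fun_eq_iff)

lemma gen_act_supported: "u \<in> supported {1..d} \<Longrightarrow> gen_act u \<in> supported {1..d}"
  by (auto simp: gen_act_def supported_def)

lemma gen_act_pow_supported: "u \<in> supported {1..d} \<Longrightarrow> (gen_act ^^ k) u \<in> supported {1..d}"
  by (induction k) (simp_all only: funpow.simps o_apply id_apply gen_act_supported)

text \<open>\<open>gen_act\<close> is 1 plus the shift, so its powers are powers of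
  \<open>X + 1\<close> evaluated at the shift. The Frobenius identity then shows that the
  \<open>Q\<close>-th power is trivial on the first \<open>Q\<close> coordinates.\<close>

lemma gen_act_pow_poly:
  assumes "u \<in> supported {1..d}" "1 \<le> i"
  shows "(gen_act ^^ k) u i = (\<Sum>m\<le>d. coeff ([:1, 1:] ^ k) m * u (i + m))"
  using assms(2)
proof (induction k arbitrary: i)
  case 0
  have "(\<Sum>m\<le>d. coeff (1 :: 'a poly) m * u (i + m)) = (\<Sum>m\<le>d. if m = 0 then u i else 0)"
    by (intro sum.cong) auto
  then show ?case by simp
next
  case (Suc k)
  let ?c = "coeff ([:1, 1:] ^ k :: 'a poly)"
  have c: "coeff ([:1, 1:] ^ Suc k :: 'a poly) m = ?c m + (if m = 0 then 0 else ?c (m - 1))" for m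
    by (cases m) (auto simp: coeff_pCons)
  have z: "u (Suc i + d) = 0" using assms(1) by (auto simp: supported_def)
  have "(\<Sum>m\<le>d. (if m = 0 then 0 else ?c (m - 1)) * u (i + m)) = (\<Sum>m<d. ?c m * u (Suc i + m))"
    by (subst sum.atMost_shift) simp
  also have "\<dots> = (\<Sum>m\<le>d. ?c m * u (Suc i + m))"
    unfolding lessThan_Suc_atMost[symmetric] using z by simp
  finally have 2: "(\<Sum>m\<le>d. (if m = 0 then 0 else ?c (m - 1)) * u (i + m)) = (\<Sum>m\<le>d. ?c m * u (Suc i + m))" .
  have "(gen_act ^^ Suc k) u i = (gen_act ^^ k) u i + (gen_act ^^ k) u (Suc i)"
    using Suc.prems by (simp add: gen_act_def)
  then show ?case
    unfolding c distrib_right sum.distrib 2 using Suc.IH[of i] Suc.IH[of "Suc i"] Suc.prems by simp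
qed

lemma frobenius_linear:
  assumes "prime CHAR('f::field)"
  shows "[:1, 1:] ^ (CHAR('f) ^ a) = (1 + monom 1 (CHAR('f) ^ a) :: 'f poly)"
proof -
  have c: "CHAR('f poly) = CHAR('f)" by simp
  have "[:1, 1:] = 1 + (monom 1 1 :: 'f poly)" by (simp add: monom_Suc monom_0 one_pCons)
  then have "[:1, 1:] ^ (CHAR('f) ^ a) = (1 + monom 1 1 :: 'f poly) ^ (CHAR('f poly) ^ a)" by simp
  also have "\<dots> = 1 + monom 1 1 ^ (CHAR('f poly) ^ a)"
    using assms freshmans_dream'[where x = "1 :: 'f poly" and y = "monom 1 1" and n = a] by simp
  also have "monom 1 1 ^ (CHAR('f poly) ^ a) = (monom 1 (CHAR('f) ^ a) :: 'f poly)"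
    by (simp add: monom_power)
  finally show ?thesis .
qed

locale cyclic_p_group = group G for G :: "('g, 'b) monoid_scheme" (structure) +
  fixes g :: 'g and Q a :: nat and F :: "'f::field itself"
  assumes prime_char: "prime CHAR('f)" and a_pos: "0 < a" and Q: "Q = CHAR('f) ^ a"
    and g: "g \<in> carrier G" and generate: "carrier G = generate G {g}"
    and card_G: "Coset.order G = Q"
begin

lemma Q_gt_1: "1 < Q"
  using prime_gt_1_nat[OF prime_char] a_pos unfolding Q by (rule one_less_power)

lemma ord_g: "ord g = Q"
  using generate_pow_card[OF g] generate card_G by (simp add: Coset.order_def)

lemma gen_act_pow_Q:
  assumes "u \<in> supported {1..Q}"
  shows "(gen_act ^^ Q) u = (u :: nat \<Rightarrow> 'f)"
proof
  fix i
  show "(gen_act ^^ Q) u i = u i"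
  proof (cases "i = 0")
    case True
    then show ?thesis using gen_act_pow_supported[OF assms, of Q] assms by (auto simp: supported_def)
  next
    case False
    have "(gen_act ^^ Q) u i = (\<Sum>m\<le>Q. coeff (1 + monom 1 Q) m * u (i + m))"
      using gen_act_pow_poly[OF assms, of i Q] False frobenius_linear[OF prime_char, of a] unfolding Q by simp
    also have "\<dots> = (\<Sum>m\<le>Q. if m = 0 then u i else 0)"
      using assms False Q_gt_1 by (intro sum.cong) (auto simp: supported_def coeff_monom)
    finally show ?thesis by simp
  qed
qed

lemma gen_act_pow_mod:
  assumes "u \<in> supported {1..d}" "d \<le> Q"
  shows "(gen_act ^^ k) u = (gen_act ^^ (k mod Q)) (u :: nat \<Rightarrow> 'f)"
proof -
  have u: "u \<in> supported {1..Q}" using assms by (auto simp: supported_def)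
  have "((gen_act ^^ Q) ^^ n) u = u" for n
    by (induction n) (simp_all add: gen_act_pow_Q[OF u])
  then have "(gen_act ^^ (Q * (k div Q))) u = u" by (simp only: funpow_mult)
  then have "(gen_act ^^ (k mod Q + Q * (k div Q))) u = (gen_act ^^ (k mod Q)) u"
    by (simp only: funpow_add o_apply)
  then show ?thesis by (simp only: mod_mult_div_eq)
qed

lemma gen_act_pow_cong:
  assumes "u \<in> supported {1..d}" "d \<le> Q" "k mod Q = k' mod Q"
  shows "(gen_act ^^ k) u = (gen_act ^^ k') (u :: nat \<Rightarrow> 'f)"
  using gen_act_pow_mod[OF assms(1,2)] assms(3) by metis

lemma int_pow_g_eq_iff: "g [^] e = g [^] e' \<longleftrightarrow> e mod int Q = e' mod int Q" for e e' :: int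
  using int_pow_eq[OF g, of e' e] by (auto simp: ord_g mod_eq_dvd_iff)

lemma pow_g_eq_iff: "g [^] k = g [^] k' \<longleftrightarrow> k mod Q = k' mod Q" for k k' :: nat
  using int_pow_g_eq_iff[of "int k" "int k'"] by (simp add: int_pow_int flip: of_nat_mod)

definition log_g :: "int \<Rightarrow> nat"
  where "log_g e = (LEAST k::nat. g [^] k = g [^] e)"

lemma pow_log_g: "g [^] log_g e = g [^] e"
proof -
  have "g [^] (nat (e mod int Q)) = g [^] e"
    using int_pow_g_eq_iff[of "int (nat (e mod int Q))" e] Q_gt_1 by (simp add: int_pow_int)
  then show ?thesis unfolding log_g_def by (rule LeastI)
qed

text \<open>Only a congruence, because the least exponent wraps around at \<open>Q\<close>.\<close>

lemma log_g_Suc: "Suc (log_g e) mod Q = log_g (e + 1) mod Q"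
proof -
  have "g [^] Suc (log_g e) = g [^] e \<otimes> g"
    by (simp add: pow_log_g)
  also have "\<dots> = g [^] (e + 1)"
    using g by (simp add: int_pow_mult)
  finally show ?thesis using pow_log_g pow_g_eq_iff by metis
qed

lemma LEAST_g: "(LEAST k::nat. g [^] k = g) = 1"
proof (rule Least_equality)
  show "g [^] (1::nat) = g" using g by simp
  fix k :: nat assume "g [^] k = g"
  moreover have "g = g [^] (1::nat)" using g by simp
  ultimately have "k mod Q = 1 mod Q" using pow_g_eq_iff by metis
  then show "1 \<le> k" using Q_gt_1 by (cases k) auto
qed

lemma vact_g: "vact G g g = gen_act"
  by (simp add: vact_def LEAST_g)

end

section \<open>Untwisting the basis\<close>

definition shift :: "(nat \<Rightarrow> 'f::field) \<Rightarrow> (nat \<Rightarrow> 'f)"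
  where "shift u = (\<lambda>j. if j = 0 then 0 else u (Suc j))"

text \<open>The operator \<open>g - 1\<close> in coordinates with respect to the
  \<open>v_ij\<close>: the coefficient at \<open>(i, j)\<close> collects those of the two vectors
  mapped onto \<open>v_ij\<close>.\<close>

definition shift2 :: "(nat \<times> nat \<Rightarrow> 'f::field) \<Rightarrow> (nat \<times> nat \<Rightarrow> 'f)"
  where "shift2 u = (\<lambda>(i, j). if i = 0 \<or> j = 0 then 0 else u (Suc i, j) + u (i, Suc j))"

definition rect :: "nat \<Rightarrow> nat \<Rightarrow> (nat \<times> nat \<Rightarrow> 'f::field) set"
  where "rect r s = supported ({1..r} \<times> {1..s})"

text \<open>The class modulo \<open>X^r\<close> and \<open>Y^s\<close> of the form of degree
  \<open>d\<close> whose value at \<open>Y = 1\<close> is \<open>f\<close>.\<close>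

definition pvec :: "nat \<Rightarrow> nat \<Rightarrow> nat \<Rightarrow> 'f::field poly \<Rightarrow> (nat \<times> nat \<Rightarrow> 'f)"
  where "pvec r s d f = (\<lambda>(i, j). if i \<in> {1..r} \<and> j \<in> {1..s} \<and> (r - i) + (s - j) = d then coeff f (r - i) else 0)"

lemma rectI: "(\<And>i j. i = 0 \<or> r < i \<or> j = 0 \<or> s < j \<Longrightarrow> u (i, j) = 0) \<Longrightarrow> u \<in> rect r s"
  by (auto simp: rect_def supported_def)

lemma rectD: "u \<in> rect r s \<Longrightarrow> i = 0 \<or> r < i \<or> j = 0 \<or> s < j \<Longrightarrow> u (i, j) = 0"
  by (auto simp: rect_def supported_def)

lemma rect_subspace: "fs.subspace (rect r s)"
  unfolding rect_def by (rule supported_subspace)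

lemma shift2_rect: "u \<in> rect r s \<Longrightarrow> shift2 u \<in> rect r s"
proof (rule rectI)
  fix i j assume "u \<in> rect r s" "i = 0 \<or> r < i \<or> j = 0 \<or> s < j"
  then show "shift2 u (i, j) = 0"
    using rectD[of u r s "Suc i" j] rectD[of u r s i "Suc j"] by (auto simp: shift2_def)
qed

lemma shift2_pow_rect: "u \<in> rect r s \<Longrightarrow> (shift2 ^^ k) u \<in> rect r s"
  by (induction k) (simp_all only: funpow.simps o_apply id_apply shift2_rect)

lemma shift2_add: "shift2 (u + w) = shift2 u + shift2 w"
  by (auto simp: shift2_def fun_eq_iff)

lemma shift2_scale: "shift2 (c *\<^sub>F u) = c *\<^sub>F shift2 u"
  by (auto simp: shift2_def fun_eq_iff algebra_simps)

lemma shift2_pow_add: "(shift2 ^^ k) (u + w) = (shift2 ^^ k) u + (shift2 ^^ k) w"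
  by (induction k) (simp_all only: funpow.simps o_apply id_apply shift2_add)

lemma shift2_pow_scale: "(shift2 ^^ k) (c *\<^sub>F u) = c *\<^sub>F (shift2 ^^ k) u"
  by (induction k) (simp_all only: funpow.simps o_apply id_apply shift2_scale)

lemma pvec_rect: "pvec r s d f \<in> rect r s"
  by (rule rectI) (auto simp: pvec_def)

lemma pvec_add: "pvec r s d (f + h) = pvec r s d f + pvec r s d h"
  by (auto simp: pvec_def fun_eq_iff)

lemma pvec_diff: "pvec r s d (f - h) = pvec r s d f - pvec r s d h"
  by (auto simp: pvec_def fun_eq_iff)

lemma pvec_smult: "pvec r s d (smult c f) = c *\<^sub>F pvec r s d f"
  by (auto simp: pvec_def fun_eq_iff)

lemma pvec_0: "pvec r s d 0 = 0"
  by (auto simp: pvec_def fun_eq_iff)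

lemma pvec_sum: "pvec r s d (\<Sum>i\<in>A. f i) = (\<Sum>i\<in>A. pvec r s d (f i))"
  by (induction A rule: infinite_finite_induct) (simp_all only: sum.infinite sum.empty sum.insert pvec_0 pvec_add not_False_eq_True)

lemma pvec_monom: "m < r \<Longrightarrow> m' < s \<Longrightarrow> pvec r s (m + m') (monom c m) = c *\<^sub>F delta (r - m, s - m')"
  by (auto simp: pvec_def delta_def fun_eq_iff coeff_monom)

lemma pvec_eq_0_iff: "pvec r s d f = 0 \<longleftrightarrow> (\<forall>m<r. m \<le> d \<longrightarrow> d < m + s \<longrightarrow> coeff f m = 0)"
proof
  assume z: "pvec r s d f = 0"
  show "\<forall>m<r. m \<le> d \<longrightarrow> d < m + s \<longrightarrow> coeff f m = 0"
  proof (intro allI impI)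
    fix m assume m: "m < r" "m \<le> d" "d < m + s"
    have *: "r - (r - m) = m" "s - (s - (d - m)) = d - m" "1 \<le> r - m" "1 \<le> s - (d - m)" using m by auto
    have "pvec r s d f (r - m, s - (d - m)) = coeff f m"
      unfolding pvec_def split_conv * using *(3,4) m by simp
    then show "coeff f m = 0" using z by simp
  qed
next
  assume "\<forall>m<r. m \<le> d \<longrightarrow> d < m + s \<longrightarrow> coeff f m = 0"
  then show "pvec r s d f = 0" by (auto simp: pvec_def fun_eq_iff)
qed

lemma pvec_eq_0_iff_vanishes:
  assumes "deg_le f (int d)"
  shows "pvec r s d f = 0 \<longleftrightarrow> vanishes r s (int d) f"
  unfolding pvec_eq_0_iff vanishes_def using deg_leD[OF assms]
  by (metis add.commute diff_less_eq linorder_not_le of_nat_add of_nat_less_iff)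

lemma pvec_eq_iff: "pvec r s d f = pvec r s d h \<longleftrightarrow> pvec r s d (f - h) = 0"
  by (simp only: pvec_diff right_minus_eq)

lemma shift2_pvec:
  assumes "deg_le f (int d)"
  shows "shift2 (pvec r s d f) = pvec r s (Suc d) ([:1, 1:] * f)"
proof
  fix x :: "nat \<times> nat"
  obtain i j where x: "x = (i, j)" by (cases x)
  show "shift2 (pvec r s d f) x = pvec r s (Suc d) ([:1, 1:] * f) x"
  proof (cases "i \<in> {1..r} \<and> j \<in> {1..s} \<and> (r - i) + (s - j) = Suc d")
    case True
    have 1: "pvec r s d f (Suc i, j) = (if r - i = 0 then 0 else coeff f (r - i - 1))"
      using True by (auto simp: pvec_def)
    have 2: "pvec r s d f (i, Suc j) = coeff f (r - i)"
    proof (cases "j = s")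
      \<comment> \<open>The column beyond \<open>s\<close> is empty. The polynomial side agrees only
        because \<open>r - i = d + 1\<close> exceeds the degree bound.\<close>
      case j: True
      then have "coeff f (r - i) = 0" using True by (intro deg_leD[OF assms]) auto
      then show ?thesis using j by (simp add: pvec_def)
    next
      case False
      then show ?thesis using True by (auto simp: pvec_def)
    qed
    have "shift2 (pvec r s d f) x = pvec r s d f (Suc i, j) + pvec r s d f (i, Suc j)"
      using True x by (simp add: shift2_def)
    also have "\<dots> = coeff ([:1, 1:] * f) (r - i)"
      unfolding 1 2 coeff_linear_mult by simp
    also have "\<dots> = pvec r s (Suc d) ([:1, 1:] * f) x"
      unfolding x pvec_def split_conv if_P[OF True] ..
    finally show ?thesis .
  next
    case False
    then have "pvec r s (Suc d) ([:1, 1:] * f) x = 0" using x by (auto simp: pvec_def)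
    moreover have "shift2 (pvec r s d f) x = 0"
    proof (cases "i = 0 \<or> j = 0")
      case False': False
      have "pvec r s d f (Suc i, j) = 0" "pvec r s d f (i, Suc j) = 0"
        using False False' unfolding pvec_def by auto
      then show ?thesis using x by (simp add: shift2_def)
    qed (auto simp: x shift2_def)
    ultimately show ?thesis by simp
  qed
qed

lemma shift2_pow_pvec:
  assumes "deg_le f (int d)"
  shows "(shift2 ^^ k) (pvec r s d f) = pvec r s (d + k) ([:1, 1:] ^ k * f)"
proof (induction k)
  case (Suc k)
  have "deg_le ([:1, 1:] ^ k * f) (int (d + k))"
    unfolding deg_le_linear_power_mult_iff using assms by (rule deg_le_mono) simp
  from shift2_pvec[OF this] show ?case
    using Suc.IH by (simp only: funpow.simps o_apply power_Suc mult.assoc add_Suc_right)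
qed simp

lemma gen_act_at_0: "gen_act u 0 = 0"
  by (simp add: gen_act_def)

context cyclic_p_group
begin

text \<open>Row \<open>i\<close> is moved by \<open>g^(c-i)\<close>, which takes coordinate vectors
  to the basis \<open>v_ij\<close>.\<close>

definition twist :: "int \<Rightarrow> (nat \<times> nat \<Rightarrow> 'f) \<Rightarrow> (nat \<times> nat \<Rightarrow> 'f)"
  where "twist c u = (\<lambda>(i, j). (gen_act ^^ log_g (c - int i)) (\<lambda>j'. u (i, j')) j)"

lemma twist_apply: "(\<lambda>j. twist c u (i, j)) = (gen_act ^^ log_g (c - int i)) (\<lambda>j'. u (i, j'))"
  by (simp add: twist_def)

lemma twist_eval: "twist c u (i, j) = (gen_act ^^ log_g (c - int i)) (\<lambda>j'. u (i, j')) j"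
  by (simp add: twist_def)

lemma twist_add: "twist c (u + w) = twist c u + twist c w"
proof
  fix x :: "nat \<times> nat"
  obtain i j where x: "x = (i, j)" by (cases x)
  have "twist c (u + w) (i, j) = (gen_act ^^ log_g (c - int i)) ((\<lambda>j'. u (i, j')) + (\<lambda>j'. w (i, j'))) j"
    unfolding twist_eval by (simp add: plus_fun_def)
  also have "\<dots> = twist c u (i, j) + twist c w (i, j)"
    unfolding gen_act_pow_add twist_eval by simp
  finally show "twist c (u + w) x = (twist c u + twist c w) x" by (simp add: x)
qed

lemma twist_scale: "twist c (z *\<^sub>F u) = z *\<^sub>F twist c u"
proof
  fix x :: "nat \<times> nat"
  obtain i j where x: "x = (i, j)" by (cases x)
  have "twist c (z *\<^sub>F u) (i, j) = (gen_act ^^ log_g (c - int i)) (z *\<^sub>F (\<lambda>j'. u (i, j'))) j"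
    unfolding twist_eval by (simp add: fscale_def)
  also have "\<dots> = z * twist c u (i, j)"
    unfolding gen_act_pow_scale twist_eval by simp
  finally show "twist c (z *\<^sub>F u) x = (z *\<^sub>F twist c u) x" by (simp add: x)
qed

lemma twist_0: "twist c 0 = 0"
  using twist_scale[of c 0 0] by (simp add: fscale_def zero_fun_def)

lemma twist_sum: "twist c (\<Sum>i\<in>A. f i) = (\<Sum>i\<in>A. twist c (f i))"
  by (induction A rule: infinite_finite_induct)
     (simp_all only: sum.infinite sum.empty sum.insert twist_0 twist_add not_False_eq_True)

lemma tbasis_eq_twist:
  assumes "1 \<le> i" "1 \<le> j"
  shows "tbasis G g c i j = twist c (delta (i, j))"
proof
  fix x :: "nat \<times> nat"
  obtain i' j' where x: "x = (i', j')" by (cases x)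
  show "tbasis G g c i j x = twist c (delta (i, j)) x"
  proof (cases "i' = i")
    case True
    have "(\<lambda>j'. delta (i, j) (i, j')) = (vbasis j :: nat \<Rightarrow> 'f)"
      using assms by (auto simp: delta_def vbasis_def)
    then show ?thesis using True assms
      by (simp add: x tbasis_def twist_def pure_tensor_def vact_def log_g_def vbasis_def)
  next
    case False
    then have "(\<lambda>j''. delta (i, j) (i', j'')) = (\<lambda>_. 0 :: 'f)" by (auto simp: delta_def)
    then show ?thesis using False
      by (simp add: x tbasis_def twist_def pure_tensor_def vbasis_def)
  qed
qed

lemma row_supported: "u \<in> rect r s \<Longrightarrow> (\<lambda>j. u (i, j)) \<in> supported {1..s}"
  by (auto simp: rect_def supported_def)

lemma row_0: "u \<in> rect r s \<Longrightarrow> i = 0 \<or> r < i \<Longrightarrow> (\<lambda>j. u (i, j)) = (\<lambda>_. 0)"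
  by (auto dest: rectD)

lemma twist_rect: "u \<in> rect r s \<Longrightarrow> twist c u \<in> rect r s"
proof (rule rectI)
  fix i j assume u: "u \<in> rect r s" and "i = 0 \<or> r < i \<or> j = 0 \<or> s < j"
  then consider "i = 0 \<or> r < i" | "j \<notin> {1..s}" by fastforce
  then show "twist c u (i, j) = 0"
  proof cases
    case 1
    then show ?thesis by (simp add: twist_def row_0[OF u])
  next
    case 2
    moreover have "(gen_act ^^ log_g (c - int i)) (\<lambda>j'. u (i, j')) \<in> supported {1..s}"
      by (rule gen_act_pow_supported[OF row_supported[OF u]])
    ultimately show ?thesis by (simp add: twist_def supported_def)
  qed
qed

definition untwist :: "int \<Rightarrow> (nat \<times> nat \<Rightarrow> 'f) \<Rightarrow> (nat \<times> nat \<Rightarrow> 'f)"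
  where "untwist c u = (\<lambda>(i, j). (gen_act ^^ ((Q - 1) * log_g (c - int i))) (\<lambda>j'. u (i, j')) j)"

lemma untwist_rect: "u \<in> rect r s \<Longrightarrow> untwist c u \<in> rect r s"
proof (rule rectI)
  fix i j assume u: "u \<in> rect r s" and "i = 0 \<or> r < i \<or> j = 0 \<or> s < j"
  then consider "i = 0 \<or> r < i" | "j \<notin> {1..s}" by fastforce
  then show "untwist c u (i, j) = 0"
  proof cases
    case 1
    then show ?thesis by (simp add: untwist_def row_0[OF u])
  next
    case 2
    moreover have "(gen_act ^^ ((Q - 1) * log_g (c - int i))) (\<lambda>j'. u (i, j')) \<in> supported {1..s}"
      by (rule gen_act_pow_supported[OF row_supported[OF u]])
    ultimately show ?thesis by (simp add: untwist_def supported_def)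
  qed
qed

lemma gen_act_pow_cancel:
  assumes "u \<in> supported {1..d}" "d \<le> Q" "m + n = Q * k"
  shows "(gen_act ^^ m) ((gen_act ^^ n) u) = (u :: nat \<Rightarrow> 'f)"
proof -
  have "(gen_act ^^ (m + n)) u = (gen_act ^^ 0) u"
    by (rule gen_act_pow_cong[OF assms(1,2)]) (simp add: assms(3))
  then show ?thesis by (simp only: funpow_add o_apply funpow.simps id_apply)
qed

lemma Q_pred: "(Q - 1) * k + k = Q * k" "k + (Q - 1) * k = Q * k"
  using Q_gt_1 by (simp_all add: algebra_simps)

lemma untwist_twist:
  assumes "u \<in> rect r s" "s \<le> Q"
  shows "untwist c (twist c u) = u"
proof
  fix x :: "nat \<times> nat"
  obtain i j where x: "x = (i, j)" by (cases x)
  show "untwist c (twist c u) x = u x"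
    unfolding x untwist_def split_conv twist_apply
    by (simp only: gen_act_pow_cancel[OF row_supported[OF assms(1)] assms(2) Q_pred(1)])
qed

lemma twist_untwist:
  assumes "u \<in> rect r s" "s \<le> Q"
  shows "twist c (untwist c u) = u"
proof
  fix x :: "nat \<times> nat"
  obtain i j where x: "x = (i, j)" by (cases x)
  have "(\<lambda>j. untwist c u (i, j)) = (gen_act ^^ ((Q - 1) * log_g (c - int i))) (\<lambda>j'. u (i, j'))"
    by (simp add: untwist_def)
  then show "twist c (untwist c u) x = u x"
    unfolding x twist_def split_conv
    by (simp only: gen_act_pow_cancel[OF row_supported[OF assms(1)] assms(2) Q_pred(2)])
qed

lemma shift_gen_act_pow: "shift ((gen_act ^^ k) u) = (gen_act ^^ k) (shift (u :: nat \<Rightarrow> 'f))"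
proof (induction k)
  case (Suc k)
  have "shift (gen_act w) = gen_act (shift w)" for w :: "nat \<Rightarrow> 'f"
    by (auto simp: shift_def gen_act_def fun_eq_iff)
  then show ?case using Suc.IH by simp
qed simp

text \<open>The exponent \<open>c - i\<close> in \<open>v_ij\<close> is there for this:
  \<open>g\<close> acts on both factors, and its action on the second one is absorbed when row
  \<open>i + 1\<close> moves to row \<open>i\<close>.\<close>

lemma gminus1_twist:
  assumes u: "u \<in> rect r s" and s: "s \<le> Q"
  shows "gminus1 G g (twist c u) = twist c (shift2 u)"
proof
  fix x :: "nat \<times> nat"
  obtain i j where x: "x = (i, j)" by (cases x)
  show "gminus1 G g (twist c u) x = twist c (shift2 u) x"
  proof (cases "i = 0")
    case True
    have "(\<lambda>j'. shift2 u (0, j')) = (\<lambda>_. 0)" by (simp add: shift2_def)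
    then show ?thesis
      using True row_0[OF u, of 0]
      by (simp add: x gminus1_def tensor_map_def vact_g twist_def gen_act_at_0)
  next
    case False
    let ?k = "\<lambda>i. log_g (c - int i)" and ?u = "\<lambda>i j'. u (i, j')"
    define w where "w = (gen_act ^^ ?k i) (?u i)"
    have w: "w \<in> supported {1..s}" unfolding w_def by (rule gen_act_pow_supported[OF row_supported[OF u]])
    have gw: "gen_act w = w + shift w"
      using w by (auto simp: gen_act_def shift_def fun_eq_iff supported_def)
    have next_row: "gen_act ((gen_act ^^ ?k (Suc i)) (?u (Suc i))) = (gen_act ^^ ?k i) (?u (Suc i))"
    proof -
      have "(gen_act ^^ Suc (?k (Suc i))) (?u (Suc i)) = (gen_act ^^ ?k i) (?u (Suc i))"
        by (rule gen_act_pow_cong[OF row_supported[OF u] s])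
           (use log_g_Suc[of "c - int (Suc i)"] in \<open>simp add: algebra_simps\<close>)
      then show ?thesis by simp
    qed
    have row: "(\<lambda>j'. shift2 u (i, j')) = ?u (Suc i) + shift (?u i)"
      using False rectD[OF u, of "Suc i" 0] by (auto simp: shift2_def shift_def fun_eq_iff)
    have "gminus1 G g (twist c u) x =
        gen_act (\<lambda>i'. gen_act ((gen_act ^^ ?k i') (?u i')) j) i - twist c u (i, j)"
      by (simp add: x gminus1_def tensor_map_def vact_g twist_apply)
    also have "\<dots> = gen_act w j + gen_act ((gen_act ^^ ?k (Suc i)) (?u (Suc i))) j - w j"
    proof -
      have e: "gen_act h i = h i + h (Suc i)" for h :: "nat \<Rightarrow> 'f" using False by (simp add: gen_act_def)
      show ?thesis unfolding e twist_eval w_def ..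
    qed
    also have "\<dots> = (gen_act ^^ ?k i) (?u (Suc i)) j + shift w j"
      unfolding next_row gw by (simp add: algebra_simps)
    also have "shift w = (gen_act ^^ ?k i) (shift (?u i))"
      unfolding w_def by (rule shift_gen_act_pow)
    also have "(gen_act ^^ ?k i) (?u (Suc i)) j + (gen_act ^^ ?k i) (shift (?u i)) j =
        (gen_act ^^ ?k i) (?u (Suc i) + shift (?u i)) j"
      unfolding gen_act_pow_add by simp
    finally show ?thesis unfolding x twist_def split_conv row .
  qed
qed

lemma gminus1_pow_twist:
  assumes u: "u \<in> rect r s" and s: "s \<le> Q"
  shows "(gminus1 G g ^^ k) (twist c u) = twist c ((shift2 ^^ k) u)"
proof (induction k)
  case (Suc k)
  then show ?case
    using gminus1_twist[OF shift2_pow_rect[OF u, of k] s] by (simp only: funpow.simps o_apply)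
qed simp

end

section \<open>Strings\<close>

definition xv :: "nat \<Rightarrow> nat \<Rightarrow> nat \<Rightarrow> (nat \<times> nat \<Rightarrow> 'f::field)"
  where "xv r s l = pvec r s (r + s - l - 1) (xpoly r l)"

lemma xv_apply:
  assumes "1 \<le> l" "l \<le> min r s"
  shows "xv r s l (i, j) = (if 1 \<le> i \<and> 1 \<le> j \<and> i + j = Suc l then (- 1) ^ (i - 1) else 0)"
proof (cases "i \<in> {1..r} \<and> j \<in> {1..s}")
  case True
  then have e: "(r - i) + (s - j) = r + s - l - 1 \<longleftrightarrow> i + j = Suc l" using assms by auto
  have "r - (r - i) - 1 = i - 1" using True by simp
  then show ?thesis
    using True assms unfolding xv_def pvec_def split_conv e by (auto simp: coeff_xpoly)
next
  case False
  then show ?thesis using assms unfolding xv_def pvec_def by auto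
qed

lemma xv_rect: "xv r s l \<in> rect r s"
  unfolding xv_def by (rule pvec_rect)

lemma shift2_xv:
  assumes "1 \<le> l" "l \<le> min r s"
  shows "shift2 (xv r s l) = 0"
proof
  fix x :: "nat \<times> nat"
  obtain i j where x: "x = (i, j)" by (cases x)
  show "shift2 (xv r s l) x = (0 :: nat \<times> nat \<Rightarrow> 'a) x"
    unfolding x shift2_def split_conv xv_apply[OF assms] by (cases i) auto
qed

text \<open>In the kernel, entries change sign along antidiagonals, so the first row determines
  everything. Its entries beyond \<open>min r s\<close> are 0, being outside the rectangle or
  transported out of it.\<close>

lemma shift2_ker:
  assumes u: "u \<in> rect r s" and z: "shift2 u = 0"
  shows "u = (\<Sum>l=1..min r s. u (1, l) *\<^sub>F xv r s l)"
proof
  fix x :: "nat \<times> nat"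
  obtain i j where x: "x = (i, j)" by (cases x)
  have step: "u (Suc i, j) = - u (i, Suc j)" if "1 \<le> i" "1 \<le> j" for i j
    using fun_cong[OF z, of "(i, j)"] that by (simp add: shift2_def eq_neg_iff_add_eq_0)
  have row: "u (Suc i, j) = (- 1) ^ i * u (1, i + j)" if "1 \<le> j" for i j
    using that
  proof (induction i arbitrary: j)
    case (Suc i)
    then show ?case using step[of "Suc i" j] Suc.IH[of "Suc j"] by simp
  qed simp
  have big: "u (1, l) = 0" if "min r s < l" for l
  proof (cases "s < l")
    case True
    then show ?thesis using rectD[OF u, of 1 l] by simp
  next
    case False
    then have "u (Suc (l - 1), 1) = 0" using that rectD[OF u, of l 1] by auto
    then show ?thesis using row[of 1 "l - 1"] that by simp
  qed
  have "(\<Sum>l=1..min r s. u (1, l) *\<^sub>F xv r s l) (i, j) =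
      (\<Sum>l=1..min r s. if l = i + j - 1 \<and> 1 \<le> i \<and> 1 \<le> j then (- 1) ^ (i - 1) * u (1, i + j - 1) else 0)"
    unfolding sum_fun_apply fscale_apply by (intro sum.cong refl) (auto simp: xv_apply)
  also have "\<dots> = u (i, j)"
  proof (cases "1 \<le> i \<and> 1 \<le> j")
    case True
    then have "u (i, j) = (- 1) ^ (i - 1) * u (1, i + j - 1)"
      using row[of j "i - 1"] by auto
    then show ?thesis using True big[of "i + j - 1"] by (cases "i + j - 1 \<le> min r s") auto
  next
    case False
    then have "i = 0 \<or> j = 0" by auto
    then show ?thesis using rectD[OF u, of i j] by auto
  qed
  finally show "u x = (\<Sum>l=1..min r s. u (1, l) *\<^sub>F xv r s l) x" by (simp add: x)
qed

lemma xv_independent: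
  assumes "(\<Sum>l=1..min r s. c l *\<^sub>F xv r s l) = 0" "k \<in> {1..min r s}"
  shows "c k = 0"
proof -
  have "(\<Sum>l=1..min r s. c l *\<^sub>F xv r s l) (1, k) = (\<Sum>l=1..min r s. if l = k then c k else 0)"
    unfolding sum_fun_apply fscale_apply by (intro sum.cong refl) (auto simp: xv_apply)
  then show ?thesis using assms by simp
qed

definition diagonal :: "nat \<Rightarrow> nat \<Rightarrow> (nat \<times> nat \<Rightarrow> 'f::field) \<Rightarrow> 'f poly"
  where "diagonal r e v = (\<Sum>i=1..r. monom (v (i, e - i)) (r - i))"

lemma coeff_diagonal: "1 \<le> i \<Longrightarrow> i \<le> r \<Longrightarrow> coeff (diagonal r e v) (r - i) = v (i, e - i)"
proof -
  assume i: "1 \<le> i" "i \<le> r"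
  have "coeff (diagonal r e v) (r - i) = (\<Sum>k=1..r. if k = i then v (i, e - i) else 0)"
    unfolding diagonal_def coeff_sum coeff_monom using i by (intro sum.cong) auto
  then show ?thesis using i by simp
qed

lemma coeff_diagonal_power:
  assumes v: "v \<in> rect r s" and "1 \<le> i" "i \<le> r" "i < e"
  shows "coeff ([:1, 1:] ^ k * diagonal r (e + k) v) (r - i) = (shift2 ^^ k) v (i, e - i)"
  using assms(2-)
proof (induction k arbitrary: i e)
  case 0
  then show ?case by (simp add: coeff_diagonal)
next
  case (Suc k)
  let ?g = "[:1, 1:] ^ k * diagonal r (Suc e + k) v" and ?u = "(shift2 ^^ k) v"
  have 1: "coeff ?g (r - i) = ?u (i, Suc (e - i))"
    using Suc.IH[of i "Suc e"] Suc.prems by (simp add: Suc_diff_le)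
  have 2: "(if r - i = 0 then 0 else coeff ?g (r - i - 1)) = ?u (Suc i, e - i)"
  proof (cases "i = r")
    case True
    then show ?thesis using rectD[OF shift2_pow_rect[OF v, of k], of "Suc i"] by simp
  next
    case False
    moreover have "r - i - 1 = r - Suc i" by simp
    ultimately show ?thesis using Suc.IH[of "Suc i" "Suc e"] Suc.prems by simp
  qed
  have "coeff ([:1, 1:] ^ Suc k * diagonal r (e + Suc k) v) (r - i) = coeff ([:1, 1:] * ?g) (r - i)"
    by (simp only: power_Suc mult.assoc add_Suc add_Suc_right)
  also have "\<dots> = shift2 ?u (i, e - i)"
    unfolding coeff_linear_mult 1 2 using Suc.prems by (simp add: shift2_def)
  finally show ?case by simp
qed

text \<open>Only the antidiagonal of \<open>v\<close> with index sum \<open>l + 1 + j\<close>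
  contributes to that of \<open>x_l\<close>; divided by the coefficient of \<open>x_l\<close> it is
  a homogeneous preimage.\<close>

lemma hits_of_image:
  fixes v :: "nat \<times> nat \<Rightarrow> 'f::field"
  assumes v: "v \<in> rect r s" and k: "shift2 ((shift2 ^^ j) v) = 0"
    and l: "1 \<le> l" "l \<le> min r s" and c: "(shift2 ^^ j) v (1, l) \<noteq> 0"
  shows "hits TYPE('f) r s l j"
  unfolding hits_def
proof (intro exI conjI ballI)
  let ?u = "(shift2 ^^ j) v"
  let ?f = "smult (1 / ?u (1, l)) (diagonal r (Suc l + j) v)"
  show "deg_le ?f (int r + int s - int l - 1 - int j)"
  proof (rule deg_le_smult)
    show "deg_le (diagonal r (Suc l + j) v) (int r + int s - int l - 1 - int j)"
      unfolding diagonal_def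
    proof (rule deg_le_sum)
      fix i assume i: "i \<in> {1..r}"
      show "deg_le (monom (v (i, Suc l + j - i)) (r - i)) (int r + int s - int l - 1 - int j)"
      proof (cases "s < Suc l + j - i")
        case True
        then show ?thesis using rectD[OF v, of i "Suc l + j - i"] by simp
      next
        case False
        then show ?thesis using i by (intro deg_le_monom) auto
      qed
    qed
  qed
  fix i assume i: "i \<in> {1..l}"
  have "coeff ([:1, 1:] ^ j * diagonal r (Suc l + j) v) (r - i) = ?u (i, Suc l - i)"
    by (rule coeff_diagonal_power[OF v]) (use i l in auto)
  also have "\<dots> = (- 1) ^ (i - 1) * ?u (1, l)"
  proof -
    have "?u (i, Suc l - i) = (\<Sum>l=1..min r s. ?u (1, l) *\<^sub>F xv r s l) (i, Suc l - i)"
      using shift2_ker[OF shift2_pow_rect[OF v, of j] k] by (rule arg_cong)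
    also have "\<dots> = (\<Sum>l'=1..min r s. if l' = l then (- 1) ^ (i - 1) * ?u (1, l) else 0)"
      unfolding sum_fun_apply fscale_apply using i by (intro sum.cong refl) (auto simp: xv_apply)
    finally show ?thesis using l by simp
  qed
  finally show "coeff ([:1, 1:] ^ j * ?f) (r - i) = (- 1) ^ (i - 1)"
    using c unfolding mult_smult_right by simp
qed

lemma shift2_nilpotent:
  assumes v: "v \<in> rect r s"
  shows "(shift2 ^^ (r + s)) v = 0"
proof -
  have z: "(shift2 ^^ k) v (i, j) = 0" if "r + s < i + j + k" for i j k
    using that
  proof (induction k arbitrary: i j)
    case 0
    then have "r < i \<or> s < j" by linarith
    then show ?case using rectD[OF v, of i j] by auto
  next
    case (Suc k)
    then show ?case using Suc.IH[of "Suc i" j] Suc.IH[of i "Suc j"] by (auto simp: shift2_def)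
  qed
  show ?thesis
  proof
    fix x :: "nat \<times> nat"
    obtain i j where x: "x = (i, j)" by (cases x)
    show "(shift2 ^^ (r + s)) v x = (0 :: nat \<times> nat \<Rightarrow> 'a) x"
    proof (cases "i = 0")
      case True
      then show ?thesis using rectD[OF shift2_pow_rect[OF v, of "r + s"], of i j] x by simp
    next
      case False
      then show ?thesis using z[where i = i and j = j and k = "r + s"] x by simp
    qed
  qed
qed

definition string_gen :: "nat \<Rightarrow> nat \<Rightarrow> nat \<Rightarrow> (nat \<times> nat \<Rightarrow> 'f::field)"
  where "string_gen r s l = (SOME y. y \<in> rect r s \<and> (shift2 ^^ (plam TYPE('f) r s l - 1)) y = xv r s l)"

lemma string_gen:
  assumes l: "1 \<le> l" "l \<le> min r s"
  shows "(string_gen r s l :: nat \<times> nat \<Rightarrow> 'f::field) \<in> rect r s" (is ?A)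
    "(shift2 ^^ (plam TYPE('f) r s l - 1)) (string_gen r s l) = (xv r s l :: nat \<times> nat \<Rightarrow> 'f)" (is ?B)
proof -
  let ?j = "plam TYPE('f) r s l - 1"
  have "0 < plam TYPE('f) r s l" by (rule plam_pos[OF l])
  then have "hits TYPE('f) r s l ?j" using less_plam_iff[OF l(1), of ?j "TYPE('f)" r s] by simp
  moreover from hits_bound[OF this l(1)] have b: "int l + int ?j + 1 \<le> int r + int s" .
  ultimately obtain u :: "'f poly" where u: "deg_le u (int r + int s - int l - 1 - int ?j)"
    "\<forall>i\<in>{1..l}. coeff ([:1, 1:] ^ ?j * u) (r - i) = (- 1) ^ (i - 1)"
    unfolding hits_def by blast
  define d where "d = r + s - l - 1 - ?j"
  have d: "int d = int r + int s - int l - 1 - int ?j" "d + ?j = r + s - l - 1" using b by (auto simp: d_def)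
  have "(shift2 ^^ ?j) (pvec r s d u) = pvec r s (r + s - l - 1) ([:1, 1:] ^ ?j * u)"
    using shift2_pow_pvec[of u d ?j r s] u(1) d by simp
  also have "\<dots> = xv r s l"
    unfolding xv_def pvec_eq_iff pvec_eq_0_iff
  proof (intro allI impI)
    fix m assume m: "m < r" "m \<le> r + s - l - 1" "r + s - l - 1 < m + s"
    then have "r - m \<in> {1..l}" using l by auto
    with u(2) have "coeff ([:1, 1:] ^ ?j * u) (r - (r - m)) = (- 1) ^ (r - m - 1)" by blast
    moreover have "r - (r - m) = m" "r - l \<le> m" using m l by auto
    ultimately show "coeff ([:1, 1:] ^ ?j * u - xpoly r l) m = 0"
      using m l by (simp add: coeff_xpoly)
  qed
  finally have "\<exists>y. y \<in> rect r s \<and> (shift2 ^^ ?j) y = (xv r s l :: nat \<times> nat \<Rightarrow> 'f)"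
    using pvec_rect by blast
  from someI_ex[OF this] show ?A ?B
    unfolding string_gen_def[symmetric] by simp_all
qed

lemma shift2_pow_string_gen_0:
  assumes l: "1 \<le> l" "l \<le> min r s" and k: "plam TYPE('f::field) r s l \<le> k"
  shows "(shift2 ^^ k) (string_gen r s l) = (0 :: nat \<times> nat \<Rightarrow> 'f)"
proof -
  let ?L = "plam TYPE('f) r s l"
  have z: "(shift2 ^^ n) 0 = (0 :: nat \<times> nat \<Rightarrow> 'f)" for n
    using shift2_pow_scale[of n 0 "0 :: nat \<times> nat \<Rightarrow> 'f"] by (simp add: fscale_def zero_fun_def)
  have "k = (k - ?L) + Suc (?L - 1)" using k plam_pos[OF l, of "TYPE('f)"] by simp
  then have "(shift2 ^^ k) (string_gen r s l :: nat \<times> nat \<Rightarrow> 'f) = (shift2 ^^ (k - ?L)) (shift2 ((shift2 ^^ (?L - 1)) (string_gen r s l)))"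
    by (metis funpow.simps(2) funpow_add o_apply)
  also have "\<dots> = 0" unfolding string_gen(2)[OF l] shift2_xv[OF l] z ..
  finally show ?thesis .
qed

section \<open>Uniqueness of the decomposition\<close>

definition cells :: "nat list \<Rightarrow> (nat \<times> nat) set"
  where "cells L = (SIGMA k:{..<length L}. {1..L ! k})"

definition row_act :: "(nat \<times> nat \<Rightarrow> 'f::field) \<Rightarrow> (nat \<times> nat \<Rightarrow> 'f)"
  where "row_act w = (\<lambda>(k, x). gen_act (\<lambda>x'. w (k, x')) x)"

definition row_shift :: "(nat \<times> nat \<Rightarrow> 'f::field) \<Rightarrow> (nat \<times> nat \<Rightarrow> 'f)"
  where "row_shift w = (\<lambda>(k, x). if x = 0 then 0 else w (k, Suc x))"

definition tens_act :: "(nat \<times> nat \<Rightarrow> 'f::field) \<Rightarrow> (nat \<times> nat \<Rightarrow> 'f)"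
  where "tens_act = tensor_map gen_act gen_act"

lemma finite_cells: "finite (cells L)"
  by (simp add: cells_def)

lemma mod_space_direct_sum:
  "mod_space (direct_sum_module (map (Vmod G g) L)) = (supported (cells L) :: (nat \<times> nat \<Rightarrow> 'f::field) set)"
proof (rule Set.set_eqI)
  fix w :: "nat \<times> nat \<Rightarrow> 'f"
  have "w \<in> mod_space (direct_sum_module (map (Vmod G g) L)) \<longleftrightarrow>
      (\<forall>k<length L. (\<lambda>x. w (k, x)) \<in> supported {1..L ! k}) \<and> (\<forall>k\<ge>length L. \<forall>x. w (k, x) = 0)"
    by (simp add: direct_sum_module_def mod_space_Vmod del: One_nat_def)
  also have "\<dots> \<longleftrightarrow> w \<in> supported (cells L)"
    unfolding supported_def cells_def by (auto simp: not_less) (metis not_less)+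
  finally show "w \<in> mod_space (direct_sum_module (map (Vmod G g) L)) \<longleftrightarrow> w \<in> supported (cells L)" .
qed

lemma row_act_eval: "row_act w (k, x) = gen_act (\<lambda>x'. w (k, x')) x"
  by (simp add: row_act_def)

lemma row_act_pow: "(row_act ^^ n) w (k, x) = (gen_act ^^ n) (\<lambda>x'. w (k, x')) x"
proof (induction n arbitrary: x)
  case (Suc n)
  have "(\<lambda>x'. (row_act ^^ n) w (k, x')) = (gen_act ^^ n) (\<lambda>x'. w (k, x'))"
    using Suc.IH by (simp add: fun_eq_iff)
  then show ?case by (simp add: row_act_eval)
qed simp

text \<open>The module action is 0 beyond the last summand, whereas the zeroth power of
  \<open>row_act\<close> is the identity; on supported vectors they agree.\<close>

lemma mod_act_direct_sum:
  assumes "w \<in> supported (cells L)"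
  shows "mod_act (direct_sum_module (map (Vmod G g) L)) h w = (row_act ^^ (LEAST k::nat. g [^]\<^bsub>G\<^esub> k = h)) w"
proof
  fix y :: "nat \<times> nat"
  obtain k x where y: "y = (k, x)" by (cases y)
  show "mod_act (direct_sum_module (map (Vmod G g) L)) h w y = (row_act ^^ (LEAST k::nat. g [^]\<^bsub>G\<^esub> k = h)) w y"
  proof (cases "k < length L")
    case True
    then show ?thesis unfolding y row_act_pow by (simp add: direct_sum_module_def Vmod_def vact_def)
  next
    case False
    then have "(\<lambda>x'. w (k, x')) = (\<lambda>_. 0)" using assms by (auto simp: supported_def cells_def)
    then show ?thesis using False unfolding y row_act_pow by (simp add: direct_sum_module_def)
  qed
qed

text \<open>The actions on the two factors are commuting operators \<open>A\<close> and
  \<open>B\<close>, so \<open>A^n B^n = (A B)^n\<close>.\<close>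

lemma tensor_map_pow: "tensor_map (gen_act ^^ n) (gen_act ^^ n) = tens_act ^^ n"
proof -
  define A where "A = (\<lambda>(T :: nat \<times> nat \<Rightarrow> 'a) (i, j). gen_act (\<lambda>i'. T (i', j)) i)"
  define B where "B = (\<lambda>(T :: nat \<times> nat \<Rightarrow> 'a) (i, j). gen_act (\<lambda>j'. T (i, j')) j)"
  have AB: "A (B T) = B (A T)" for T
    by (auto simp: A_def B_def gen_act_def fun_eq_iff)
  have A: "(A ^^ n) T (i, j) = (gen_act ^^ n) (\<lambda>i'. T (i', j)) i" for n T i j
  proof (induction n arbitrary: i)
    case (Suc n)
    have "(\<lambda>i'. (A ^^ n) T (i', j)) = (gen_act ^^ n) (\<lambda>i'. T (i', j))" using Suc.IH by (simp add: fun_eq_iff)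
    then show ?case by (simp add: A_def)
  qed simp
  have B: "(B ^^ n) T (i, j) = (gen_act ^^ n) (\<lambda>j'. T (i, j')) j" for n T i j
  proof (induction n arbitrary: j)
    case (Suc n)
    have "(\<lambda>j'. (B ^^ n) T (i, j')) = (gen_act ^^ n) (\<lambda>j'. T (i, j'))" using Suc.IH by (simp add: fun_eq_iff)
    then show ?case by (simp add: B_def)
  qed simp
  have t: "tensor_map (gen_act ^^ n) (gen_act ^^ n) T = (A ^^ n) ((B ^^ n) T)" for n and T :: "nat \<times> nat \<Rightarrow> 'a"
    by (auto simp: tensor_map_def fun_eq_iff A B)
  have t1: "tens_act T = A (B T)" for T using t[of 1 T] by (simp add: tens_act_def)
  have "(A ^^ n) ((B ^^ n) T) = (tens_act ^^ n) T" for n T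
  proof (induction n)
    case (Suc n)
    have An: "(A ^^ n) (B S) = B ((A ^^ n) S)" for S
      by (induction n) (simp_all add: AB)
    have "(A ^^ Suc n) ((B ^^ Suc n) T) = A (B ((A ^^ n) ((B ^^ n) T)))" by (simp add: An)
    then show ?case using Suc.IH t1 by simp
  qed simp
  then show ?thesis using t by (auto simp: fun_eq_iff)
qed

lemma mod_act_tensor:
  "mod_act (tensor_module (Vmod G g r) (Vmod G g s)) h = tens_act ^^ (LEAST k::nat. g [^]\<^bsub>G\<^esub> k = h)"
  by (simp add: tensor_module_def Vmod_def vact_def tensor_map_pow)

lemma row_act_eq: "w \<in> supported (cells L) \<Longrightarrow> row_act w = w + row_shift w"
  by (auto simp: row_act_def row_shift_def gen_act_def fun_eq_iff supported_def cells_def)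

lemma row_shift_supported: "w \<in> supported (cells L) \<Longrightarrow> row_shift w \<in> supported (cells L)"
  by (auto simp: row_shift_def supported_def cells_def)

lemma row_act_supported: "w \<in> supported (cells L) \<Longrightarrow> row_act w \<in> supported (cells L)"
  using row_act_eq row_shift_supported supported_subspace fs.subspace_add by metis

lemma row_act_pow_supported: "w \<in> supported (cells L) \<Longrightarrow> (row_act ^^ n) w \<in> supported (cells L)"
  by (induction n) (simp_all only: funpow.simps o_apply id_apply row_act_supported)

lemma additive_on_sum:
  fixes \<chi> :: "('x \<Rightarrow> 'f::field) \<Rightarrow> ('y \<Rightarrow> 'f)"
  assumes add: "\<And>u w. u \<in> supported A \<Longrightarrow> w \<in> supported A \<Longrightarrow> \<chi> (u + w) = \<chi> u + \<chi> w"
    and scale: "\<And>c u. u \<in> supported A \<Longrightarrow> \<chi> (c *\<^sub>F u) = c *\<^sub>F \<chi> u"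
    and "finite K" "\<And>k. k \<in> K \<Longrightarrow> e k \<in> supported A"
  shows "\<chi> (\<Sum>k\<in>K. c k *\<^sub>F e k) = (\<Sum>k\<in>K. c k *\<^sub>F \<chi> (e k))"
  using assms(3,4)
proof (induction K rule: finite_induct)
  case empty
  have "\<chi> (0 *\<^sub>F 0) = 0 *\<^sub>F \<chi> 0" by (rule scale) (simp add: supported_def)
  then show ?case by (simp add: fscale_def zero_fun_def)
next
  case (insert k K)
  have 1: "(\<Sum>k\<in>K. c k *\<^sub>F e k) \<in> supported A"
    using insert by (intro fs.subspace_sum supported_subspace fs.subspace_scale) auto
  have 2: "e k \<in> supported A" using insert.prems by auto
  then have 3: "c k *\<^sub>F e k \<in> supported A" by (rule fs.subspace_scale[OF supported_subspace])
  have IH: "\<chi> (\<Sum>k\<in>K. c k *\<^sub>F e k) = (\<Sum>k\<in>K. c k *\<^sub>F \<chi> (e k))"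
    using insert.prems by (intro insert.IH) auto
  have "\<chi> (\<Sum>k\<in>insert k K. c k *\<^sub>F e k) = \<chi> (c k *\<^sub>F e k + (\<Sum>k\<in>K. c k *\<^sub>F e k))"
    by (simp only: sum.insert[OF insert.hyps])
  also have "\<dots> = (\<Sum>k\<in>insert k K. c k *\<^sub>F \<chi> (e k))"
    by (simp only: add[OF 3 1] scale[OF 2] IH sum.insert[OF insert.hyps])
  finally show ?case .
qed

text \<open>The bottom vectors of the blocks longer than \<open>i\<close> span the kernel of the
  shift intersected with the image of its \<open>i\<close>-th power. An injection commuting with the
  shift carries this space into its counterpart.\<close>

lemma count_le:
  fixes \<chi> :: "(nat \<times> nat \<Rightarrow> 'f::field) \<Rightarrow> (nat \<times> nat \<Rightarrow> 'f)"
  assumes into: "\<And>w. w \<in> supported (cells L) \<Longrightarrow> \<chi> w \<in> supported (cells L')"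
    and add: "\<And>u w. u \<in> supported (cells L) \<Longrightarrow> w \<in> supported (cells L) \<Longrightarrow> \<chi> (u + w) = \<chi> u + \<chi> w"
    and scale: "\<And>c u. u \<in> supported (cells L) \<Longrightarrow> \<chi> (c *\<^sub>F u) = c *\<^sub>F \<chi> u"
    and inj: "inj_on \<chi> (supported (cells L))"
    and comm: "\<And>w. w \<in> supported (cells L) \<Longrightarrow> \<chi> (row_shift w) = row_shift (\<chi> w)"
  shows "card {k. k < length L \<and> i < L ! k} \<le> card {k. k < length L' \<and> i < L' ! k}"
proof -
  define B where "B = {k. k < length L \<and> i < L ! k}"
  define B' where "B' = {k. k < length L' \<and> i < L' ! k}"
  define e where "e = (\<lambda>k. delta (k, 1) :: nat \<times> nat \<Rightarrow> 'f)"
  have fin: "finite B" "finite B'" by (auto simp: B_def B'_def)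
  have e: "e k \<in> supported (cells L)" if "k \<in> B" for k
    using that by (auto simp: e_def B_def supported_def delta_def cells_def)
  have zero: "0 \<in> supported (cells L)" by (rule fs.subspace_0[OF supported_subspace])
  have \<chi>0: "\<chi> 0 = 0" using scale[OF zero, of 0] by (simp add: fscale_def zero_fun_def)
  have inj_e: "inj_on (\<lambda>k. \<chi> (e k)) B"
  proof (rule inj_onI)
    fix k k' assume k: "k \<in> B" "k' \<in> B" "\<chi> (e k) = \<chi> (e k')"
    then have "e k = e k'" using inj e by (auto dest: inj_onD)
    then have "e k (k, 1) = e k' (k, 1)" by simp
    then show "k = k'" by (auto simp: e_def delta_def split: if_splits)
  qed
  have "fs.independent ((\<lambda>k. \<chi> (e k)) ` B)"
  proof (rule fs.independent_if_scalars_zero)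
    show "finite ((\<lambda>k. \<chi> (e k)) ` B)" using fin by simp
    fix f x assume s: "(\<Sum>x\<in>(\<lambda>k. \<chi> (e k)) ` B. f x *\<^sub>F x) = 0" and "x \<in> (\<lambda>k. \<chi> (e k)) ` B"
    then obtain k where k: "k \<in> B" "x = \<chi> (e k)" by blast
    let ?v = "\<Sum>k\<in>B. f (\<chi> (e k)) *\<^sub>F e k"
    have "\<chi> ?v = (\<Sum>k\<in>B. f (\<chi> (e k)) *\<^sub>F \<chi> (e k))"
      by (rule additive_on_sum[OF add scale fin(1) e])
    also have "\<dots> = \<chi> 0" using s unfolding \<chi>0 by (simp add: sum.reindex[OF inj_e])
    finally have "\<chi> ?v = \<chi> 0" .
    moreover have "?v \<in> supported (cells L)"
      using e by (intro fs.subspace_sum supported_subspace fs.subspace_scale) auto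
    ultimately have "?v = 0" using inj zero by (auto dest: inj_onD)
    then have "?v (k, 1) = 0" by simp
    moreover have "?v (k, 1) = (\<Sum>k'\<in>B. if k' = k then f (\<chi> (e k)) else 0)"
      unfolding sum_fun_apply by (intro sum.cong) (auto simp: e_def delta_def)
    ultimately show "f x = 0" using k fin by simp
  qed
  moreover have "(\<lambda>k. \<chi> (e k)) ` B \<subseteq> fs.span (delta ` (B' \<times> {1}))"
  proof safe
    fix k assume k: "k \<in> B"
    have pow: "(row_shift ^^ n) w (k', x) = (if n > 0 \<and> x = 0 then 0 else w (k', x + n))"
      for n k' x and w :: "nat \<times> nat \<Rightarrow> 'f"
      by (induction n arbitrary: x) (auto simp: row_shift_def)
    \<comment> \<open>A vector at height \<open>i + 1\<close> above \<open>e k\<close>; it exhibits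
      \<open>\<chi> (e k)\<close> as an \<open>i\<close>-fold shift.\<close>
    define d where "d = (delta (k, Suc i) :: nat \<times> nat \<Rightarrow> 'f)"
    have d: "d \<in> supported (cells L)" using k by (auto simp: d_def B_def supported_def delta_def cells_def)
    have dn: "(row_shift ^^ n) d \<in> supported (cells L)" for n
      by (induction n) (simp_all only: funpow.simps o_apply id_apply d row_shift_supported)
    have "\<chi> ((row_shift ^^ n) d) = (row_shift ^^ n) (\<chi> d)" for n
      using comm[OF dn] by (induction n) simp_all
    moreover have "(row_shift ^^ i) d = e k"
    proof
      fix y :: "nat \<times> nat"
      obtain k' x where "y = (k', x)" by (cases y)
      then show "(row_shift ^^ i) d y = e k y" by (auto simp: pow d_def e_def delta_def)
    qed
    ultimately have 1: "\<chi> (e k) = (row_shift ^^ i) (\<chi> d)" by metis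
    have "row_shift (e k) = 0" by (auto simp: row_shift_def e_def delta_def fun_eq_iff)
    then have 2: "row_shift (\<chi> (e k)) = 0" using comm[OF e[OF k]] \<chi>0 by simp
    have "\<chi> (e k) \<in> supported (B' \<times> {1})"
      unfolding supported_def
    proof (intro CollectI allI impI)
      fix y assume y: "y \<notin> B' \<times> {1::nat}"
      obtain k' x where x: "y = (k', x)" by (cases y)
      show "\<chi> (e k) y = 0"
      proof (cases "x = 1")
        case True
        then have "(k', Suc i) \<notin> cells L'" using y x by (auto simp: B'_def cells_def)
        then have "\<chi> d (k', Suc i) = 0" using into[OF d] by (auto simp: supported_def)
        then show ?thesis unfolding 1 x pow using True by simp
      next
        case False
        then consider "x = 0" | x0 where "x = Suc x0" "x0 \<noteq> 0" by (cases x) auto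
        then show ?thesis
        proof cases
          case 1
          then show ?thesis using into[OF e[OF k]] x by (auto simp: supported_def cells_def)
        next
          case 2
          then show ?thesis using fun_cong[OF \<open>row_shift (\<chi> (e k)) = 0\<close>, of "(k', x0)"] x by (simp add: row_shift_def)
        qed
      qed
    qed
    then show "\<chi> (e k) \<in> fs.span (delta ` (B' \<times> {1}))"
      using fin by (simp only: span_delta finite_SigmaI finite.intros)
  qed
  ultimately have "card ((\<lambda>k. \<chi> (e k)) ` B) \<le> card (delta ` (B' \<times> {1::nat}) :: (nat \<times> nat \<Rightarrow> 'f) set)"
    using fs.independent_span_bound[of "delta ` (B' \<times> {1::nat})" "(\<lambda>k. \<chi> (e k)) ` B"] fin by simp
  also have "\<dots> \<le> card (B' \<times> {1::nat})" using fin by (intro card_image_le) auto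
  finally show ?thesis using card_image[OF inj_e] by (simp add: B_def B'_def card_cartesian_product)
qed

text \<open>The counts form the conjugate partition, from which a decreasing list can be read
  off.\<close>

lemma decreasing_nth_iff:
  fixes L :: "nat list"
  assumes "sorted_wrt (\<ge>) L" "k < length L"
  shows "i < L ! k \<longleftrightarrow> k < card {k. k < length L \<and> i < L ! k}"
proof
  assume "i < L ! k"
  then have "i < L ! k'" if "k' \<le> k" for k'
    using that assms sorted_wrt_nth_less[OF assms(1), of k' k] by (cases "k' = k") auto
  then have "{..k} \<subseteq> {k. k < length L \<and> i < L ! k}" using assms(2) by auto
  then have "card {..k} \<le> card {k. k < length L \<and> i < L ! k}" by (intro card_mono) auto
  then show "k < card {k. k < length L \<and> i < L ! k}" by simp
next
  assume c: "k < card {k. k < length L \<and> i < L ! k}"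
  show "i < L ! k"
  proof (rule ccontr)
    assume "\<not> i < L ! k"
    then have "k' < k" if "k' < length L" "i < L ! k'" for k'
      using that assms sorted_wrt_nth_less[OF assms(1), of k k'] by (cases k k' rule: linorder_cases) auto
    then have "{k. k < length L \<and> i < L ! k} \<subseteq> {..<k}" by auto
    then have "card {k. k < length L \<and> i < L ! k} \<le> card {..<k}" by (intro card_mono) auto
    then show False using c by simp
  qed
qed

lemma decreasing_eqI:
  fixes L L' :: "nat list"
  assumes "length L = length L'" "sorted_wrt (\<ge>) L" "sorted_wrt (\<ge>) L'"
    and "\<And>i. card {k. k < length L \<and> i < L ! k} = card {k. k < length L' \<and> i < L' ! k}"
  shows "L = L'"
proof (rule nth_equalityI)
  fix k assume k: "k < length L"
  have "i < L ! k \<longleftrightarrow> i < L' ! k" for i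
    using decreasing_nth_iff[OF assms(2) k] decreasing_nth_iff[OF assms(3), of k] k assms(1,4) by simp
  then show "L ! k = L' ! k" by (metis linorder_neqE_nat less_irrefl)
qed (rule assms(1))

context cyclic_p_group
begin

text \<open>One isomorphism is composed with the inverse of the other. Commuting with
  \<open>g\<close> means commuting with the shift, since \<open>g\<close> acts as 1 plus the
  shift.\<close>

lemma iso_direct_sums_count_le:
  assumes 1: "gmodule_iso G (tensor_module (Vmod G g r :: ('g, nat \<Rightarrow> 'f) gmodule) (Vmod G g s)) (direct_sum_module (map (Vmod G g) L))"
    and 2: "gmodule_iso G (tensor_module (Vmod G g r :: ('g, nat \<Rightarrow> 'f) gmodule) (Vmod G g s)) (direct_sum_module (map (Vmod G g) L'))"
  shows "card {k. k < length L \<and> i < L ! k} \<le> card {k. k < length L' \<and> i < L' ! k}"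
proof -
  define T where "T = (supported ({1..r} \<times> {1..s}) :: (nat \<times> nat \<Rightarrow> 'f) set)"
  have act_L: "mod_act (direct_sum_module (map (Vmod G g) K)) g w = row_act w"
    if "w \<in> supported (cells K)" for w :: "nat \<times> nat \<Rightarrow> 'f" and K
    using mod_act_direct_sum[OF that, of G g g] by (simp add: LEAST_g)
  have act_T: "mod_act (tensor_module (Vmod G g r) (Vmod G g s)) g = (tens_act :: (nat \<times> nat \<Rightarrow> 'f) \<Rightarrow> _)"
    by (simp add: mod_act_tensor LEAST_g)
  from 1 obtain \<phi> where \<phi>: "bij_betw \<phi> T (supported (cells L))"
    "\<And>u w. u \<in> T \<Longrightarrow> w \<in> T \<Longrightarrow> \<phi> (u + w) = \<phi> u + \<phi> w"
    "\<And>c u. u \<in> T \<Longrightarrow> \<phi> (c *\<^sub>F u) = c *\<^sub>F \<phi> u"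
    "\<And>u. u \<in> T \<Longrightarrow> \<phi> (tens_act u) = mod_act (direct_sum_module (map (Vmod G g) L)) g (\<phi> u)"
    unfolding gmodule_iso_def mod_space_tensor mod_space_direct_sum T_def[symmetric] act_T[symmetric] using g by blast
  from 2 obtain \<phi>' where \<phi>': "bij_betw \<phi>' T (supported (cells L'))"
    "\<And>u w. u \<in> T \<Longrightarrow> w \<in> T \<Longrightarrow> \<phi>' (u + w) = \<phi>' u + \<phi>' w"
    "\<And>c u. u \<in> T \<Longrightarrow> \<phi>' (c *\<^sub>F u) = c *\<^sub>F \<phi>' u"
    "\<And>u. u \<in> T \<Longrightarrow> \<phi>' (tens_act u) = mod_act (direct_sum_module (map (Vmod G g) L')) g (\<phi>' u)"
    unfolding gmodule_iso_def mod_space_tensor mod_space_direct_sum T_def[symmetric] act_T[symmetric] using g by blast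
  define \<psi> where "\<psi> = inv_into T \<phi>"
  have \<psi>: "\<psi> w \<in> T" "\<phi> (\<psi> w) = w" if "w \<in> supported (cells L)" for w
    using that \<phi>(1) unfolding \<psi>_def by (auto simp: bij_betw_def inv_into_into f_inv_into_f)
  have \<psi>\<phi>: "\<psi> (\<phi> u) = u" if "u \<in> T" for u
    using that \<phi>(1) unfolding \<psi>_def by (auto simp: bij_betw_def)
  have T: "u + w \<in> T" "c *\<^sub>F u \<in> T" if "u \<in> T" "w \<in> T" for u w c
    using that fs.subspace_add[OF supported_subspace] fs.subspace_scale[OF supported_subspace] unfolding T_def by blast+
  have tens_T: "tens_act u \<in> T" if "u \<in> T" for u
    using that by (auto simp: T_def supported_def tens_act_def tensor_map_def gen_act_def)
  define \<chi> where "\<chi> = (\<lambda>w. \<phi>' (\<psi> w))"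
  have \<psi>_add: "\<psi> (u + w) = \<psi> u + \<psi> w" if "u \<in> supported (cells L)" "w \<in> supported (cells L)" for u w
    using \<psi>\<phi>[OF T(1)[OF \<psi>(1)[OF that(1)] \<psi>(1)[OF that(2)]]] \<phi>(2) \<psi> that by simp
  have \<psi>_scale: "\<psi> (c *\<^sub>F w) = c *\<^sub>F \<psi> w" if "w \<in> supported (cells L)" for c w
    using \<psi>\<phi>[OF T(2)[OF \<psi>(1)[OF that] \<psi>(1)[OF that]]] \<phi>(3) \<psi> that by simp
  have \<psi>_act: "\<psi> (row_act w) = tens_act (\<psi> w)" if "w \<in> supported (cells L)" for w
  proof -
    have "\<phi> (tens_act (\<psi> w)) = row_act w" using \<phi>(4) \<psi> act_L that by simp
    then show ?thesis using \<psi>\<phi>[OF tens_T[OF \<psi>(1)[OF that]]] by simp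
  qed
  have into: "\<chi> w \<in> supported (cells L')" if "w \<in> supported (cells L)" for w
    using \<psi>(1)[OF that] \<phi>'(1) unfolding \<chi>_def by (auto simp: bij_betw_def)
  have add: "\<chi> (u + w) = \<chi> u + \<chi> w" if "u \<in> supported (cells L)" "w \<in> supported (cells L)" for u w
    using \<psi>_add \<phi>'(2) \<psi>(1) that unfolding \<chi>_def by simp
  show ?thesis
  proof (rule count_le[where \<chi> = \<chi>])
    show "inj_on \<chi> (supported (cells L))"
    proof (rule inj_onI)
      fix u w assume "u \<in> supported (cells L)" "w \<in> supported (cells L)" "\<chi> u = \<chi> w"
      then have "\<psi> u = \<psi> w" using \<phi>'(1) \<psi>(1) unfolding \<chi>_def bij_betw_def by (auto dest: inj_onD)
      then show "u = w" using \<psi>(2) \<open>u \<in> _\<close> \<open>w \<in> _\<close> by metis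
    qed
    fix w :: "nat \<times> nat \<Rightarrow> 'f" assume w: "w \<in> supported (cells L)"
    have "\<chi> (row_act w) = row_act (\<chi> w)"
      using \<psi>_act[OF w] \<phi>'(4)[OF \<psi>(1)[OF w]] act_L[OF into[OF w]] unfolding \<chi>_def by simp
    then have "\<chi> w + \<chi> (row_shift w) = \<chi> w + row_shift (\<chi> w)"
      unfolding row_act_eq[OF w] row_act_eq[OF into[OF w]] add[OF w row_shift_supported[OF w]] .
    then show "\<chi> (row_shift w) = row_shift (\<chi> w)" by (rule add_left_imp_eq)
  qed (use into add \<psi>_scale \<phi>'(3) \<psi>(1) in \<open>auto simp: \<chi>_def\<close>)
qed

end

section \<open>Existence of the decomposition\<close>

text \<open>Strings naturally give a map out of the direct sum, while the decomposition asks for one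
  into it.\<close>

lemma gmodule_iso_symI:
  assumes bij: "bij_betw \<Phi> (mod_space N) (mod_space M)"
    and add: "\<And>u w. u \<in> mod_space N \<Longrightarrow> w \<in> mod_space N \<Longrightarrow> \<Phi> (u + w) = \<Phi> u + \<Phi> w"
    and scale: "\<And>c u. u \<in> mod_space N \<Longrightarrow> \<Phi> (c *\<^sub>F u) = c *\<^sub>F \<Phi> u"
    and act: "\<And>h u. h \<in> carrier G \<Longrightarrow> u \<in> mod_space N \<Longrightarrow> \<Phi> (mod_act N h u) = mod_act M h (\<Phi> u)"
    and subspace: "fs.subspace (mod_space N)"
    and closed: "\<And>h u. h \<in> carrier G \<Longrightarrow> u \<in> mod_space N \<Longrightarrow> mod_act N h u \<in> mod_space N"
  shows "gmodule_iso G M N"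
proof -
  define \<phi> where "\<phi> = inv_into (mod_space N) \<Phi>"
  have \<phi>: "\<phi> w \<in> mod_space N" "\<Phi> (\<phi> w) = w" if "w \<in> mod_space M" for w
    using that bij unfolding \<phi>_def by (auto simp: bij_betw_def inv_into_into f_inv_into_f)
  have \<phi>\<Phi>: "\<phi> (\<Phi> u) = u" if "u \<in> mod_space N" for u
    using that bij unfolding \<phi>_def by (auto simp: bij_betw_def)
  show ?thesis
    unfolding gmodule_iso_def
  proof (intro exI[of _ \<phi>] conjI ballI allI)
    show "bij_betw \<phi> (mod_space M) (mod_space N)"
      unfolding \<phi>_def by (rule bij_betw_inv_into[OF bij])
    fix u assume u: "u \<in> mod_space M"
    show "\<phi> (c *\<^sub>F u) = c *\<^sub>F \<phi> u" for c
      using \<phi>\<Phi>[OF fs.subspace_scale[OF subspace \<phi>(1)[OF u]], of c] scale[OF \<phi>(1)[OF u]] \<phi>(2)[OF u] by simp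
    show "\<phi> (mod_act M h u) = mod_act N h (\<phi> u)" if "h \<in> carrier G" for h
      using \<phi>\<Phi>[OF closed[OF that \<phi>(1)[OF u]]] act[OF that \<phi>(1)[OF u]] \<phi>(2)[OF u] by simp
    fix w assume w: "w \<in> mod_space M"
    show "\<phi> (u + w) = \<phi> u + \<phi> w"
      using \<phi>\<Phi>[OF fs.subspace_add[OF subspace \<phi>(1)[OF u] \<phi>(1)[OF w]]] add[OF \<phi>(1)[OF u] \<phi>(1)[OF w]]
        \<phi>(2)[OF u] \<phi>(2)[OF w] by simp
  qed
qed

definition plams :: "'f::field itself \<Rightarrow> nat \<Rightarrow> nat \<Rightarrow> nat list"
  where "plams F r s = map (plam F r s) [1..<Suc (min r s)]"

lemma length_plams [simp]: "length (plams F r s) = min r s"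
  by (simp add: plams_def del: upt_Suc)

lemma nth_plams: "k < min r s \<Longrightarrow> plams F r s ! k = plam F r s (Suc k)"
  by (simp add: plams_def del: upt_Suc)

text \<open>Cell \<open>(k, i)\<close> goes to the element at height \<open>i\<close> of the string
  over \<open>x_(k+1)\<close>, with \<open>x_(k+1)\<close> itself at height 1.\<close>

definition string_map :: "nat \<Rightarrow> nat \<Rightarrow> (nat \<times> nat \<Rightarrow> 'f::field) \<Rightarrow> (nat \<times> nat \<Rightarrow> 'f)"
  where "string_map r s w = (\<Sum>k<min r s. \<Sum>i=1..plam TYPE('f) r s (Suc k).
    w (k, i) *\<^sub>F (shift2 ^^ (plam TYPE('f) r s (Suc k) - i)) (string_gen r s (Suc k)))"

lemma string_map_add: "string_map r s (u + w) = string_map r s u + string_map r s w"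
  unfolding string_map_def plus_fun_apply fs.scale_left_distrib sum.distrib ..

lemma string_map_scale: "string_map r s (c *\<^sub>F w) = c *\<^sub>F string_map r s w"
  unfolding string_map_def fs.scale_sum_right fscale_apply fs.scale_scale ..

lemma shift2_sum: "shift2 (\<Sum>i\<in>A. f i) = (\<Sum>i\<in>A. shift2 (f i))"
proof (induction A rule: infinite_finite_induct)
  case empty
  show ?case by (simp add: shift2_def fun_eq_iff)
next
  case (infinite A)
  then show ?case by (simp add: shift2_def fun_eq_iff)
qed (simp_all only: sum.insert shift2_add not_False_eq_True)

lemma shift2_pow_sum: "(shift2 ^^ n) (\<Sum>i\<in>A. f i) = (\<Sum>i\<in>A. (shift2 ^^ n) (f i))"
  by (induction n) (simp_all only: funpow.simps o_apply id_apply shift2_sum)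

lemma string_map_rect: "string_map r s w \<in> rect r s"
  unfolding string_map_def
  by (intro fs.subspace_sum fs.subspace_scale rect_subspace shift2_pow_rect string_gen(1)) auto

lemma shift2_pow_string:
  assumes l: "l < min r s" and i: "1 \<le> i" "i \<le> plam TYPE('f::field) r s (Suc l)"
  shows "(shift2 ^^ n) ((shift2 ^^ (plam TYPE('f) r s (Suc l) - i)) (string_gen r s (Suc l))) =
    (if n < i - 1 then (shift2 ^^ (plam TYPE('f) r s (Suc l) - (i - n))) (string_gen r s (Suc l))
     else if n = i - 1 then xv r s (Suc l) else (0 :: nat \<times> nat \<Rightarrow> 'f))"
proof -
  let ?L = "plam TYPE('f) r s (Suc l)" and ?y = "string_gen r s (Suc l) :: nat \<times> nat \<Rightarrow> 'f"
  have l': "1 \<le> Suc l" "Suc l \<le> min r s" using l by auto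
  have e: "(shift2 ^^ n) ((shift2 ^^ (?L - i)) ?y) = (shift2 ^^ (n + (?L - i))) ?y"
    by (simp only: funpow_add o_apply)
  consider "n < i - 1" | "n = i - 1" | "i \<le> n" using i by linarith
  then show ?thesis
  proof cases
    case 1
    then have "n + (?L - i) = ?L - (i - n)" using i by simp
    then show ?thesis unfolding e using 1 by simp
  next
    case 2
    then have "n + (?L - i) = ?L - 1" using i by simp
    then show ?thesis unfolding e using 2 string_gen(2)[OF l'] by simp
  next
    case 3
    then have "?L \<le> n + (?L - i)" using i by simp
    from shift2_pow_string_gen_0[OF l' this] show ?thesis unfolding e using 3 i by auto
  qed
qed

lemma shift2_string_map:
  fixes w :: "nat \<times> nat \<Rightarrow> 'f::field"
  assumes w: "w \<in> supported (cells (plams TYPE('f) r s))"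
  shows "shift2 (string_map r s w) = string_map r s (row_shift w)"
  unfolding string_map_def shift2_sum
proof (rule sum.cong[OF refl])
  fix k assume k: "k \<in> {..<min r s}"
  let ?L = "plam TYPE('f) r s (Suc k)" and ?y = "string_gen r s (Suc k) :: nat \<times> nat \<Rightarrow> 'f"
  have k': "1 \<le> Suc k" "Suc k \<le> min r s" using k by auto
  have "(\<Sum>i=1..?L. shift2 (w (k, i) *\<^sub>F (shift2 ^^ (?L - i)) ?y)) =
      (\<Sum>i=1..?L. w (k, i) *\<^sub>F (shift2 ^^ (Suc (?L - i))) ?y)"
    by (simp only: shift2_scale funpow.simps o_apply)
  also have "\<dots> = (\<Sum>i\<in>{Suc 1..?L}. w (k, i) *\<^sub>F (shift2 ^^ (Suc (?L - i))) ?y)"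
  proof (rule sum.mono_neutral_right)
    show "\<forall>i\<in>{1..?L} - {Suc 1..?L}. w (k, i) *\<^sub>F (shift2 ^^ Suc (?L - i)) ?y = 0"
    proof
      fix i assume "i \<in> {1..?L} - {Suc 1..?L}"
      then have "i = 1" "1 \<le> ?L" by auto
      then have "?L \<le> Suc (?L - i)" by simp
      from shift2_pow_string_gen_0[OF k' this] show "w (k, i) *\<^sub>F (shift2 ^^ Suc (?L - i)) ?y = 0"
        by (simp only: fs.scale_zero_right)
    qed
  qed auto
  also have "\<dots> = (\<Sum>i\<in>{Suc 1..?L}. w (k, Suc (i - 1)) *\<^sub>F (shift2 ^^ (?L - (i - 1))) ?y)"
  proof (rule sum.cong[OF refl])
    fix i assume "i \<in> {Suc 1..?L}"
    then have "Suc (?L - i) = ?L - (i - 1)" "Suc (i - 1) = i" by auto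
    then show "w (k, i) *\<^sub>F (shift2 ^^ (Suc (?L - i))) ?y = w (k, Suc (i - 1)) *\<^sub>F (shift2 ^^ (?L - (i - 1))) ?y"
      by (simp only:)
  qed
  also have "\<dots> = (\<Sum>i\<in>{1..<?L}. w (k, Suc i) *\<^sub>F (shift2 ^^ (?L - i)) ?y)"
    by (rule sum.reindex_bij_witness[of _ Suc "\<lambda>i. i - 1"]) auto
  also have "\<dots> = (\<Sum>i\<in>{1..?L}. w (k, Suc i) *\<^sub>F (shift2 ^^ (?L - i)) ?y)"
  proof (rule sum.mono_neutral_left)
    show "\<forall>i\<in>{1..?L} - {1..<?L}. w (k, Suc i) *\<^sub>F (shift2 ^^ (?L - i)) ?y = 0"
    proof
      fix i assume "i \<in> {1..?L} - {1..<?L}"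
      then have "i = ?L" by auto
      then have "(k, Suc i) \<notin> cells (plams TYPE('f) r s)"
        using k by (auto simp: cells_def nth_plams)
      then have "w (k, Suc i) = 0" using w by (simp add: supported_def)
      then show "w (k, Suc i) *\<^sub>F (shift2 ^^ (?L - i)) ?y = 0" by (simp only: fs.scale_zero_left)
    qed
  qed auto
  also have "\<dots> = (\<Sum>i=1..?L. row_shift w (k, i) *\<^sub>F (shift2 ^^ (?L - i)) ?y)"
    by (rule sum.cong) (auto simp: row_shift_def)
  finally show "(\<Sum>i=1..?L. shift2 (w (k, i) *\<^sub>F (shift2 ^^ (?L - i)) ?y)) = \<dots>" .
qed

text \<open>Let \<open>n\<close> be the largest height that occurs. Applying the shift
  \<open>n - 1\<close> times leaves only height \<open>n\<close>, which lands on the independent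
  vectors \<open>x_l\<close>.\<close>

lemma string_map_inj:
  fixes w :: "nat \<times> nat \<Rightarrow> 'f::field"
  assumes w: "w \<in> supported (cells (plams TYPE('f) r s))" and z: "string_map r s w = 0"
  shows "w = 0"
proof (rule ccontr)
  assume "w \<noteq> 0"
  define A where "A = snd ` {y \<in> cells (plams TYPE('f) r s). w y \<noteq> 0}"
  have finA: "finite A" unfolding A_def using finite_cells by (intro finite_imageI) auto
  obtain y where y: "w y \<noteq> 0" using \<open>w \<noteq> 0\<close> by (auto simp: fun_eq_iff)
  then have "y \<in> cells (plams TYPE('f) r s)" using w unfolding supported_def by blast
  with y have "A \<noteq> {}" unfolding A_def by blast
  define n where "n = Max A"
  have "n \<in> A" unfolding n_def using finA \<open>A \<noteq> {}\<close> by (rule Max_in)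
  then obtain k where k: "(k, n) \<in> cells (plams TYPE('f) r s)" "w (k, n) \<noteq> 0" by (auto simp: A_def)
  then have k': "k < min r s" "1 \<le> n" "n \<le> plam TYPE('f) r s (Suc k)" by (auto simp: cells_def nth_plams)
  have top: "w (k', i) = 0" if "n < i" for k' i
  proof (rule ccontr)
    assume "w (k', i) \<noteq> 0"
    moreover from this have "(k', i) \<in> cells (plams TYPE('f) r s)" using w unfolding supported_def by blast
    ultimately have "(k', i) \<in> {y \<in> cells (plams TYPE('f) r s). w y \<noteq> 0}" by blast
    from imageI[OF this, of snd] have "i \<in> A" unfolding A_def snd_conv .
    from Max_ge[OF finA this] show False using that unfolding n_def by linarith
  qed
  have "0 = (shift2 ^^ (n - 1)) (string_map r s w)"
    unfolding z using shift2_pow_scale[of "n - 1" 0 "0 :: nat \<times> nat \<Rightarrow> 'f"] by (simp add: fscale_def zero_fun_def)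
  also have "\<dots> = (\<Sum>k<min r s. w (k, n) *\<^sub>F xv r s (Suc k))"
    unfolding string_map_def shift2_pow_sum
  proof (rule sum.cong[OF refl])
    fix l assume l: "l \<in> {..<min r s}"
    let ?L = "plam TYPE('f) r s (Suc l)" and ?y = "string_gen r s (Suc l) :: nat \<times> nat \<Rightarrow> 'f"
    have "(\<Sum>i=1..?L. (shift2 ^^ (n - 1)) (w (l, i) *\<^sub>F (shift2 ^^ (?L - i)) ?y)) =
        (\<Sum>i=1..?L. if i = n then w (l, n) *\<^sub>F xv r s (Suc l) else 0)"
    proof (rule sum.cong[OF refl])
      fix i assume i: "i \<in> {1..?L}"
      have p: "(shift2 ^^ (n - 1)) ((shift2 ^^ (?L - i)) ?y) =
        (if n - 1 < i - 1 then (shift2 ^^ (?L - (i - (n - 1)))) ?y else if n - 1 = i - 1 then xv r s (Suc l) else 0)"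
        by (rule shift2_pow_string) (use l i in auto)
      show "(shift2 ^^ (n - 1)) (w (l, i) *\<^sub>F (shift2 ^^ (?L - i)) ?y) = (if i = n then w (l, n) *\<^sub>F xv r s (Suc l) else 0)"
      proof (cases i n rule: linorder_cases)
        case less
        then have "(n - 1 < i - 1) = False" "(n - 1 = i - 1) = False" "(i = n) = False" using i by auto
        then show ?thesis unfolding shift2_pow_scale p by (simp only: if_False fs.scale_zero_right)
      next
        case equal
        then show ?thesis unfolding shift2_pow_scale p by simp
      next
        case greater
        then show ?thesis unfolding shift2_pow_scale top[OF greater] by simp
      qed
    qed
    also have "\<dots> = w (l, n) *\<^sub>F xv r s (Suc l)"
    proof (cases "n \<in> {1..?L}")
      case True
      then show ?thesis by (simp add: sum.delta)
    next
      case False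
      then have "(l, n) \<notin> cells (plams TYPE('f) r s)" using l by (auto simp: cells_def nth_plams)
      then have "w (l, n) = 0" using w by (simp add: supported_def)
      moreover have "(\<Sum>i=1..?L. if i = n then w (l, n) *\<^sub>F xv r s (Suc l) else 0) = 0"
        using False by (intro sum.neutral) auto
      ultimately show ?thesis by (simp only: fs.scale_zero_left)
    qed
    finally show "(\<Sum>i=1..?L. (shift2 ^^ (n - 1)) (w (l, i) *\<^sub>F (shift2 ^^ (?L - i)) ?y)) = w (l, n) *\<^sub>F xv r s (Suc l)" .
  qed
  also have "\<dots> = (\<Sum>l=1..min r s. w (l - 1, n) *\<^sub>F xv r s l)"
    by (rule sum.reindex_bij_witness[of _ "\<lambda>i. i - 1" Suc]) auto
  finally have "(\<Sum>l=1..min r s. w (l - 1, n) *\<^sub>F xv r s l) = 0" by (rule sym)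
  then have "w (Suc k - 1, n) = 0"
    using xv_independent[where c = "\<lambda>l. w (l - 1, n)" and k = "Suc k"] k' by simp
  then show False using k by simp
qed

text \<open>Induction on the power of \<open>shift2\<close> killing \<open>v\<close>. The last
  nonzero power is a combination of vectors \<open>x_l\<close>, whose strings are long enough by
  \<open>hits_of_image\<close>; subtracting the elements at height \<open>n + 1\<close> of these
  strings lowers the power.\<close>

lemma string_map_surj:
  fixes v :: "nat \<times> nat \<Rightarrow> 'f::field"
  assumes v: "v \<in> rect r s"
  shows "v \<in> string_map r s ` supported (cells (plams TYPE('f) r s))"
proof -
  let ?S = "string_map r s ` supported (cells (plams TYPE('f) r s)) :: (nat \<times> nat \<Rightarrow> 'f) set"
  have S: "fs.subspace ?S"
  proof (rule fs.subspaceI)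
    have "string_map r s (0 *\<^sub>F 0) = (0 :: nat \<times> nat \<Rightarrow> 'f)"
      unfolding string_map_scale by (simp only: fs.scale_zero_left)
    then show "0 \<in> ?S"
      using fs.subspace_0[OF supported_subspace] by (metis (no_types, lifting) fs.scale_zero_left imageI)
  next
    fix x y assume "x \<in> ?S" "y \<in> ?S"
    then obtain u w where "u \<in> supported (cells (plams TYPE('f) r s))" "x = string_map r s u"
      "w \<in> supported (cells (plams TYPE('f) r s))" "y = string_map r s w" by blast
    then show "x + y \<in> ?S"
      using string_map_add[of r s u w] fs.subspace_add[OF supported_subspace] by (metis imageI)
  next
    fix c x assume "x \<in> ?S"
    then obtain u where "u \<in> supported (cells (plams TYPE('f) r s))" "x = string_map r s u" by blast
    then show "c *\<^sub>F x \<in> ?S"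
      using string_map_scale[of r s c u] fs.subspace_scale[OF supported_subspace] by (metis imageI)
  qed
  have mem: "(shift2 ^^ (plam TYPE('f) r s (Suc l) - i)) (string_gen r s (Suc l)) \<in> ?S"
    if l: "l < min r s" and i: "1 \<le> i" "i \<le> plam TYPE('f) r s (Suc l)" for l i
  proof (rule image_eqI)
    show "delta (l, i) \<in> supported (cells (plams TYPE('f) r s))"
      using l i by (auto simp: supported_def delta_def cells_def nth_plams)
    have "string_map r s (delta (l, i)) = (\<Sum>k<min r s. if k = l then
        (shift2 ^^ (plam TYPE('f) r s (Suc l) - i)) (string_gen r s (Suc l)) else (0 :: nat \<times> nat \<Rightarrow> 'f))"
      unfolding string_map_def
    proof (rule sum.cong[OF refl])
      fix k
      have "(\<Sum>j=1..plam TYPE('f) r s (Suc k). delta (l, i) (k, j) *\<^sub>F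
          (shift2 ^^ (plam TYPE('f) r s (Suc k) - j)) (string_gen r s (Suc k))) =
        (\<Sum>j=1..plam TYPE('f) r s (Suc k). if j = i then (if k = l then
        (shift2 ^^ (plam TYPE('f) r s (Suc l) - i)) (string_gen r s (Suc l)) else (0 :: nat \<times> nat \<Rightarrow> 'f)) else 0)"
        by (rule sum.cong[OF refl]) (auto simp: delta_def fscale_def fun_eq_iff)
      also have "\<dots> = (if k = l then
        (shift2 ^^ (plam TYPE('f) r s (Suc l) - i)) (string_gen r s (Suc l)) else (0 :: nat \<times> nat \<Rightarrow> 'f))"
        using i by (cases "k = l") (simp_all add: sum.delta)
      finally show "(\<Sum>j=1..plam TYPE('f) r s (Suc k). delta (l, i) (k, j) *\<^sub>F
          (shift2 ^^ (plam TYPE('f) r s (Suc k) - j)) (string_gen r s (Suc k))) = \<dots>" .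
    qed
    then show "(shift2 ^^ (plam TYPE('f) r s (Suc l) - i)) (string_gen r s (Suc l)) = string_map r s (delta (l, i) :: nat \<times> nat \<Rightarrow> 'f)"
      using l by (simp add: sum.delta)
  qed
  have "v \<in> ?S" if "v \<in> rect r s" "(shift2 ^^ n) v = 0" for v n
    using that
  proof (induction n arbitrary: v)
    case 0
    then have "v = 0" by (simp only: funpow.simps id_apply)
    then show ?case using fs.subspace_0[OF S] by (simp only:)
  next
    case (Suc n)
    let ?u = "(shift2 ^^ n) v"
    have u: "shift2 ?u = 0" "?u \<in> rect r s" using Suc.prems shift2_pow_rect by auto
    define C where "C = {l \<in> {1..min r s}. ?u (1, l) \<noteq> 0}"
    have L: "n < plam TYPE('f) r s l" if "l \<in> C" for l
      using hits_of_image[OF Suc.prems(1) u(1), of l] that less_plam_iff[of l n "TYPE('f)" r s] by (auto simp: C_def)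
    define y where "y = (\<lambda>l. (shift2 ^^ (plam TYPE('f) r s l - Suc n)) (string_gen r s l) :: nat \<times> nat \<Rightarrow> 'f)"
    have y: "y l \<in> ?S" "(shift2 ^^ n) (y l) = xv r s l" "y l \<in> rect r s" if "l \<in> C" for l
    proof -
      have l: "l - 1 < min r s" "Suc (l - 1) = l" "1 \<le> l" "l \<le> min r s" using that by (auto simp: C_def)
      show "y l \<in> ?S" using mem[of "l - 1" "Suc n"] L[OF that] l unfolding y_def by simp
      show "(shift2 ^^ n) (y l) = xv r s l"
        using shift2_pow_string[where 'f = 'f, of "l - 1" r s "Suc n" n] L[OF that] l unfolding y_def by simp
      show "y l \<in> rect r s" unfolding y_def by (intro shift2_pow_rect string_gen(1) l(3,4))
    qed
    define w where "w = (\<Sum>l\<in>C. ?u (1, l) *\<^sub>F y l)"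
    have wS: "w \<in> ?S" unfolding w_def using y(1) S by (intro fs.subspace_sum fs.subspace_scale) auto
    have wr: "w \<in> rect r s" unfolding w_def using y(3) by (intro fs.subspace_sum fs.subspace_scale rect_subspace) auto
    have "(shift2 ^^ n) w = (\<Sum>l\<in>C. ?u (1, l) *\<^sub>F xv r s l)"
      unfolding w_def shift2_pow_sum shift2_pow_scale using y(2) by (intro sum.cong refl) simp
    also have "\<dots> = (\<Sum>l=1..min r s. ?u (1, l) *\<^sub>F xv r s l)"
      by (rule sum.mono_neutral_left) (auto simp: C_def fscale_def fun_eq_iff)
    also have "\<dots> = ?u" using shift2_ker[OF u(2,1)] by simp
    finally have wu: "(shift2 ^^ n) w = ?u" .
    have "(shift2 ^^ n) (v - w) = ?u + (shift2 ^^ n) ((- 1) *\<^sub>F w)"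
      unfolding shift2_pow_add[symmetric] by (rule arg_cong[where f = "shift2 ^^ n"]) (simp add: fun_eq_iff)
    also have "\<dots> = 0" unfolding shift2_pow_scale wu by (simp add: fun_eq_iff)
    finally have "(shift2 ^^ n) (v - w) = 0" .
    moreover have "v - w \<in> rect r s" using Suc.prems(1) wr fs.subspace_diff[OF rect_subspace] by blast
    ultimately have "v - w \<in> ?S" by (rule Suc.IH[rotated])
    from fs.subspace_add[OF S this wS] show ?case by simp
  qed
  from this[OF v shift2_nilpotent[OF v]] show ?thesis .
qed

context cyclic_p_group
begin

text \<open>\<open>(X + Y)^Q = X^Q + Y^Q\<close> is 0 modulo \<open>X^r\<close> and
  \<open>Y^s\<close>.\<close>

lemma plam_le_Q:
  assumes "s \<le> Q" "r \<le> Q" "1 \<le> l" "l \<le> min r s"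
  shows "plam TYPE('f) r s l \<le> Q"
proof (rule ccontr)
  assume "\<not> plam TYPE('f) r s l \<le> Q"
  then have "hits TYPE('f) r s l Q" using less_plam_iff[OF assms(3), of Q "TYPE('f)" r s] by simp
  then obtain u :: "'f poly" where u: "deg_le u (int r + int s - int l - 1 - int Q)"
    "\<forall>i\<in>{1..l}. coeff ([:1, 1:] ^ Q * u) (r - i) = (- 1) ^ (i - 1)" unfolding hits_def by blast
  have "[:1, 1:] ^ Q * u = u + monom 1 Q * u"
    unfolding Q frobenius_linear[OF prime_char] by (simp add: distrib_right)
  then have "coeff ([:1, 1:] ^ Q * u) (r - 1) = coeff u (r - 1)"
    using assms by (auto simp: coeff_monom_mult)
  also have "\<dots> = 0" by (rule deg_leD[OF u(1)]) (use assms in auto)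
  finally show False using u(2) assms by (auto dest: bspec[of _ _ 1])
qed

lemma tensor_iso_plams:
  assumes "r \<le> Q" "s \<le> Q"
  shows "gmodule_iso G (tensor_module (Vmod G g r :: ('g, nat \<Rightarrow> 'f) gmodule) (Vmod G g s))
    (direct_sum_module (map (Vmod G g) (plams TYPE('f) r s)))"
proof -
  let ?D = "supported (cells (plams TYPE('f) r s)) :: (nat \<times> nat \<Rightarrow> 'f) set"
  define \<Phi> where "\<Phi> = (\<lambda>w. twist 0 (string_map r s w))"
  have step: "tens_act (\<Phi> w) = \<Phi> (row_act w)" if w: "w \<in> ?D" for w
  proof -
    have "tens_act (\<Phi> w) = \<Phi> w + gminus1 G g (\<Phi> w)"
      by (simp add: gminus1_def vact_g tens_act_def)
    also have "\<dots> = \<Phi> (w + row_shift w)"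
      unfolding \<Phi>_def gminus1_twist[OF string_map_rect assms(2)] shift2_string_map[OF w] string_map_add twist_add ..
    finally show ?thesis unfolding row_act_eq[OF w] .
  qed
  have pow: "(tens_act ^^ n) (\<Phi> w) = \<Phi> ((row_act ^^ n) w)" if w: "w \<in> ?D" for w n
    by (induction n) (simp_all add: step[OF row_act_pow_supported[OF w]])
  show ?thesis
  proof (rule gmodule_iso_symI[where \<Phi> = \<Phi>], unfold mod_space_direct_sum mod_space_tensor)
    show "bij_betw \<Phi> ?D (supported ({1..r} \<times> {1..s}))"
      unfolding rect_def[symmetric]
    proof (rule bij_betwI')
      fix u w assume uw: "u \<in> ?D" "w \<in> ?D"
      show "\<Phi> u = \<Phi> w \<longleftrightarrow> u = w"
      proof
        assume "\<Phi> u = \<Phi> w"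
        then have e: "string_map r s u = string_map r s w"
          using untwist_twist[OF string_map_rect assms(2)] unfolding \<Phi>_def by metis
        have "string_map r s (u - w) = string_map r s u + string_map r s ((- 1) *\<^sub>F w)"
          unfolding string_map_add[symmetric] by (rule arg_cong[where f = "string_map r s"]) (simp add: fun_eq_iff)
        also have "\<dots> = 0" unfolding string_map_scale e by (simp add: fun_eq_iff)
        finally have "u - w = 0"
          by (rule string_map_inj[OF fs.subspace_diff[OF supported_subspace uw]])
        then show "u = w" by simp
      qed simp
    next
      fix w assume "w \<in> ?D"
      show "\<Phi> w \<in> rect r s" unfolding \<Phi>_def by (intro twist_rect string_map_rect)
    next
      fix v :: "nat \<times> nat \<Rightarrow> 'f" assume v: "v \<in> rect r s"
      obtain w where "w \<in> ?D" "untwist 0 v = string_map r s w"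
        using string_map_surj[OF untwist_rect[OF v]] by blast
      then show "\<exists>w\<in>?D. v = \<Phi> w"
        using twist_untwist[OF v assms(2)] unfolding \<Phi>_def by metis
    qed
    show "\<Phi> (u + w) = \<Phi> u + \<Phi> w" for u w
      unfolding \<Phi>_def string_map_add twist_add ..
    show "\<Phi> (c *\<^sub>F w) = c *\<^sub>F \<Phi> w" for c w
      unfolding \<Phi>_def string_map_scale twist_scale ..
    show "fs.subspace ?D" by (rule supported_subspace)
    fix h u assume u: "u \<in> ?D"
    show "\<Phi> (mod_act (direct_sum_module (map (Vmod G g) (plams TYPE('f) r s))) h u) =
        mod_act (tensor_module (Vmod G g r) (Vmod G g s)) h (\<Phi> u)"
      unfolding mod_act_direct_sum[OF u] mod_act_tensor pow[OF u] ..
    show "mod_act (direct_sum_module (map (Vmod G g) (plams TYPE('f) r s))) h u \<in> ?D"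
      unfolding mod_act_direct_sum[OF u] by (rule row_act_pow_supported[OF u])
  qed
qed

lemma tensor_parts_eq:
  assumes "r \<le> Q" "s \<le> Q"
  shows "tensor_parts TYPE('f) G g r s = plams TYPE('f) r s"
  unfolding tensor_parts_def
proof (rule the_equality)
  have sorted: "sorted_wrt (\<ge>) (plams TYPE('f) r s)"
    unfolding sorted_wrt_iff_nth_less by (auto simp: nth_plams intro!: plam_antimono)
  moreover have "0 < d \<and> d \<le> Coset.order G" if "d \<in> set (plams TYPE('f) r s)" for d
  proof -
    obtain l where l: "d = plam TYPE('f) r s l" "1 \<le> l" "l \<le> min r s"
      using \<open>d \<in> set (plams TYPE('f) r s)\<close> by (auto simp: plams_def less_Suc_eq_le simp del: upt_Suc)
    then show ?thesis using plam_pos[OF l(2,3), of "TYPE('f)"] plam_le_Q[OF assms(2,1) l(2,3)] card_G by simp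
  qed
  ultimately show "length (plams TYPE('f) r s) = min r s \<and> sorted_wrt (\<ge>) (plams TYPE('f) r s) \<and>
      (\<forall>d\<in>set (plams TYPE('f) r s). 0 < d \<and> d \<le> Coset.order G) \<and>
      gmodule_iso G (tensor_module (Vmod G g r :: ('g, nat \<Rightarrow> 'f) gmodule) (Vmod G g s))
        (direct_sum_module (map (Vmod G g) (plams TYPE('f) r s)))"
    using tensor_iso_plams[OF assms] by simp
  fix L assume L: "length L = min r s \<and> sorted_wrt (\<ge>) L \<and> (\<forall>d\<in>set L. 0 < d \<and> d \<le> Coset.order G) \<and>
      gmodule_iso G (tensor_module (Vmod G g r :: ('g, nat \<Rightarrow> 'f) gmodule) (Vmod G g s))
        (direct_sum_module (map (Vmod G g) L))"
  show "L = plams TYPE('f) r s"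
  proof (rule decreasing_eqI)
    show "card {k. k < length L \<and> i < L ! k} =
        card {k. k < length (plams TYPE('f) r s) \<and> i < plams TYPE('f) r s ! k}" for i
      using L tensor_iso_plams[OF assms] by (intro antisym iso_direct_sums_count_le) auto
  qed (use L sorted in auto)
qed

lemma lam_eq_plam:
  assumes "r \<le> Q" "s \<le> Q" "1 \<le> l" "l \<le> min r s"
  shows "lam TYPE('f) G g r s l = plam TYPE('f) r s l"
  unfolding lam_def tensor_parts_eq[OF assms(1,2)] using assms(3,4) by (subst nth_plams) auto

end

section \<open>Toeplitz matrices of binomial coefficients\<close>

lemma coeff_linear_pow: "coeff ([:1, 1:] ^ n :: 'a::comm_ring_1 poly) k = of_nat (n choose k)"
proof (induction n arbitrary: k)
  case 0
  then show ?case by (cases k) (auto simp: coeff_1)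
next
  case (Suc n)
  then show ?case unfolding power_Suc coeff_linear_mult Suc.IH by (cases k) simp_all
qed

text \<open>Exponents run backwards so that a growing row index of the matrix reads falling
  exponents.\<close>

definition tpoly :: "nat \<Rightarrow> (nat \<Rightarrow> 'a::comm_ring_1) \<Rightarrow> 'a poly"
  where "tpoly N v = (\<Sum>i<N. monom (v i) (N - 1 - i))"

lemma deg_le_tpoly: "deg_le (tpoly N v) (int N - 1)"
  unfolding tpoly_def by (intro deg_le_sum deg_le_monom) auto

lemma coeff_tpoly: "i < N \<Longrightarrow> coeff (tpoly N v) (N - 1 - i) = v i"
proof -
  assume i: "i < N"
  have "coeff (tpoly N v) (N - 1 - i) = (\<Sum>j<N. if j = i then v i else 0)"
    unfolding tpoly_def coeff_sum coeff_monom using i by (intro sum.cong) auto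
  then show ?thesis using i by simp
qed

lemma coeff_linear_pow_tpoly:
  assumes "m < N"
  shows "coeff ([:1, 1:] ^ M * tpoly N v) (D + N - 1 - m) = (\<Sum>i<N. zbinom M (int D + int i - int m) * (v i :: 'a::field))"
proof -
  have "coeff ([:1, 1:] ^ M * monom (v i) (N - 1 - i)) (D + N - 1 - m) = zbinom M (int D + int i - int m) * v i"
    if "i < N" for i
  proof -
    have "[:1, 1:] ^ M * monom (v i) (N - 1 - i) = smult (v i) (monom 1 (N - 1 - i) * [:1, 1:] ^ M)"
      by (simp add: smult_monom mult.commute flip: mult_smult_left)
    then have c: "coeff ([:1, 1:] ^ M * monom (v i) (N - 1 - i)) (D + N - 1 - m) =
        v i * (if D + N - 1 - m < N - 1 - i then 0 else of_nat (M choose (D + N - 1 - m - (N - 1 - i))))"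
      by (simp add: coeff_monom_mult coeff_linear_pow)
    show ?thesis
    proof (cases "D + N - 1 - m < N - 1 - i")
      case True
      then show ?thesis unfolding c using assms that by (auto simp: zbinom_def)
    next
      case False
      then have "D + N - 1 - m - (N - 1 - i) = nat (int D + int i - int m)" "\<not> int D + int i - int m < 0"
        using assms that by auto
      then show ?thesis unfolding c using False by (simp add: zbinom_def mult.commute)
    qed
  qed
  then show ?thesis unfolding tpoly_def sum_distrib_left coeff_sum by (intro sum.cong) auto
qed

lemma mat_inverse_of_injective:
  fixes A :: "'a::field mat"
  assumes A: "A \<in> carrier_mat n n"
    and inj: "\<And>v. v \<in> carrier_vec n \<Longrightarrow> A *\<^sub>v v = 0\<^sub>v n \<Longrightarrow> v = 0\<^sub>v n"
  shows "invertible_mat A" "the (mat_inverse A) \<in> carrier_mat n n" "A * the (mat_inverse A) = 1\<^sub>m n"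
proof -
  have "det A \<noteq> 0" using det_0_iff_vec_prod_zero_field[OF A] inj by blast
  then have "A \<in> Units (ring_mat TYPE('a) n ())" by (rule det_non_zero_imp_unit[OF A])
  then obtain B where B: "mat_inverse A = Some B"
    using mat_inverse(1)[OF A, of "()"] by (cases "mat_inverse A") auto
  note inv = mat_inverse(2)[OF A B]
  then show "the (mat_inverse A) \<in> carrier_mat n n" "A * the (mat_inverse A) = 1\<^sub>m n" by (simp_all add: B)
  show "invertible_mat A"
    unfolding invertible_mat_def inverts_mat_def using inv A by (auto simp: square_mat.simps intro!: exI[of _ B])
qed

text \<open>The matrix is multiplication by \<open>(X + 1)^M\<close> followed by reading
  \<open>N\<close> coefficients from exponent \<open>D + N - 1\<close> downwards. Injectivity on
  polynomials thus makes the matrix invertible, and the solved system is a statement about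
  coefficients.\<close>

lemma toeplitz_solve:
  fixes A X :: "'a::field mat" and b :: "nat \<Rightarrow> 'a"
  assumes A: "A = mat1 N N (\<lambda>i j. zbinom M (int D + int j - int i))"
    and inj: "\<And>w :: 'a poly. deg_le w (int N - 1) \<Longrightarrow> \<forall>m<N. coeff ([:1, 1:] ^ M * w) (D + N - 1 - m) = 0 \<Longrightarrow> w = 0"
    and X: "X = mat1 N 1 (\<lambda>i j. b i)"
  shows "invertible_mat A"
    and "\<forall>m<N. coeff ([:1, 1:] ^ M * tpoly N (\<lambda>i. entry1 (the (mat_inverse A) * X) (i + 1) 1)) (D + N - 1 - m) = b (m + 1)"
proof -
  have AC: "A \<in> carrier_mat N N" by (simp add: A mat1_def)
  have XC: "X \<in> carrier_mat N 1" by (simp add: X mat1_def)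
  have A_entry: "A $$ (m, i) = zbinom M (int D + int i - int m)" if "m < N" "i < N" for m i
    using that by (simp add: A mat1_def algebra_simps)
  have injv: "v = 0\<^sub>v N" if v: "v \<in> carrier_vec N" and z: "A *\<^sub>v v = 0\<^sub>v N" for v
  proof -
    have "tpoly N (\<lambda>i. v $ i) = 0"
    proof (rule inj[OF deg_le_tpoly], intro allI impI)
      fix m assume m: "m < N"
      have "0 = (A *\<^sub>v v) $ m" using z m by simp
      also have "\<dots> = (\<Sum>i<N. zbinom M (int D + int i - int m) * v $ i)"
        using m v AC A_entry by (simp add: scalar_prod_def atLeast0LessThan)
      finally show "coeff ([:1, 1:] ^ M * tpoly N (\<lambda>i. v $ i)) (D + N - 1 - m) = 0"
        unfolding coeff_linear_pow_tpoly[OF m] by simp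
    qed
    then have "v $ i = 0" if "i < N" for i using coeff_tpoly[OF that, of "\<lambda>i. v $ i"] by simp
    then show ?thesis using v by (intro eq_vecI) auto
  qed
  note inv = mat_inverse_of_injective[OF AC injv]
  show "invertible_mat A" by (rule inv(1))
  define Z where "Z = the (mat_inverse A) * X"
  have ZC: "Z \<in> carrier_mat N 1" using inv(2) XC by (simp add: Z_def)
  have "A * Z = (A * the (mat_inverse A)) * X"
    unfolding Z_def by (rule assoc_mult_mat[symmetric, OF AC inv(2) XC])
  also have "\<dots> = X" using inv(3) XC by simp
  finally have AZ: "A * Z = X" .
  show "\<forall>m<N. coeff ([:1, 1:] ^ M * tpoly N (\<lambda>i. entry1 (the (mat_inverse A) * X) (i + 1) 1)) (D + N - 1 - m) = b (m + 1)"
  proof (intro allI impI)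
    fix m assume m: "m < N"
    have "b (m + 1) = (A * Z) $$ (m, 0)" unfolding AZ using m by (simp add: X mat1_def)
    also have "\<dots> = (\<Sum>i<N. zbinom M (int D + int i - int m) * Z $$ (i, 0))"
      using m AC ZC A_entry by (simp add: scalar_prod_def atLeast0LessThan)
    finally show "coeff ([:1, 1:] ^ M * tpoly N (\<lambda>i. entry1 (the (mat_inverse A) * X) (i + 1) 1)) (D + N - 1 - m) = b (m + 1)"
      unfolding coeff_linear_pow_tpoly[OF m] by (simp add: entry1_def Z_def)
  qed
qed

section \<open>Translating the definitions\<close>

context cyclic_p_group
begin

lemma Dspace_eq:
  "Dspace G g c r s d = twist c ` supported ({1..r} \<times> {1..s} \<inter> {(i, j). i + j = d + 1})"
  (is "_ = twist c ` supported ?B")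
proof
  have gen: "{tbasis G g c i j | i j. i \<in> {1..r} \<and> j \<in> {1..s} \<and> i + j = d + 1} = (\<lambda>x. twist c (delta x)) ` ?B"
  proof (intro equalityI subsetI)
    fix x assume "x \<in> (\<lambda>x. twist c (delta x)) ` ?B"
    then obtain i j where "i \<in> {1..r}" "j \<in> {1..s}" "i + j = d + 1" "x = twist c (delta (i, j))" by auto
    moreover from this have "x = tbasis G g c i j" by (simp add: tbasis_eq_twist)
    ultimately show "x \<in> {tbasis G g c i j | i j. i \<in> {1..r} \<and> j \<in> {1..s} \<and> i + j = d + 1}" by blast
  qed (auto simp: tbasis_eq_twist)
  have fin: "finite ?B" by (rule finite_subset[of _ "{1..r} \<times> {1..s}"]) auto
  show "Dspace G g c r s d \<subseteq> twist c ` supported ?B"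
    unfolding Dspace_def gen
  proof (rule fs.span_minimal)
    show "(\<lambda>x. twist c (delta x)) ` ?B \<subseteq> twist c ` supported ?B"
      by (auto simp: supported_def delta_def intro!: imageI split: if_splits)
    show "fs.subspace (twist c ` supported ?B)"
    proof (rule fs.subspaceI)
      show "0 \<in> twist c ` supported ?B"
        using fs.subspace_0[OF supported_subspace] twist_0 by (metis imageI)
    next
      fix x y assume "x \<in> twist c ` supported ?B" "y \<in> twist c ` supported ?B"
      then obtain u w where "u \<in> supported ?B" "x = twist c u" "w \<in> supported ?B" "y = twist c w" by blast
      then show "x + y \<in> twist c ` supported ?B"
        using twist_add[of c u w] fs.subspace_add[OF supported_subspace] by (metis imageI)
    next
      fix z x assume "x \<in> twist c ` supported ?B"
      then obtain u where "u \<in> supported ?B" "x = twist c u" by blast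
      then show "z *\<^sub>F x \<in> twist c ` supported ?B"
        using twist_scale[of c z u] fs.subspace_scale[OF supported_subspace] by (metis imageI)
    qed
  qed
  show "twist c ` supported ?B \<subseteq> Dspace G g c r s d"
    unfolding Dspace_def gen
  proof safe
    fix u :: "nat \<times> nat \<Rightarrow> 'f" assume "u \<in> supported ?B"
    from supported_expand[OF fin this] have "twist c u = (\<Sum>x\<in>?B. u x *\<^sub>F twist c (delta x))"
      by (metis (no_types, lifting) sum.cong twist_scale twist_sum)
    then show "twist c u \<in> fs.span ((\<lambda>x. twist c (delta x)) ` ?B)"
      by (metis (no_types, lifting) fs.span_base fs.span_scale fs.span_sum imageI)
  qed
qed

lemma gminus1_Dspace:
  fixes u :: "nat \<times> nat \<Rightarrow> 'f"
  assumes "s \<le> Q" "u \<in> Dspace G g c r s (Suc d)"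
  shows "gminus1 G g u \<in> Dspace G g c r s d"
proof -
  obtain w where w: "w \<in> supported ({1..r} \<times> {1..s} \<inter> {(i, j). i + j = Suc d + 1})" "u = twist c w"
    using assms(2) unfolding Dspace_eq by blast
  then have wr: "w \<in> rect r s" by (auto simp: rect_def supported_def)
  have "shift2 w \<in> supported ({1..r} \<times> {1..s} \<inter> {(i, j). i + j = d + 1})"
    using w(1) by (auto simp: shift2_def supported_def)
  then show ?thesis unfolding w(2) gminus1_twist[OF wr assms(1)] Dspace_eq by (rule imageI)
qed

lemma gminus1_pow_Dspace:
  fixes u :: "nat \<times> nat \<Rightarrow> 'f"
  assumes "s \<le> Q" "u \<in> Dspace G g c r s (d + n)"
  shows "(gminus1 G g ^^ n) u \<in> Dspace G g c r s d"
  using assms(2)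
proof (induction n arbitrary: u)
  case (Suc n)
  have "gminus1 G g u \<in> Dspace G g c r s (d + n)"
    using gminus1_Dspace[OF assms(1)] Suc.prems by simp
  from Suc.IH[OF this] show ?case by (simp only: funpow_Suc_right o_apply)
qed simp

lemma twist_pvec_Dspace: "d + n + 1 = r + s \<Longrightarrow> twist c (pvec r s n f) \<in> Dspace G g c r s d"
  unfolding Dspace_eq by (rule imageI) (auto simp: supported_def pvec_def)

lemma xvec_eq:
  assumes "1 \<le> l" "l \<le> min r s"
  shows "xvec G g c l = twist c (xv r s l)"
proof -
  have "(\<Sum>i=1..l. (- 1) ^ (i - 1) *\<^sub>F delta (i, l + 1 - i)) = (xv r s l :: nat \<times> nat \<Rightarrow> 'f)"
  proof
    fix x :: "nat \<times> nat"
    obtain i j where x: "x = (i, j)" by (cases x)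
    have "(\<Sum>i=1..l. (- 1) ^ (i - 1) *\<^sub>F delta (i, l + 1 - i)) (i, j) =
        (\<Sum>i'=1..l. if i' = i then (if i + j = Suc l then (- 1) ^ (i - 1) else 0) else (0 :: 'f))"
      unfolding sum_fun_apply fscale_apply by (rule sum.cong[OF refl]) (auto simp: delta_def)
    also have "\<dots> = (if i \<in> {1..l} \<and> i + j = Suc l then (- 1) ^ (i - 1) else 0)" by auto
    also have "\<dots> = xv r s l (i, j)" unfolding xv_apply[OF assms] by auto
    finally show "(\<Sum>i=1..l. (- 1) ^ (i - 1) *\<^sub>F delta (i, l + 1 - i)) x = (xv r s l x :: 'f)" by (simp only: x)
  qed
  moreover have "xvec G g c l = (\<Sum>i=1..l. (- 1) ^ (i - 1) *\<^sub>F twist c (delta (i, l + 1 - i)))"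
    unfolding xvec_def by (rule sum.cong[OF refl]) (auto simp: tbasis_eq_twist)
  ultimately show ?thesis by (simp only: twist_scale[symmetric] twist_sum[symmetric])
qed

lemma pvec_eq_xv:
  assumes "1 \<le> l" "l \<le> min r s"
  shows "pvec r s (r + s - l - 1) f = xv r s l \<longleftrightarrow> (\<forall>k\<in>{1..l}. coeff f (r - k) = (- 1) ^ (k - 1))"
proof -
  have "pvec r s (r + s - l - 1) f = xv r s l \<longleftrightarrow> (\<forall>m<r. m \<le> r + s - l - 1 \<longrightarrow> r + s - l - 1 < m + s \<longrightarrow> coeff f m = coeff (xpoly r l) m)"
    unfolding xv_def pvec_eq_iff pvec_eq_0_iff by simp
  also have "\<dots> \<longleftrightarrow> (\<forall>k\<in>{1..l}. coeff f (r - k) = coeff (xpoly r l) (r - k))"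
  proof safe
    fix k assume a: "\<forall>m<r. m \<le> r + s - l - 1 \<longrightarrow> r + s - l - 1 < m + s \<longrightarrow> coeff f m = coeff (xpoly r l) m" and k: "k \<in> {1..l}"
    show "coeff f (r - k) = coeff (xpoly r l) (r - k)"
      by (rule a[rule_format]) (use k assms in auto)
  next
    fix m assume a: "\<forall>k\<in>{1..l}. coeff f (r - k) = coeff (xpoly r l) (r - k)" and m: "m < r" "r + s - l - 1 < m + s"
    have "r - m \<in> {1..l}" "r - (r - m) = m" using m assms by auto
    with a[rule_format, of "r - m"] show "coeff f m = coeff (xpoly r l) m" by simp
  qed
  also have "\<dots> \<longleftrightarrow> (\<forall>k\<in>{1..l}. coeff f (r - k) = (- 1) ^ (k - 1))"
  proof (rule ball_cong[OF refl])
    fix k assume k: "k \<in> {1..l}"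
    then have "r - k < r" "r - l \<le> r - k" "r - (r - k) - 1 = k - 1" using assms by auto
    then show "coeff f (r - k) = coeff (xpoly r l) (r - k) \<longleftrightarrow> coeff f (r - k) = (- 1) ^ (k - 1)"
      using assms by (simp add: coeff_xpoly)
  qed
  finally show ?thesis .
qed

lemma gminus1_pow_pvec:
  assumes "s \<le> Q" "deg_le f (int d)"
  shows "(gminus1 G g ^^ n) (twist c (pvec r s d f)) = twist c (pvec r s (d + n) ([:1, 1:] ^ n * f))"
  unfolding gminus1_pow_twist[OF pvec_rect assms(1)] shift2_pow_pvec[OF assms(2)] ..

lemma gminus1_pow_eq_xvec_iff:
  assumes "s \<le> Q" "deg_le f (int d)" "1 \<le> l" "l \<le> min r s" "d + n + l + 1 = r + s"
  shows "(gminus1 G g ^^ n) (twist c (pvec r s d f)) = xvec G g c l \<longleftrightarrow>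
    (\<forall>k\<in>{1..l}. coeff ([:1, 1:] ^ n * f) (r - k) = (- 1) ^ (k - 1))"
proof -
  have d: "d + n = r + s - l - 1" using assms(5) by simp
  have "twist c u = twist c w \<longleftrightarrow> u = w" if "u \<in> rect r s" "w \<in> rect r s" for u w
    using untwist_twist[OF that(1) assms(1)] untwist_twist[OF that(2) assms(1)] by metis
  then show ?thesis
    unfolding gminus1_pow_pvec[OF assms(1,2)] xvec_eq[OF assms(3,4)] d
    using pvec_eq_xv[OF assms(3,4)] pvec_rect xv_rect by metis
qed

lemma tbasis_double_sum:
  assumes "finite I" "finite J"
    and "\<And>i j. i \<in> I \<Longrightarrow> j \<in> J \<Longrightarrow> rw i j \<in> {1..r} \<and> cl i j \<in> {1..s} \<and>
      r - rw i j = q * e i + (w + h j) \<and> (r - rw i j) + (s - cl i j) = d"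
  shows "(\<Sum>i\<in>I. \<alpha> i *\<^sub>F (\<Sum>j\<in>J. \<beta> j *\<^sub>F tbasis G g c (rw i j) (cl i j))) =
    twist c (pvec r s d (pcompose (\<Sum>i\<in>I. monom (\<alpha> i) (e i)) (monom 1 q) * (monom 1 w * (\<Sum>j\<in>J. monom (\<beta> j) (h j)))))"
proof -
  have "pcompose (\<Sum>i\<in>I. monom (\<alpha> i) (e i)) (monom 1 q) * (monom 1 w * (\<Sum>j\<in>J. monom (\<beta> j) (h j))) =
      (\<Sum>i\<in>I. \<Sum>j\<in>J. monom (\<alpha> i * \<beta> j) (q * e i + (w + h j)))"
    unfolding pcompose_sum pcompose_monom sum_distrib_left sum_distrib_right
    by (simp add: mult_monom sum_distrib_left) (rule sum.swap)
  then have "twist c (pvec r s d (pcompose (\<Sum>i\<in>I. monom (\<alpha> i) (e i)) (monom 1 q) * (monom 1 w * (\<Sum>j\<in>J. monom (\<beta> j) (h j))))) =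
      (\<Sum>i\<in>I. \<Sum>j\<in>J. twist c (pvec r s d (monom (\<alpha> i * \<beta> j) (q * e i + (w + h j)))))"
    by (simp only: pvec_sum twist_sum)
  also have "\<dots> = (\<Sum>i\<in>I. \<Sum>j\<in>J. \<alpha> i *\<^sub>F (\<beta> j *\<^sub>F tbasis G g c (rw i j) (cl i j)))"
  proof (intro sum.cong refl)
    fix i j assume "i \<in> I" "j \<in> J"
    from assms(3)[OF this] have ij: "rw i j \<in> {1..r}" "cl i j \<in> {1..s}"
      "q * e i + (w + h j) = r - rw i j" "d = (r - rw i j) + (s - cl i j)" by (blast, blast, metis, metis)
    have "r - rw i j < r" "s - cl i j < s" "r - (r - rw i j) = rw i j" "s - (s - cl i j) = cl i j"
      using ij(1,2) by auto
    then have "pvec r s d (monom (\<alpha> i * \<beta> j) (q * e i + (w + h j))) = (\<alpha> i * \<beta> j) *\<^sub>F delta (rw i j, cl i j)"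
      unfolding ij(3,4) using pvec_monom[of "r - rw i j" r "s - cl i j" s] by metis
    moreover have "tbasis G g c (rw i j) (cl i j) = twist c (delta (rw i j, cl i j))"
      using ij(1,2) by (intro tbasis_eq_twist) auto
    ultimately show "twist c (pvec r s d (monom (\<alpha> i * \<beta> j) (q * e i + (w + h j)))) =
        \<alpha> i *\<^sub>F (\<beta> j *\<^sub>F tbasis G g c (rw i j) (cl i j))"
      by (simp only: twist_scale fs.scale_scale)
  qed
  finally show ?thesis by (simp only: fs.scale_sum_right)
qed

lemma block_first_last:
  assumes "r \<le> Q" "s \<le> Q" "1 \<le> l" "l \<le> min r s"
  shows "block TYPE('f) r s (first_eq TYPE('f) G g r s l) (last_eq TYPE('f) G g r s l) (lam TYPE('f) G g r s l)"
    "first_eq TYPE('f) G g r s l \<le> l" "l \<le> last_eq TYPE('f) G g r s l"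
proof -
  have "{i \<in> {1..min r s}. lam TYPE('f) G g r s i = lam TYPE('f) G g r s l} =
      {i \<in> {1..min r s}. plam TYPE('f) r s i = plam TYPE('f) r s l}"
    using lam_eq_plam[OF assms(1,2)] assms(3,4) by auto
  then show "block TYPE('f) r s (first_eq TYPE('f) G g r s l) (last_eq TYPE('f) G g r s l) (lam TYPE('f) G g r s l)"
    "first_eq TYPE('f) G g r s l \<le> l" "l \<le> last_eq TYPE('f) G g r s l"
    using blockI[OF assms(3,4), of "TYPE('f)"] lam_eq_plam[OF assms] unfolding first_eq_def last_eq_def by metis+
qed

lemma block_unique:
  assumes "block TYPE('f) r s i j L" "block TYPE('f) r s i' j' L'" "i \<le> l" "l \<le> j" "i' \<le> l" "l \<le> j'"
  shows "i' = i" "j' = j"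
proof -
  have L: "L' = L" using plam_in_block[OF assms(1,3,4)] plam_in_block[OF assms(2,5,6)] by simp
  have "k \<in> {i..j} \<longleftrightarrow> k \<in> {i'..j'}" if "k \<in> {1..min r s}" for k
    using assms(1,2) that unfolding block_def L by blast
  moreover have "i \<in> {1..min r s}" "j \<in> {1..min r s}" "i' \<in> {1..min r s}" "j' \<in> {1..min r s}"
    using assms(1,2) by (auto simp: block_def)
  ultimately have "i \<in> {i'..j'}" "j \<in> {i'..j'}" "i' \<in> {i..j}" "j' \<in> {i..j}"
    using assms(1,2) unfolding block_def by (meson atLeastAtMost_iff order_refl)+
  then show "i' = i" "j' = j" by auto
qed

text \<open>Uniqueness in the definite description is \<open>block_ker_eq_0\<close>: two solutions
  differ by a form killed by \<open>(X + Y)^(L-1)\<close>.\<close>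

lemma Jcoeff_eq:
  fixes u :: "'f poly"
  assumes rs: "r \<le> Q" "s \<le> Q" and b: "block TYPE('f) r s i j L" and u: "block_gen r s i j L u"
  shows "Jcoeff G g c r s i = (\<lambda>m. if m \<in> {1..i} then coeff u (i - m) else 0)"
proof -
  have ij: "1 \<le> i" "i \<le> j" "j \<le> min r s" and L: "1 \<le> L" and len: "L + i + j = r + s + 1"
    using b block_pos[OF b] block_length[OF b] by (auto simp: block_def)
  have lam: "lam TYPE('f) G g r s i = L" using lam_eq_plam[OF rs, of i] plam_in_block[OF b, of i] ij by simp
  define P where "P = (\<lambda>cf. \<Sum>m=1..i. monom (cf m) (i - m) :: 'f poly)"
  have dP: "deg_le (P cf) (int (i - 1))" for cf
    unfolding P_def by (intro deg_le_sum deg_le_monom) auto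
  have cP: "coeff (P cf) (i - m) = cf m" if "m \<in> {1..i}" for cf m
  proof -
    have "coeff (P cf) (i - m) = (\<Sum>m'=1..i. if m' = m then cf m else 0)"
      unfolding P_def coeff_sum coeff_monom using that by (intro sum.cong) auto
    then show ?thesis using that by simp
  qed
  have y: "(\<Sum>m=1..i. cf m *\<^sub>F tbasis G g c (r - i + m) (s + 1 - m)) = twist c (pvec r s (i - 1) (P cf))" for cf
  proof -
    \<comment> \<open>A single sum, viewed as a double sum over a one-point set.\<close>
    have "(\<Sum>n\<in>{()}. (1::'f) *\<^sub>F (\<Sum>m\<in>{1..i}. cf m *\<^sub>F tbasis G g c (r - i + m) (s + 1 - m))) =
      twist c (pvec r s (i - 1) (pcompose (\<Sum>n\<in>{()}. monom 1 0) (monom 1 1) * (monom 1 0 * (\<Sum>m\<in>{1..i}. monom (cf m) (i - m)))))"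
      by (rule tbasis_double_sum) (use ij in auto)
    then show ?thesis by (simp add: P_def monom_0 one_pCons del: One_nat_def)
  qed
  have mem: "twist c (pvec r s (i - 1) f) \<in> Dspace G g c r s (r + s - i)" for f
    by (rule twist_pvec_Dspace) (use ij in auto)
  have j: "r + s + 1 - i - L = j" using len by simp
  have eq: "(gminus1 G g ^^ (L - 1)) (twist c (pvec r s (i - 1) (P cf))) = xvec G g c j \<longleftrightarrow> P cf = u" for cf
  proof
    assume "(gminus1 G g ^^ (L - 1)) (twist c (pvec r s (i - 1) (P cf))) = xvec G g c j"
    moreover have "i - 1 + (L - 1) + j + 1 = r + s" using len L ij by simp
    ultimately have a: "\<forall>k\<in>{1..j}. coeff ([:1, 1:] ^ (L - 1) * P cf) (r - k) = (- 1) ^ (k - 1)"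
      using gminus1_pow_eq_xvec_iff[OF rs(2) dP, of j r "L - 1"] ij by auto
    have "P cf - u = 0"
    proof (rule block_ker_eq_0[OF b])
      show "deg_le (P cf - u) (int i - 1)"
        using dP[of cf] u ij by (auto simp: block_gen_def of_nat_diff intro!: deg_le_diff)
      show "vanishes r s (int i - 2 + int L) ([:1, 1:] ^ (L - 1) * (P cf - u))"
        unfolding vanishes_def
      proof (intro allI impI)
        fix m assume m: "m < r" "int i - 2 + int L - int s < int m"
        then have k: "r - m \<in> {1..j}" "r - (r - m) = m" using len by auto
        have "coeff ([:1, 1:] ^ (L - 1) * P cf) (r - (r - m)) = coeff ([:1, 1:] ^ (L - 1) * u) (r - (r - m))"
          using a u k(1) unfolding block_gen_def by metis
        then show "coeff ([:1, 1:] ^ (L - 1) * (P cf - u)) m = 0"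
          unfolding right_diff_distrib k(2) by simp
      qed
    qed
    then show "P cf = u" by simp
  next
    assume "P cf = u"
    moreover have "i - 1 + (L - 1) + j + 1 = r + s" using len L ij by simp
    ultimately show "(gminus1 G g ^^ (L - 1)) (twist c (pvec r s (i - 1) (P cf))) = xvec G g c j"
      using gminus1_pow_eq_xvec_iff[OF rs(2) dP, of j r "L - 1"] ij u by (auto simp: block_gen_def)
  qed
  let ?cf = "\<lambda>m. if m \<in> {1..i} then coeff u (i - m) else 0"
  have Pu: "P ?cf = u"
  proof (rule poly_eqI)
    fix n
    show "coeff (P ?cf) n = coeff u n"
    proof (cases "n < i")
      case True
      then show ?thesis using cP[of "i - n" ?cf] by auto
    next
      case False
      then have "coeff (P ?cf) n = 0" "coeff u n = 0"
        using dP[of ?cf] u ij by (auto simp: block_gen_def deg_le_def)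
      then show ?thesis by simp
    qed
  qed
  show ?thesis
    unfolding Jcoeff_def Let_def lam y j
  proof (rule the_equality)
    show "(\<forall>m. m \<notin> {1..i} \<longrightarrow> ?cf m = 0) \<and> twist c (pvec r s (i - 1) (P ?cf)) \<in> Dspace G g c r s (r + s - i) \<and>
        (gminus1 G g ^^ (L - 1)) (twist c (pvec r s (i - 1) (P ?cf))) = xvec G g c j"
    proof (intro conjI allI impI mem)
      show "(gminus1 G g ^^ (L - 1)) (twist c (pvec r s (i - 1) (P ?cf))) = xvec G g c j" using eq Pu by blast
    qed auto
    fix cf assume cf: "(\<forall>m. m \<notin> {1..i} \<longrightarrow> cf m = 0) \<and> twist c (pvec r s (i - 1) (P cf)) \<in> Dspace G g c r s (r + s - i) \<and>
        (gminus1 G g ^^ (L - 1)) (twist c (pvec r s (i - 1) (P cf))) = xvec G g c j"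
    then have "P cf = u" using eq by blast
    then show "cf = ?cf" using cP[of _ cf] cf by (auto simp: fun_eq_iff)
  qed
qed

text \<open>Rules (i) and (ii) together are multiplication of the block generator by
  \<open>(-X)^(k-i)\<close>; the zeros of (ii) are the coefficients below that power.\<close>

lemma entry1_Jmat:
  fixes u :: "'f poly"
  assumes rs: "r \<le> Q" "s \<le> Q" and b: "block TYPE('f) r s i j L" and u: "block_gen r s i j L u"
    and k: "i \<le> k" "k \<le> j" and m: "m \<in> {1..k}"
  shows "entry1 (Jmat G g c r s) (k + 1 - m) m = coeff (monom ((- 1) ^ (k - i)) (k - i) * u) (k - m)"
proof -
  have ij: "1 \<le> i" "i \<le> j" "j \<le> min r s" using b by (auto simp: block_def)
  have k1: "1 \<le> k" "k \<le> min r s" using k ij by auto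
  have first: "first_eq TYPE('f) G g r s k = i"
    using block_unique(1)[OF b block_first_last(1)[OF rs k1] k block_first_last(2,3)[OF rs k1]] .
  have J: "entry1 (Jmat G g c r s :: 'f mat) (k + 1 - m) m = (if k = i then Jcoeff G g c r s k m
      else if m \<le> i then (- 1) ^ (k - i) * Jcoeff G g c r s i m else 0)"
  proof -
    have "k + 1 - m - 1 < r" "m - 1 < s" "k + 1 - m - 1 + 1 + (m - 1 + 1) - 1 = k" "m - 1 + 1 = m"
      using m k1 by auto
    then have "entry1 (Jmat G g c r s :: 'f mat) (k + 1 - m) m = (if min r s < k then 0
        else if k = first_eq TYPE('f) G g r s k then Jcoeff G g c r s k m
        else if m \<le> first_eq TYPE('f) G g r s k
        then (- 1) ^ (k - first_eq TYPE('f) G g r s k) * Jcoeff G g c r s (first_eq TYPE('f) G g r s k) m else 0)"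
      by (simp add: entry1_def Jmat_def mat1_def Let_def)
    moreover have "\<not> min r s < k" using k1(2) by (rule leD)
    ultimately show ?thesis unfolding first by (simp only: if_False)
  qed
  have c: "coeff (monom ((- 1) ^ (k - i)) (k - i) * u) (k - m) =
      (if m \<le> i then (- 1) ^ (k - i) * coeff u (i - m) else 0)"
  proof -
    have "monom ((- 1) ^ (k - i)) (k - i) = smult ((- 1) ^ (k - i)) (monom (1::'f) (k - i))"
      by (simp add: smult_monom)
    moreover have "k - m - (k - i) = i - m" "k - m < k - i \<longleftrightarrow> \<not> m \<le> i" using m k by auto
    ultimately show ?thesis by (simp add: coeff_monom_mult)
  qed
  show ?thesis unfolding J c using m by (auto simp: Jcoeff_eq[OF rs b u])
qed

lemma Jmat_poly:
  fixes u :: "'f poly"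
  assumes rs: "r \<le> Q" "s \<le> Q" and b: "block TYPE('f) r s i j L" and u: "block_gen r s i j L u"
    and k: "i \<le> k" "k \<le> j"
  shows "(\<Sum>m=1..k. monom (entry1 (Jmat G g c r s) (k + 1 - m) m) (k - m)) = monom ((- 1) ^ (k - i)) (k - i) * u"
proof (rule poly_eqI)
  fix n
  have "coeff (\<Sum>m=1..k. monom (entry1 (Jmat G g c r s) (k + 1 - m) m) (k - m)) n =
      (\<Sum>m=1..k. if m = k - n then (if n < k then coeff (monom ((- 1) ^ (k - i)) (k - i) * u) n else 0) else 0)"
    unfolding coeff_sum coeff_monom
  proof (rule sum.cong[OF refl])
    fix m assume m: "m \<in> {1..k}"
    then have "k - m = n \<longleftrightarrow> m = k - n \<and> n < k" by auto
    then show "(if k - m = n then entry1 (Jmat G g c r s) (k + 1 - m) m else 0) =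
        (if m = k - n then (if n < k then coeff (monom ((- 1) ^ (k - i)) (k - i) * u) n else 0) else 0)"
      using entry1_Jmat[OF rs b u k m] m by auto
  qed
  also have "\<dots> = (if n < k then coeff (monom ((- 1) ^ (k - i)) (k - i) * u) n else 0)"
    by auto
  also have "\<dots> = coeff (monom ((- 1) ^ (k - i)) (k - i) * u) n"
  proof (cases "n < k")
    case False
    have "deg_le (monom ((- 1) ^ (k - i)) (k - i) * u) (int (k - i) + (int i - 1))"
      using u by (intro deg_le_mult deg_le_monom) (auto simp: block_gen_def)
    then have "coeff (monom ((- 1) ^ (k - i)) (k - i) * u) n = 0"
      by (rule deg_leD) (use False k in auto)
    then show ?thesis by simp
  qed simp
  finally show "coeff (\<Sum>m=1..k. monom (entry1 (Jmat G g c r s) (k + 1 - m) m) (k - m)) n =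
      coeff (monom ((- 1) ^ (k - i)) (k - i) * u) n" .
qed

end

lemma vanishes_monom_mult:
  fixes f :: "'a::comm_ring_1 poly"
  assumes "vanishes r s d f"
  shows "vanishes r s (d + int m) (monom c m * f)"
proof -
  obtain A B where AB: "f = monom 1 r * A + B" "deg_le B (d - int s)" using assms by (auto simp: vanishes_iff)
  have "monom c m * f = monom 1 r * (monom c m * A) + monom c m * B"
    unfolding AB(1) by (simp only: distrib_left mult.left_commute)
  moreover have "deg_le (monom c m * B) (int m + (d - int s))"
    by (intro deg_le_mult deg_le_monom AB(2)) simp
  then have "deg_le (monom c m * B) (d + int m - int s)" by (rule deg_le_mono) simp
  ultimately show ?thesis unfolding vanishes_iff by blast
qed

lemma deg_le_Theta: "t = 0 \<or> int n \<le> d \<Longrightarrow> deg_le (Theta n t) d"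
  unfolding Theta_def by (cases "t = 0") (auto intro!: deg_le_sum deg_le_monom)

lemma (in carry) deg_le_Z: "deg_le Z (int (t * q + i) - 1 + int (M * q))"
proof -
  let ?d = "int q * int rn + int i - 1"
  have "deg_le (pcompose (Theta rn (Suc t)) xq * a) (int q * int rn + (int i - 1))"
    using a(1) by (intro deg_le_mult deg_le_pcompose deg_le_Theta) (simp_all add: block_gen_def)
  then have 1: "deg_le (pcompose (Theta rn (Suc t)) xq * a) ?d" by (rule deg_le_mono) simp
  have "deg_le (pcompose (Theta (rn - 1) t) xq * (monom 1 R * b))
      (int q * (int rn - 1) + (int R + (int i + int q - int R - int S - 1)))"
    using t'(1) by (intro deg_le_mult deg_le_pcompose deg_le_Theta deg_le_monom b) auto
  then have 2: "deg_le (pcompose (Theta (rn - 1) t) xq * (monom 1 R * b)) ?d"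
    by (rule deg_le_mono) (simp add: algebra_simps)
  have "deg_le Z ?d" unfolding Z_def by (rule deg_le_add[OF 1 2])
  then show ?thesis
  proof (rule deg_le_mono)
    have "M * q + 2 * t * q = rn * q + sn * q" using t'(3) by (simp flip: distrib_right)
    then have "rn * q \<le> t * q + M * q" using mult_le_mono1[OF t'(2), of q] by linarith
    then have "int (rn * q) \<le> int (t * q + M * q)" by (simp only: of_nat_le_iff)
    then show "int q * int rn + int i - 1 \<le> int (t * q + i) - 1 + int (M * q)" by (simp add: algebra_simps)
  qed
qed

section \<open>Index arithmetic, with the multiples of \<open>p^n\<close> as atoms to make it
  linear\<close>

lemma index_z1:
  fixes A B C X Y T W R S k j :: nat
  assumes "A + B = X" "C + A = T" "T \<le> Y" "W + T + T = X + Y" "k \<le> R" "k \<le> S" "1 \<le> j" "j \<le> k"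
  shows "A + (R - k) + j \<in> {1..X + R} \<and> C + S + 1 - j \<in> {1..Y + S} \<and>
    X + R - (A + (R - k) + j) = B + (0 + (k - j)) \<and>
    (X + R - (A + (R - k) + j)) + (Y + S - (C + S + 1 - j)) = W + (T + k) - 1"
  unfolding atLeastAtMost_iff using assms by (intro conjI) linarith+

lemma index_z2:
  fixes A B C C' X Y T W R S k j u w :: nat
  assumes "A + w + B = X" "C + A = T" "C' + w = C" "T \<le> Y" "W + T + T = X + Y" "k \<le> R" "k \<le> S" "u + R + S = k + w" "1 \<le> j" "j \<le> u"
  shows "A + R + S + j - k \<in> {1..X + R} \<and> C + 1 - j \<in> {1..Y + S} \<and>
    X + R - (A + R + S + j - k) = B + (R + (u - j)) \<and>
    (X + R - (A + R + S + j - k)) + (Y + S - (C + 1 - j)) = W + (T + k) - 1"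
  unfolding atLeastAtMost_iff using assms by (intro conjI) linarith+

lemma index_y1:
  fixes A B C I X Y T R S k j :: nat
  assumes "A + B = X" "B + I = T" "C + I = Y" "k \<le> R" "k \<le> S" "1 \<le> j" "j \<le> k"
  shows "A + R + j - k \<in> {1..X + R} \<and> C + S + 1 - j \<in> {1..Y + S} \<and>
    X + R - (A + R + j - k) = B + (0 + (k - j)) \<and>
    (X + R - (A + R + j - k)) + (Y + S - (C + S + 1 - j)) = T + k - 1"
  unfolding atLeastAtMost_iff using assms by (intro conjI) linarith+

lemma index_y2:
  fixes A B C C' I X Y T R S k j u w :: nat
  assumes "A + w + B = X" "w + B + I = T" "C + I = Y" "C' + w = C" "k \<le> R" "k \<le> S" "u + R + S = k + w" "1 \<le> j" "j \<le> u"
  shows "A + R + S + j - k \<in> {1..X + R} \<and> C + 1 - j \<in> {1..Y + S} \<and>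
    X + R - (A + R + S + j - k) = B + (R + (u - j)) \<and>
    (X + R - (A + R + S + j - k)) + (Y + S - (C + 1 - j)) = T + k - 1"
  unfolding atLeastAtMost_iff using assms by (intro conjI) linarith+

theorem proposition3:
  fixes G :: "('g, 'b) monoid_scheme" and g :: 'g
    and p a q r s n r\<^sub>n s\<^sub>n R S m l t k k' :: nat and e c c\<^sub>A c\<^sub>D :: int
    and v :: "nat \<Rightarrow> nat \<Rightarrow> (nat \<times> nat \<Rightarrow> 'f::field)"
    and x :: "nat \<Rightarrow> (nat \<times> nat \<Rightarrow> 'f)"
    and D :: "nat \<Rightarrow> (nat \<times> nat \<Rightarrow> 'f) set"
    and g1 :: "(nat \<times> nat \<Rightarrow> 'f) \<Rightarrow> (nat \<times> nat \<Rightarrow> 'f)"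
    and lm \<mu> :: "nat \<Rightarrow> nat"
    and JA JD P Q Xc Yc \<zeta> \<eta> :: "'f mat"
    and z y :: "nat \<times> nat \<Rightarrow> 'f"
  assumes "prime p" and "CHAR('f) = p" and "0 < a" and "q = p ^ a"
    and "group G" and "g \<in> carrier G" and "carrier G = generate G {g}" and "Coset.order G = q"
    and "1 \<le> r" and "r \<le> q" and "1 \<le> s" and "s \<le> q"
    and "p ^ n \<le> max r s" and "max r s < p ^ (n + 1)"
    and "r = r\<^sub>n * p ^ n + R" and "r\<^sub>n < p" and "R < p ^ n"
    and "s = s\<^sub>n * p ^ n + S" and "s\<^sub>n < p" and "S < p ^ n"
    and "m = min R S" and "e = int R + int S - int (p ^ n)"
    and v: "v = tbasis G g c" and x: "x = xvec G g c" and D: "D = Dspace G g c r s"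
    and g1: "g1 = gminus1 G g"
    and lm: "lm = lam TYPE('f) G g r s" and \<mu>: "\<mu> = lam TYPE('f) G g R S"
    and k': "k' = first_eq TYPE('f) G g R S k + last_eq TYPE('f) G g R S k - k"
    and "l = t * p ^ n + k" and "1 \<le> k" and "k \<le> p ^ n"
    and "max (int r + int s - int (p ^ (n + 1))) 0 + 1 \<le> int l" and "l \<le> min r s"
    and "m > 0" and "t \<le> min r\<^sub>n s\<^sub>n" and "max e 0 + 1 \<le> int k" and "k \<le> m"
    and JA: "JA = Jmat G g c\<^sub>A R S" and JD: "JD = Jmat G g c\<^sub>D (p ^ n - R) (p ^ n - S)"
    and z: "z =
      (\<Sum>i=0..t. (-1) ^ i *\<^sub>F (\<Sum>j=1..k. entry1 JA (k + 1 - j) j *\<^sub>F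
          v (i * p ^ n + (R - k) + j) ((t - i) * p ^ n + S + 1 - j)))
      + (-1) ^ R *\<^sub>F (\<Sum>i=0..<t. (-1) ^ i *\<^sub>F
          (\<Sum>j=1..nat (int k - e). entry1 JD (nat (int k - e) + 1 - j) j *\<^sub>F
             v (i * p ^ n + R + S + j - k) ((t - i) * p ^ n + 1 - j)))"
    and P: "P = mat1 (t + 1) (t + 1)
              (\<lambda>i j. zbinom (r\<^sub>n + s\<^sub>n - 2 * t) (int r\<^sub>n - int t + int j - int i))"
    and Q: "Q = mat1 t t
              (\<lambda>i j. zbinom (r\<^sub>n + s\<^sub>n - 2 * t) (int r\<^sub>n - int t + int j - int i))"
    and Xc: "Xc = mat1 (t + 1) 1 (\<lambda>i j. (-1) ^ (i - 1))"
    and Yc: "Yc = mat1 t 1 (\<lambda>i j. (-1) ^ (i - 1))"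
    and \<zeta>: "\<zeta> = the (mat_inverse P) * Xc" and \<eta>: "\<eta> = the (mat_inverse Q) * Yc"
    and y: "y =
      (\<Sum>i=0..t. entry1 \<zeta> (i + 1) 1 *\<^sub>F (\<Sum>j=1..k. entry1 JA (k + 1 - j) j *\<^sub>F
          v ((r\<^sub>n - t + i) * p ^ n + R + j - k) ((s\<^sub>n - i) * p ^ n + S + 1 - j)))
      + (-1) ^ R *\<^sub>F (\<Sum>i=0..<t. entry1 \<eta> (i + 1) 1 *\<^sub>F
          (\<Sum>j=1..nat (int k - e). entry1 JD (nat (int k - e) + 1 - j) j *\<^sub>F
             v ((r\<^sub>n - t + i) * p ^ n + R + S + j - k) ((s\<^sub>n - i) * p ^ n + 1 - j)))"
  shows "lm l = (r\<^sub>n + s\<^sub>n - 2 * t) * p ^ n + \<mu> k \<and>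
    (g1 ^^ ((r\<^sub>n + s\<^sub>n - 2 * t) * p ^ n)) ` D ((r\<^sub>n + s\<^sub>n - t) * p ^ n + R + S - k)
           \<subseteq> D (t * p ^ n + R + S - k) \<and>
    z \<in> D (t * p ^ n + R + S - k) \<and> (g1 ^^ (\<mu> k - 1)) z = x (t * p ^ n + k') \<and>
    invertible_mat P \<and> invertible_mat Q \<and>
         y \<in> D ((r\<^sub>n + s\<^sub>n - t) * p ^ n + R + S - k) \<and>
         (g1 ^^ ((r\<^sub>n + s\<^sub>n - 2 * t) * p ^ n)) y = z"
proof -
  define w where "w = p ^ n"
  note P1 = \<open>prime p\<close> \<open>CHAR('f) = p\<close>
  interpret C: cyclic_p_group G g q a "TYPE('f)"
    using \<open>prime p\<close> \<open>CHAR('f) = p\<close> \<open>0 < a\<close> \<open>q = p ^ a\<close> \<open>group G\<close> \<open>g \<in> carrier G\<close>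
      \<open>carrier G = generate G {g}\<close> \<open>Coset.order G = q\<close>
    by (simp add: cyclic_p_group_def cyclic_p_group_axioms_def)
  have frob: "[:1, 1:] ^ w = (1 + monom 1 w :: 'f poly)"
    using frobenius_linear[of n, where 'f = 'f] P1 unfolding w_def by simp
  have Rw: "R < w" and Sw: "S < w" and r: "r = r\<^sub>n * w + R" and s: "s = s\<^sub>n * w + S"
    using \<open>R < p ^ n\<close> \<open>S < p ^ n\<close> \<open>r = r\<^sub>n * p ^ n + R\<close> \<open>s = s\<^sub>n * p ^ n + S\<close> by (simp_all add: w_def)
  have wq: "w \<le> q" using \<open>p ^ n \<le> max r s\<close> \<open>r \<le> q\<close> \<open>s \<le> q\<close> by (simp add: w_def)
  have Rq: "R \<le> q" and Sq: "S \<le> q" using Rw Sw wq by auto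
  have k: "1 \<le> k" "k \<le> min R S" using \<open>1 \<le> k\<close> \<open>k \<le> m\<close> \<open>m = min R S\<close> by auto
  have t: "t \<le> min r\<^sub>n s\<^sub>n" by fact
  have l: "l = t * w + k" using \<open>l = t * p ^ n + k\<close> by (simp add: w_def)
  define i where "i = first_eq TYPE('f) G g R S k"
  define j where "j = last_eq TYPE('f) G g R S k"
  define L where "L = lam TYPE('f) G g R S k"
  have bl: "block TYPE('f) R S i j L" and ik: "i \<le> k" and kj: "k \<le> j"
    unfolding i_def j_def L_def using C.block_first_last[OF Rq Sq k] by simp_all
  have ij: "1 \<le> i" "i \<le> j" "j \<le> min R S" using bl by (auto simp: block_def)
  have ke: "R + S < k + w" using \<open>max e 0 + 1 \<le> int k\<close> \<open>e = int R + int S - int (p ^ n)\<close>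
    unfolding w_def by linarith
  \<comment> \<open>The bound on \<open>k\<close> passes to the first index of its block, since
    equal parts lie on the same side of the threshold \<open>w\<close>.\<close>
  have ie: "R + S < i + w"
  proof (rule ccontr)
    assume "\<not> R + S < i + w"
    then have "w \<le> plam TYPE('f) R S i" using ij by (subst le_plam_frobenius_iff[OF frob Rw Sw]) auto
    then have "w \<le> plam TYPE('f) R S k" using plam_in_block[OF bl] ik kj ij by simp
    then show False using le_plam_frobenius_iff[OF frob Rw Sw k] ke by simp
  qed
  obtain ua :: "'f poly" where ua: "block_gen R S i j L ua" "poly ua (- 1) \<noteq> 0"
    using block_gen_exists[OF bl] .
  obtain f h b where fhb:
    "deg_le f (int S - int j - 1)" "deg_le h (int R - int j - 1)" "deg_le b (int i + int w - int R - int S - 1)"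
    "[:1, 1:] ^ L * ua = monom 1 R * (1 + [:1, 1:] * f) + (monom ((- 1) ^ (j - 1)) (R - j) + [:1, 1:] * h)"
    "[:1, 1:] ^ L * b = (1 + [:1, 1:] * f) - monom 1 (w - R) * (monom ((- 1) ^ (j - 1)) (R - j) + [:1, 1:] * h)"
    "monom 1 R * b = ua - [:1, 1:] ^ (w - L) * (monom ((- 1) ^ (j - 1)) (R - j) + [:1, 1:] * h)"
    "L < w"
    using block_syzygy[OF frob Rw Sw bl ie ua(1)] .
  have tr: "t \<le> r\<^sub>n" "t \<le> s\<^sub>n" using t by auto
  \<comment> \<open>As \<open>k <= R\<close>, the bound \<open>l > r + s - p^(n+1)\<close> gives
    \<open>(r_n + s_n - t) w < p w\<close>.\<close>
  have char: "r\<^sub>n + s\<^sub>n - t < CHAR('f)"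
  proof -
    have "int r + int s - int (p * w) + 1 \<le> int (t * w) + int k"
      using \<open>max (int r + int s - int (p ^ (n + 1))) 0 + 1 \<le> int l\<close> unfolding l w_def by simp
    then have "r\<^sub>n * w + s\<^sub>n * w + R + S + 1 \<le> t * w + k + p * w"
      unfolding r s by (simp flip: of_nat_add of_nat_mult)
    moreover have "r\<^sub>n * w + s\<^sub>n * w = (r\<^sub>n + s\<^sub>n - t) * w + t * w"
      using tr by (simp flip: distrib_right)
    ultimately have "(r\<^sub>n + s\<^sub>n - t) * w < p * w" using k unfolding min.bounded_iff by linarith
    then show ?thesis using P1 by simp
  qed
  let ?M = "r\<^sub>n + s\<^sub>n - 2 * t"
  have P': "P = mat1 (t + 1) (t + 1) (\<lambda>i j. zbinom ?M (int (r\<^sub>n - t) + int j - int i))"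
    unfolding P using tr by (simp add: of_nat_diff)
  have Q': "Q = mat1 t t (\<lambda>i j. zbinom ?M (int (r\<^sub>n - t) + int j - int i))"
    unfolding Q using tr by (simp add: of_nat_diff)
  have injP: "u = 0" if "deg_le u (int (t + 1) - 1)"
    "\<forall>m<t + 1. coeff ([:1, 1:] ^ ?M * u) (r\<^sub>n - t + (t + 1) - 1 - m) = 0" for u :: "'f poly"
    by (rule binomial_window_injective[OF t char]) (use that tr in \<open>auto simp: less_Suc_eq_le\<close>)
  \<comment> \<open>\<open>Q\<close> is the matrix \<open>P\<close> for \<open>r_n - 1\<close>,
    \<open>s_n - 1\<close>, \<open>t - 1\<close>, which have the same binomial top
    \<open>r_n + s_n - 2 t\<close>; for \<open>t = 0\<close> it is empty.\<close>
  have injQ: "u = 0" if u: "deg_le u (int t - 1)"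
    "\<forall>m<t. coeff ([:1, 1:] ^ ?M * u) (r\<^sub>n - t + t - 1 - m) = 0" for u :: "'f poly"
  proof (cases "t = 0")
    case True
    then show ?thesis using u(1) by (auto intro: deg_le_neg)
  next
    case False
    have M: "r\<^sub>n - 1 + (s\<^sub>n - 1) - 2 * (t - 1) = ?M" using False tr by auto
    show ?thesis
    proof (rule binomial_window_injective[of "t - 1" "r\<^sub>n - 1" "s\<^sub>n - 1"])
      show "\<forall>m\<le>t - 1. coeff ([:1, 1:] ^ (r\<^sub>n - 1 + (s\<^sub>n - 1) - 2 * (t - 1)) * u) (r\<^sub>n - 1 - m) = 0"
      proof (intro allI impI)
        fix m assume "m \<le> t - 1"
        then have "m < t" "r\<^sub>n - t + t - 1 - m = r\<^sub>n - 1 - m" using False tr by auto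
        then show "coeff ([:1, 1:] ^ (r\<^sub>n - 1 + (s\<^sub>n - 1) - 2 * (t - 1)) * u) (r\<^sub>n - 1 - m) = 0"
          using u(2) unfolding M by metis
      qed
    qed (use u(1) False tr char in \<open>auto simp: of_nat_diff\<close>)
  qed
  define \<zeta>p where "\<zeta>p = tpoly (t + 1) (\<lambda>i. entry1 \<zeta> (i + 1) 1)"
  define \<eta>p where "\<eta>p = tpoly t (\<lambda>i. entry1 \<eta> (i + 1) 1)"
  have invP: "invertible_mat P" and \<zeta>p: "\<forall>m<t + 1. coeff ([:1, 1:] ^ ?M * \<zeta>p) (r\<^sub>n - t + (t + 1) - 1 - m) = (- 1) ^ (m + 1 - 1)"
    using toeplitz_solve[OF P' injP, of Xc "\<lambda>i. (- 1) ^ (i - 1)"] Xc unfolding \<zeta>p_def \<zeta> by blast+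
  have invQ: "invertible_mat Q" and \<eta>p: "\<forall>m<t. coeff ([:1, 1:] ^ ?M * \<eta>p) (r\<^sub>n - t + t - 1 - m) = (- 1) ^ (m + 1 - 1)"
    using toeplitz_solve[OF Q' injQ, of Yc "\<lambda>i. (- 1) ^ (i - 1)"] Yc unfolding \<eta>p_def \<eta> by blast+
  have \<zeta>w: "\<forall>m\<le>t. coeff ([:1, 1:] ^ ?M * \<zeta>p) (r\<^sub>n - m) = (- 1) ^ m"
  proof (intro allI impI)
    fix m assume "m \<le> t"
    then have "m < t + 1" "r\<^sub>n - t + (t + 1) - 1 - m = r\<^sub>n - m" using tr by auto
    then show "coeff ([:1, 1:] ^ ?M * \<zeta>p) (r\<^sub>n - m) = (- 1) ^ m" using \<zeta>p by (metis diff_add_inverse2)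
  qed
  have \<eta>w: "\<forall>m<t. coeff ([:1, 1:] ^ ?M * \<eta>p) (r\<^sub>n - 1 - m) = (- 1) ^ m"
  proof (intro allI impI)
    fix m assume "m < t"
    then have "m < t" "r\<^sub>n - t + t - 1 - m = r\<^sub>n - 1 - m" using tr by auto
    then show "coeff ([:1, 1:] ^ ?M * \<eta>p) (r\<^sub>n - 1 - m) = (- 1) ^ m" using \<eta>p by (metis diff_add_inverse2)
  qed
  interpret A: carry w R S r\<^sub>n s\<^sub>n t i j L ua f h b \<zeta>p \<eta>p
  proof
    show "deg_le \<zeta>p (int t)" using deg_le_tpoly[of "t + 1"] unfolding \<zeta>p_def by simp
    show "deg_le \<eta>p (int t - 1)" unfolding \<eta>p_def by (rule deg_le_tpoly)
  qed (use frob Rw Sw t char bl ie fhb ua \<zeta>w \<eta>w in simp_all)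
  have M: "A.M = ?M" by (simp add: A.M_def)
  \<comment> \<open>The passage \<open>(-X)^(k-i)\<close> from the first index of the block to
    \<open>k\<close>, a common factor of \<open>z\<close> and \<open>y\<close>.\<close>
  define sg where "sg = (monom ((- 1) ^ (k - i)) (k - i) :: 'f poly)"
  have polyA: "(\<Sum>j=1..k. monom (entry1 JA (k + 1 - j) j) (k - j)) = sg * ua"
    unfolding JA sg_def by (rule C.Jmat_poly[OF Rq Sq bl ua(1) ik kj])
  define kd where "kd = nat (int k - e)"
  have kd: "kd = k + w - R - S" 
  proof -
    have "e = int R + int S - int w" unfolding w_def by fact
    then have "int k - e = int (k + w - R - S)" using ke by auto
    then show ?thesis unfolding kd_def by (simp only: nat_int)
  qed
  \<comment> \<open>The dual block starts at \<open>i - e\<close>, so \<open>k - e\<close> is at the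
    same distance \<open>k - i\<close> from its start and the same factor \<open>sg\<close>
    appears.\<close>
  have polyD: "(\<Sum>j=1..kd. monom (entry1 JD (kd + 1 - j) j) (kd - j)) = sg * smult ((- 1) ^ R) b"
  proof -
    have "kd - (i + w - R - S) = k - i" using ie ik by (simp add: kd)
    moreover have "(\<Sum>j=1..kd. monom (entry1 (Jmat G g c\<^sub>D (w - R) (w - S)) (kd + 1 - j) j) (kd - j)) =
        monom ((- 1) ^ (kd - (i + w - R - S))) (kd - (i + w - R - S)) * smult ((- 1) ^ R) b"
      by (rule C.Jmat_poly[OF _ _ block_dual[OF frob Rw Sw bl ie] dual_block_gen[OF frob Rw Sw bl ie fhb(1,3,5)]])
         (use wq ik kj in \<open>auto simp: kd\<close>)
    ultimately show ?thesis unfolding JD sg_def by (simp add: w_def)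
  qed
  have sgn: "smult ((- 1) ^ R) (smult ((- 1) ^ R) u) = u" for u :: "'f poly"
    by (simp flip: power_mult_distrib)
  define X Y T W where "X = r\<^sub>n * w" and "Y = s\<^sub>n * w" and "T = t * w" and "W = ?M * w"
  have le: "T \<le> X" "T \<le> Y" "W + T + T = X + Y"
  proof -
    show "T \<le> X" "T \<le> Y" unfolding X_def Y_def T_def using tr by (simp_all add: mult_le_mono1)
    have "?M + t + t = r\<^sub>n + s\<^sub>n" using tr by simp
    from arg_cong[OF this, of "\<lambda>a. a * w"] show "W + T + T = X + Y"
      unfolding X_def Y_def T_def W_def by (simp only: distrib_right)
  qed
  have split: "a * w + b * w = c * w" if "a + b = c" for a b c
    using that by (simp flip: distrib_right)
  have split3: "a * w + w + b * w = c * w" if "a + 1 + b = c" for a b c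
    using that by (auto simp: distrib_right)
  have lT: "l = T + k" "r = X + R" "s = Y + S" by (simp_all add: l r s T_def X_def Y_def)
  let ?E = "\<lambda>f. pcompose f (monom 1 w)"
  have kb: "k \<le> R" "k \<le> S" "1 \<le> k" "kd + R + S = k + w" using k ke kd by auto
  have z_eq: "z = C.twist c (pvec r s (W + l - 1) (sg * A.Z))"
  proof -
    have "(\<Sum>i=0..t. (-1) ^ i *\<^sub>F (\<Sum>j=1..k. entry1 JA (k + 1 - j) j *\<^sub>F
          tbasis G g c (i * p ^ n + (R - k) + j) ((t - i) * p ^ n + S + 1 - j))) =
        C.twist c (pvec r s (W + l - 1) (?E (\<Sum>i=0..t. monom ((-1) ^ i) (r\<^sub>n - i)) *
          (monom 1 0 * (\<Sum>j=1..k. monom (entry1 JA (k + 1 - j) j) (k - j)))))"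
    proof (rule C.tbasis_double_sum)
      fix i j assume ij: "i \<in> {0..t}" "j \<in> {1..k}"
      have 1: "i * w + (r\<^sub>n - i) * w = X" and 2: "(t - i) * w + i * w = T"
        unfolding X_def T_def using ij tr by (auto intro!: split)
      have "1 \<le> j" "j \<le> k" using ij by auto
      from index_z1[OF 1 2 le(2,3) kb(1,2) this] show "i * p ^ n + (R - k) + j \<in> {1..r} \<and> (t - i) * p ^ n + S + 1 - j \<in> {1..s} \<and>
          r - (i * p ^ n + (R - k) + j) = w * (r\<^sub>n - i) + (0 + (k - j)) \<and>
          (r - (i * p ^ n + (R - k) + j)) + (s - ((t - i) * p ^ n + S + 1 - j)) = W + l - 1"
        unfolding lT w_def[symmetric] mult.commute[of w] .
    qed auto
    moreover have "(\<Sum>i=0..<t. (-1) ^ i *\<^sub>F (\<Sum>j=1..kd. entry1 JD (kd + 1 - j) j *\<^sub>F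
          tbasis G g c (i * p ^ n + R + S + j - k) ((t - i) * p ^ n + 1 - j))) =
        C.twist c (pvec r s (W + l - 1) (?E (\<Sum>i=0..<t. monom ((-1) ^ i) (r\<^sub>n - 1 - i)) *
          (monom 1 R * (\<Sum>j=1..kd. monom (entry1 JD (kd + 1 - j) j) (kd - j)))))"
    proof (rule C.tbasis_double_sum)
      fix i j assume ij: "i \<in> {0..<t}" "j \<in> {1..kd}"
      have 1: "i * w + w + (r\<^sub>n - 1 - i) * w = X"
        unfolding X_def by (rule split3) (use ij tr in auto)
      have 2: "(t - i) * w + i * w = T" unfolding T_def by (rule split) (use ij in auto)
      have "(t - 1 - i) * w + 1 * w = (t - i) * w" by (rule split) (use ij in auto)
      then have 3: "(t - 1 - i) * w + w = (t - i) * w" by simp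
      have "1 \<le> j" "j \<le> kd" using ij by auto
      from index_z2[OF 1 2 3 le(2,3) kb(1,2,4) this] show "i * p ^ n + R + S + j - k \<in> {1..r} \<and> (t - i) * p ^ n + 1 - j \<in> {1..s} \<and>
          r - (i * p ^ n + R + S + j - k) = w * (r\<^sub>n - 1 - i) + (R + (kd - j)) \<and>
          (r - (i * p ^ n + R + S + j - k)) + (s - ((t - i) * p ^ n + 1 - j)) = W + l - 1"
        unfolding lT w_def[symmetric] mult.commute[of w] .
    qed auto
    ultimately have "z = C.twist c (pvec r s (W + l - 1) (?E (\<Sum>i=0..t. monom ((-1) ^ i) (r\<^sub>n - i)) * (monom 1 0 * (sg * ua))
        + smult ((-1) ^ R) (?E (\<Sum>i=0..<t. monom ((-1) ^ i) (r\<^sub>n - 1 - i)) * (monom 1 R * (sg * smult ((- 1) ^ R) b)))))"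
      unfolding z v kd_def[symmetric] polyA polyD pvec_add pvec_smult C.twist_add C.twist_scale by (simp only:)
    also have "?E (\<Sum>i=0..t. monom ((-1) ^ i) (r\<^sub>n - i)) * (monom 1 0 * (sg * ua))
        + smult ((-1) ^ R) (?E (\<Sum>i=0..<t. monom ((-1) ^ i) (r\<^sub>n - 1 - i)) * (monom 1 R * (sg * smult ((- 1) ^ R) b))) = sg * A.Z"
      unfolding A.Z_def Theta_def mult_smult_right sgn atLeast0AtMost atLeast0LessThan lessThan_Suc_atMost
      by (simp add: algebra_simps flip: one_pCons)
    finally show ?thesis .
  qed
  have y_eq: "y = C.twist c (pvec r s (l - 1) (sg * A.Y))"
  proof -
    have "(\<Sum>i=0..t. entry1 \<zeta> (i + 1) 1 *\<^sub>F (\<Sum>j=1..k. entry1 JA (k + 1 - j) j *\<^sub>F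
          tbasis G g c ((r\<^sub>n - t + i) * p ^ n + R + j - k) ((s\<^sub>n - i) * p ^ n + S + 1 - j))) =
        C.twist c (pvec r s (l - 1) (?E (\<Sum>i=0..t. monom (entry1 \<zeta> (i + 1) 1) (t + 1 - 1 - i)) *
          (monom 1 0 * (\<Sum>j=1..k. monom (entry1 JA (k + 1 - j) j) (k - j)))))"
    proof (rule C.tbasis_double_sum)
      fix i j assume ij: "i \<in> {0..t}" "j \<in> {1..k}"
      have 1: "(r\<^sub>n - t + i) * w + (t + 1 - 1 - i) * w = X" and 2: "(t + 1 - 1 - i) * w + i * w = T"
        and 3: "(s\<^sub>n - i) * w + i * w = Y"
        unfolding X_def T_def Y_def by (rule split, use ij tr in auto)+
      have "1 \<le> j" "j \<le> k" using ij by auto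
      from index_y1[OF 1 2 3 kb(1,2) this] show "(r\<^sub>n - t + i) * p ^ n + R + j - k \<in> {1..r} \<and> (s\<^sub>n - i) * p ^ n + S + 1 - j \<in> {1..s} \<and>
          r - ((r\<^sub>n - t + i) * p ^ n + R + j - k) = w * (t + 1 - 1 - i) + (0 + (k - j)) \<and>
          (r - ((r\<^sub>n - t + i) * p ^ n + R + j - k)) + (s - ((s\<^sub>n - i) * p ^ n + S + 1 - j)) = l - 1"
        unfolding lT w_def[symmetric] mult.commute[of w] .
    qed auto
    moreover have "(\<Sum>i=0..<t. entry1 \<eta> (i + 1) 1 *\<^sub>F (\<Sum>j=1..kd. entry1 JD (kd + 1 - j) j *\<^sub>F
          tbasis G g c ((r\<^sub>n - t + i) * p ^ n + R + S + j - k) ((s\<^sub>n - i) * p ^ n + 1 - j))) =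
        C.twist c (pvec r s (l - 1) (?E (\<Sum>i=0..<t. monom (entry1 \<eta> (i + 1) 1) (t - 1 - i)) *
          (monom 1 R * (\<Sum>j=1..kd. monom (entry1 JD (kd + 1 - j) j) (kd - j)))))"
    proof (rule C.tbasis_double_sum)
      fix i j assume ij: "i \<in> {0..<t}" "j \<in> {1..kd}"
      have 1: "(r\<^sub>n - t + i) * w + w + (t - 1 - i) * w = X"
        unfolding X_def by (rule split3) (use ij tr in auto)
      have "0 * w + w + (t - 1) * w = T" unfolding T_def by (rule split3) (use ij in auto)
      moreover have "(t - 1 - i) * w + i * w = (t - 1) * w" by (rule split) (use ij in auto)
      ultimately have 2: "w + (t - 1 - i) * w + i * w = T" by simp
      have 3: "(s\<^sub>n - i) * w + i * w = Y" unfolding Y_def by (rule split) (use ij tr in auto)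
      have "(s\<^sub>n - 1 - i) * w + 1 * w = (s\<^sub>n - i) * w" by (rule split) (use ij tr in auto)
      then have 4: "(s\<^sub>n - 1 - i) * w + w = (s\<^sub>n - i) * w" by simp
      have "1 \<le> j" "j \<le> kd" using ij by auto
      from index_y2[OF 1 2 3 4 kb(1,2,4) this] show "(r\<^sub>n - t + i) * p ^ n + R + S + j - k \<in> {1..r} \<and> (s\<^sub>n - i) * p ^ n + 1 - j \<in> {1..s} \<and>
          r - ((r\<^sub>n - t + i) * p ^ n + R + S + j - k) = w * (t - 1 - i) + (R + (kd - j)) \<and>
          (r - ((r\<^sub>n - t + i) * p ^ n + R + S + j - k)) + (s - ((s\<^sub>n - i) * p ^ n + 1 - j)) = l - 1"
        unfolding lT w_def[symmetric] mult.commute[of w] .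
    qed auto
    ultimately have "y = C.twist c (pvec r s (l - 1) (?E (\<Sum>i=0..t. monom (entry1 \<zeta> (i + 1) 1) (t + 1 - 1 - i)) * (monom 1 0 * (sg * ua))
        + smult ((-1) ^ R) (?E (\<Sum>i=0..<t. monom (entry1 \<eta> (i + 1) 1) (t - 1 - i)) * (monom 1 R * (sg * smult ((- 1) ^ R) b)))))"
      unfolding y v kd_def[symmetric] polyA polyD pvec_add pvec_smult C.twist_add C.twist_scale by (simp only:)
    also have "(\<Sum>i=0..t. monom (entry1 \<zeta> (i + 1) 1) (t + 1 - 1 - i)) = \<zeta>p"
      unfolding \<zeta>p_def tpoly_def by (simp add: atLeast0AtMost lessThan_Suc_atMost)
    also have "(\<Sum>i=0..<t. monom (entry1 \<eta> (i + 1) 1) (t - 1 - i)) = \<eta>p"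
      unfolding \<eta>p_def tpoly_def by (simp only: atLeast0LessThan)
    also have "?E \<zeta>p * (monom 1 0 * (sg * ua)) + smult ((-1) ^ R) (?E \<eta>p * (monom 1 R * (sg * smult ((- 1) ^ R) b))) = sg * A.Y"
      unfolding A.Y_def mult_smult_right sgn by (simp add: algebra_simps flip: one_pCons)
    finally show ?thesis .
  qed
  have dY: "deg_le (sg * A.Y) (int (l - 1))"
  proof -
    have "deg_le (sg * A.Y) (int (k - i) + (int (t * w + i) - 1))"
      unfolding sg_def by (intro deg_le_mult deg_le_monom A.deg_le_Y) simp
    then show ?thesis by (rule deg_le_mono) (use ik ij in \<open>auto simp: l\<close>)
  qed
  have W: "A.M * w = W" by (simp add: M W_def)
  have dZ: "deg_le (sg * A.Z) (int (W + l - 1))"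
  proof -
    have "deg_le (sg * A.Z) (int (k - i) + (int (t * w + i) - 1 + int (A.M * w)))"
      unfolding sg_def by (intro deg_le_mult deg_le_monom A.deg_le_Z) simp
    then show ?thesis by (rule deg_le_mono) (use ik ij in \<open>auto simp: l W\<close>)
  qed
  have sq: "s \<le> q" and rq: "r \<le> q" by fact+
  have g1_y: "(g1 ^^ W) y = z"
  proof -
    have "(g1 ^^ W) y = C.twist c (pvec r s (l - 1 + W) ([:1, 1:] ^ W * (sg * A.Y)))"
      unfolding g1 y_eq by (rule C.gminus1_pow_pvec[OF sq dY])
    also have "l - 1 + W = W + l - 1" using k l by simp
    \<comment> \<open>The two polynomials agree only modulo \<open>X^r\<close> and
      \<open>Y^s\<close>, which is all that \<open>pvec\<close> sees.\<close>
    also have "pvec r s (W + l - 1) ([:1, 1:] ^ W * (sg * A.Y)) = pvec r s (W + l - 1) (sg * A.Z)"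
    proof -
      have "[:1, 1:] ^ W * (sg * A.Y) - sg * A.Z = sg * ([:1, 1:] ^ (A.M * w) * A.Y - A.Z)"
        unfolding W by (simp only: right_diff_distrib mult.left_commute)
      moreover have "vanishes r s (int (t * w + i) - 1 + int (A.M * w) + int (k - i)) (sg * ([:1, 1:] ^ (A.M * w) * A.Y - A.Z))"
        unfolding sg_def r s by (rule vanishes_monom_mult[OF A.Y_image])
      moreover have "int (t * w + i) - 1 + int (A.M * w) + int (k - i) = int (W + l - 1)"
        unfolding W l using ik ij by (simp add: of_nat_diff)
      ultimately have v: "vanishes r s (int (W + l - 1)) ([:1, 1:] ^ W * (sg * A.Y) - sg * A.Z)" by simp
      have "deg_le ([:1, 1:] ^ W * (sg * A.Y)) (int (W + l - 1))"
        unfolding deg_le_linear_power_mult_iff by (rule deg_le_mono[OF dY]) (use k l in simp)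
      then show ?thesis
        unfolding pvec_eq_iff using pvec_eq_0_iff_vanishes[OF deg_le_diff[OF _ dZ]] v by blast
    qed
    finally show ?thesis unfolding z_eq .
  qed
  have k'_eq: "k' = i + j - k" unfolding k' i_def j_def ..
  have L1: "1 \<le> L" and len: "L + i + j = R + S + 1" using block_pos[OF bl] block_length[OF bl] by auto
  have \<mu>L: "\<mu> k = L" unfolding \<mu> L_def ..
  have g1_z: "(g1 ^^ (\<mu> k - 1)) z = x (T + k')"
    unfolding g1 x z_eq \<mu>L
  proof (rule C.gminus1_pow_eq_xvec_iff[OF sq dZ, THEN iffD2])
    show "1 \<le> T + k'" "T + k' \<le> min r s" using ij ik kj le k unfolding k'_eq lT by auto
    show "W + l - 1 + (L - 1) + (T + k') + 1 = r + s"
      using ij ik kj le len L1 unfolding k'_eq lT by auto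
    show "\<forall>\<kappa>\<in>{1..T + k'}. coeff ([:1, 1:] ^ (L - 1) * (sg * A.Z)) (r - \<kappa>) = (- 1) ^ (\<kappa> - 1)"
    proof
      fix \<kappa> assume \<kappa>: "\<kappa> \<in> {1..T + k'}"
      \<comment> \<open>The factor \<open>X^(k-i)\<close> shifts the window, and
        \<open>k' + (k - i) = j\<close>.\<close>
      then have in_range: "\<kappa> + (k - i) \<in> {1..t * w + j}" using ik kj ij unfolding k'_eq T_def by auto
      have "t * w + j \<le> r" using le ij unfolding lT T_def by auto
      then have idx: "\<not> r - \<kappa> < k - i" "r - \<kappa> - (k - i) = r\<^sub>n * w + R - (\<kappa> + (k - i))"
        using in_range r by auto
      have "[:1, 1:] ^ (L - 1) * (sg * A.Z) = smult ((- 1) ^ (k - i)) (monom 1 (k - i) * ([:1, 1:] ^ (L - 1) * A.Z))"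
      proof -
        have "sg = smult ((- 1) ^ (k - i)) (monom 1 (k - i))" by (simp add: sg_def smult_monom)
        then show ?thesis by (simp only: mult_smult_left mult_smult_right mult.left_commute)
      qed
      then have "coeff ([:1, 1:] ^ (L - 1) * (sg * A.Z)) (r - \<kappa>) =
          (- 1) ^ (k - i) * coeff ([:1, 1:] ^ (L - 1) * A.Z) (r\<^sub>n * w + R - (\<kappa> + (k - i)))"
        using idx by (simp only: coeff_smult coeff_monom_mult if_False mult_1)
      also have "\<dots> = (- 1) ^ (k - i) * (- 1) ^ (\<kappa> + (k - i) - 1)"
        unfolding A.coeff_Z_image[OF in_range] ..
      also have "\<dots> = (- 1) ^ (2 * (k - i) + (\<kappa> - 1))"
        unfolding power_add[symmetric] using \<kappa> by (intro arg_cong[where f = "(^) (- 1)"]) auto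
      also have "\<dots> = (- 1) ^ (\<kappa> - 1)" by (simp add: power_add)
      finally show "coeff ([:1, 1:] ^ (L - 1) * (sg * A.Z)) (r - \<kappa>) = (- 1) ^ (\<kappa> - 1)" .
    qed
  qed
  have lam_l: "lm l = W + \<mu> k"
  proof -
    have "lm l = plam TYPE('f) r s l"
      unfolding lm by (rule C.lam_eq_plam[OF rq sq]) (use k l \<open>l \<le> min r s\<close> in auto)
    also have "\<dots> = A.M * w + L" unfolding l r s by (rule A.plam_carry[OF ik kj])
    finally show ?thesis unfolding W \<mu>L .
  qed
  have total: "(r\<^sub>n + s\<^sub>n - t) * w = T + W"
  proof -
    have "(r\<^sub>n + s\<^sub>n - t) * w + t * w = (r\<^sub>n + s\<^sub>n) * w" using tr by (intro split) simp
    then show ?thesis using le by (simp add: T_def X_def Y_def distrib_right)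
  qed
  have D_image: "(g1 ^^ W) ` D ((r\<^sub>n + s\<^sub>n - t) * w + R + S - k) \<subseteq> D (T + R + S - k)"
  proof
    fix u assume "u \<in> (g1 ^^ W) ` D ((r\<^sub>n + s\<^sub>n - t) * w + R + S - k)"
    then obtain u' where u': "u' \<in> D ((r\<^sub>n + s\<^sub>n - t) * w + R + S - k)" "u = (g1 ^^ W) u'" by blast
    have "(r\<^sub>n + s\<^sub>n - t) * w + R + S - k = T + R + S - k + W" using total kb by simp
    then show "u \<in> D (T + R + S - k)"
      using u' C.gminus1_pow_Dspace[OF sq] unfolding D g1 by metis
  qed
  have z_mem: "z \<in> D (T + R + S - k)"
    unfolding D z_eq by (rule C.twist_pvec_Dspace) (use le kb in \<open>auto simp: lT\<close>)
  have y_mem: "y \<in> D ((r\<^sub>n + s\<^sub>n - t) * w + R + S - k)"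
    unfolding D y_eq total by (rule C.twist_pvec_Dspace) (use le kb in \<open>auto simp: lT\<close>)
  show ?thesis
    using lam_l D_image z_mem g1_z invP invQ y_mem g1_y
    unfolding W_def T_def w_def by blast
qed

end
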